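(* Let $\xi\in\mathcal{DM}^\infty(\mathbb{R}^2)$ and let $S\subset\mathbb{R}^2$ be an oriented $\mathcal{H}^1$-rectifiable set with locally finite $\mathcal{H}^1$-measure. Then, for $\mathcal{H}^1$-a.e. $x_0\in S$ such that $[\xi\cdot\nu_S](x_0)=\|\xi\|_\infty$, one has $$\operatorname{ap-lim}_{x\to x_0^-}\xi(x)=\|\xi\|_\infty\,\nu_S(x_0).$$
   Context: $\mathcal{H}^{d}$ denotes $d$-dimensional Hausdorff measure, and $\|\xi\|_\infty$ is the $L^\infty$-norm of $|\xi|$ on $\mathbb{R}^n$. $\mathcal{DM}^\infty(\mathbb{R}^n)$ is the space of bounded (i.e. $L^\infty$) vector fields on $\mathbb{R}^n$ whose distributional divergence is a (signed, locally finite) Radon measure. Oriented rectifiable set: an $\mathcal{H}^{n-1}$-rectifiable set $S$ together with a Borel choice of unit normal $\nu_S$, defined $\mathcal{H}^{n-1}$-a.e. on $S$. Weak normal trace: let $\xi\in\mathcal{DM}^\infty(\mathbb{R}^n)$. For a bounded open set $E\subset\mathbb{R}^n$ of class $C^1$ with outer normal $\nu_E$, $[\xi\cdot\nu_E]\in L^\infty(\partial E;\mathcal{H}^{n-1})$ is the function such that $$\int_E\psi\,d\operatorname{div}\xi+\int_E\xi\cdot\nabla\psi\,dx=\int_{\partial E}\psi\,[\xi\cdot\nu_E]\,d\mathcal{H}^{n-1}\qquad\text{for all }\psi\in C^\infty_c(\mathbb{R}^n).$$ These traces are local: if $E,E'$ are two such sets, then $[\xi\cdot\nu_E]=[\xi\cdot\nu_{E'}]$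 holds $\mathcal{H}^{n-1}$-a.e. on the set of points of $\partial E\cap\partial E'$ where $\nu_E=\nu_{E'}$. For an oriented $\mathcal{H}^{n-1}$-rectifiable set $S$, $[\xi\cdot\nu_S]$ is defined $\mathcal{H}^{n-1}$-a.e. on $S$ by covering $\mathcal{H}^{n-1}$-almost all of $S$ with countably many pairwise disjoint Borel sets $S_i\subset S\cap\partial E_i$, with $E_i$ bounded open of class $C^1$ and $\nu_{E_i}=\nu_S$ on $S_i$, and setting $[\xi\cdot\nu_S]=[\xi\cdot\nu_{E_i}]$ on $S_i$. (So $[\xi\cdot\nu_S]$ is the trace taken from the side of $S$ pointed to by $-\nu_S$.) One-sided approximate limit: for a unit vector $v$, set $B^v_r(z)=\{x\in B_r(z):(x-z)\cdot v>0\}$. If $z\in S$ is a point where $\nu=\nu_S(z)$ is defined and $f$ is a measurable vector field on $\mathbb{R}^n$, write $\operatorname{ap-lim}_{x\to z^-}f(x)=w$ if for every $\alpha>0$ the set $N_\alpha=\{x\in B^{-\nu}_1(z):|f(x)-w|\ge\alpha\}$ has density $0$ at $z$, i.e. $\lim_{r\to0^+}|N_\alpha\cap B_r(z)|/|B_r(z)|=0$. *)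

theory Defs
  imports "HOL-Probability.Probability"
begin

section \<open>Hausdorff measure\<close>

definition hausdorff_gauge :: "nat \<Rightarrow> real \<Rightarrow> 'a::metric_space set \<Rightarrow> ennreal" where
  "hausdorff_gauge d \<delta> C =
     (if C = {} then 0
      else if bounded C \<and> diameter C \<le> \<delta>
        then ennreal (unit_ball_vol (real d) * (diameter C / 2) ^ d)
      else \<infinity>)"

text \<open>
  The value \<open>\<infinity>\<close> excludes covers by sets of diameter larger than \<open>\<delta>\<close>. The library's
  \<^const>\<open>outer_measure\<close> only uses pairwise disjoint countable covers, which does not change
  the infimum: the gauge is increasing, so a cover may be made disjoint by shrinking its members.
\<close>

definition hausdorff_pre :: "nat \<Rightarrow> real \<Rightarrow> 'a::metric_space set \<Rightarrow> ennreal" where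
  "hausdorff_pre d \<delta> = outer_measure UNIV (hausdorff_gauge d \<delta>)"

definition hausdorff_outer :: "nat \<Rightarrow> 'a::metric_space set \<Rightarrow> ennreal" where
  "hausdorff_outer d A = (SUP \<delta>\<in>{0<..}. hausdorff_pre d \<delta> A)"

text \<open>
  The Hausdorff measure lives on all Caratheodory measurable sets, so it is complete.
\<close>

definition hausdorff_measure :: "nat \<Rightarrow> 'a::metric_space measure" where
  "hausdorff_measure d =
     measure_of UNIV (lambda_system UNIV UNIV (hausdorff_outer d)) (hausdorff_outer d)"

lemma hausdorff_gauge_mono:
  assumes "C \<subseteq> D" shows "hausdorff_gauge d \<delta> C \<le> hausdorff_gauge d \<delta> D"
proof -
  have "diameter C \<le> diameter D" "bounded C" if "bounded D"
    using assms that by (auto intro: diameter_subset bounded_subset)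
  moreover have "0 \<le> diameter C" if "bounded D"
    using assms that by (auto intro: diameter_ge_0 bounded_subset)
  ultimately show ?thesis
    using assms
    by (auto simp: hausdorff_gauge_def intro!: ennreal_leI mult_left_mono power_mono)
qed

lemma outer_measure_space_hausdorff_pre:
  "outer_measure_space UNIV (hausdorff_pre d \<delta>)"
proof -
  interpret ring_of_sets UNIV "UNIV :: 'a set set"
    by (rule ring_of_setsI) auto
  show ?thesis
    unfolding hausdorff_pre_def
    using outer_measure_space_outer_measure[of "hausdorff_gauge d \<delta>"]
    by (auto simp: positive_def increasing_def hausdorff_gauge_def[of _ _ "{}"] hausdorff_gauge_mono)
qed

lemma hausdorff_pre_antimono:
  assumes "\<delta> \<le> \<delta>'" shows "hausdorff_pre d \<delta>' A \<le> hausdorff_pre d \<delta> A"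
proof -
  have "hausdorff_gauge d \<delta>' C \<le> hausdorff_gauge d \<delta> C" for C :: "'a set"
    using assms by (auto simp: hausdorff_gauge_def)
  then show ?thesis
    unfolding hausdorff_pre_def outer_measure_def
    by (intro INF_mono) (auto intro!: suminf_le)
qed

lemma outer_measure_space_hausdorff_outer:
  "outer_measure_space UNIV (hausdorff_outer d)"
proof -
  have pre: "hausdorff_pre d \<delta> {} = 0"
      "\<And>A B. A \<subseteq> B \<Longrightarrow> hausdorff_pre d \<delta> A \<le> hausdorff_pre d \<delta> B"
      "\<And>A. disjoint_family A \<Longrightarrow> hausdorff_pre d \<delta> (\<Union>i. A i) \<le> (\<Sum>i. hausdorff_pre d \<delta> (A i))"
    for \<delta> and dummy :: 'a
    using outer_measure_space_hausdorff_pre[of d \<delta>]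
    by (auto simp: outer_measure_space_def positive_def increasing_def countably_subadditive_def)
  show ?thesis
    unfolding outer_measure_space_def
  proof (intro conjI)
    show "positive UNIV (hausdorff_outer d)"
      by (simp add: positive_def hausdorff_outer_def pre)
    show "increasing UNIV (hausdorff_outer d)"
      by (auto simp: increasing_def hausdorff_outer_def intro!: SUP_mono' pre)
    show "countably_subadditive UNIV (hausdorff_outer d :: 'a set \<Rightarrow> _)"
      unfolding countably_subadditive_def
    proof (intro allI impI)
      fix A :: "nat \<Rightarrow> 'a set" assume A: "disjoint_family A"
      show "hausdorff_outer d (\<Union>i. A i) \<le> (\<Sum>i. hausdorff_outer d (A i))"
        unfolding hausdorff_outer_def[of d "\<Union>i. A i"]
      proof (rule SUP_least)
        fix \<delta> :: real assume "\<delta> \<in> {0<..}"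
        then have "hausdorff_pre d \<delta> (A i) \<le> hausdorff_outer d (A i)" for i
          unfolding hausdorff_outer_def by (rule SUP_upper)
        then have "(\<Sum>i. hausdorff_pre d \<delta> (A i)) \<le> (\<Sum>i. hausdorff_outer d (A i))"
          by (intro suminf_le) auto
        then show "hausdorff_pre d \<delta> (\<Union>i. A i) \<le> (\<Sum>i. hausdorff_outer d (A i))"
          using pre(3)[OF A, of \<delta>] by simp
      qed
    qed
  qed
qed

lemma measure_space_hausdorff:
  "measure_space UNIV (lambda_system UNIV UNIV (hausdorff_outer d)) (hausdorff_outer d)"
proof -
  interpret sigma_algebra UNIV "UNIV :: 'a set set"
    using sigma_algebra_Pow[of UNIV] by simp
  show ?thesis
    by (rule caratheodory_lemma[OF outer_measure_space_hausdorff_outer])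
qed

lemma space_hausdorff_measure [simp]: "space (hausdorff_measure d) = UNIV"
  by (simp add: hausdorff_measure_def space_measure_of_conv)

lemma sets_hausdorff_measure:
  "sets (hausdorff_measure d :: 'a::metric_space measure) = lambda_system UNIV UNIV (hausdorff_outer d)"
  using measure_space_hausdorff[of d, where 'a='a] unfolding hausdorff_measure_def
  by (auto simp: measure_space_def sigma_algebra.sigma_sets_eq)

lemma emeasure_hausdorff_measure:
  fixes A :: "'a::metric_space set"
  assumes "A \<in> sets (hausdorff_measure d)"
  shows "emeasure (hausdorff_measure d) A = hausdorff_outer d A"
  using measure_space_hausdorff[of d, where 'a='a] assms
  unfolding sets_hausdorff_measure hausdorff_measure_def
  by (auto simp: measure_space_def sigma_algebra.sigma_sets_eq intro!: emeasure_measure_of_sigma)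

lemma hausdorff_outer_separated:
  assumes "\<epsilon> > 0" and sep: "\<And>x y. x \<in> A \<Longrightarrow> y \<in> B \<Longrightarrow> \<epsilon> \<le> dist x y"
  shows "hausdorff_outer d A + hausdorff_outer d B \<le> hausdorff_outer d (A \<union> B)"
proof -
  have *: "hausdorff_pre d \<delta> A + hausdorff_pre d \<delta> B \<le> hausdorff_pre d \<delta> (A \<union> B)"
    if "\<delta> < \<epsilon>" for \<delta>
    unfolding hausdorff_pre_def outer_measure_def[of _ _ "A \<union> B"]
  proof (rule INF_greatest)
    fix C :: "nat \<Rightarrow> 'a set"
    assume C: "C \<in> {C. range C \<subseteq> UNIV \<and> disjoint_family C \<and> A \<union> B \<subseteq> (\<Union>i. C i)}"
    have le: "outer_measure UNIV (hausdorff_gauge d \<delta>) X \<le> (\<Sum>i. hausdorff_gauge d \<delta> (C i \<inter> X))"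
      if "X \<subseteq> A \<union> B" for X
      unfolding outer_measure_def using C that
      by (intro INF_lower) (auto simp: disjoint_family_on_def)
    have "hausdorff_gauge d \<delta> (C i \<inter> A) + hausdorff_gauge d \<delta> (C i \<inter> B) \<le> hausdorff_gauge d \<delta> (C i)"
      for i
    proof (cases "C i \<inter> A = {} \<or> C i \<inter> B = {}")
      case True
      then show ?thesis
        using hausdorff_gauge_mono[of "C i \<inter> A" "C i" d \<delta>] hausdorff_gauge_mono[of "C i \<inter> B" "C i" d \<delta>]
        by (auto simp: hausdorff_gauge_def[of _ _ "{}"])
    next
      case False
      then obtain x y where xy: "x \<in> C i \<inter> A" "y \<in> C i \<inter> B" by blast
      then have "\<not> (bounded (C i) \<and> diameter (C i) \<le> \<delta>)"
        using sep[of x y] diameter_bounded_bound[of "C i" x y] \<open>\<delta> < \<epsilon>\<close> by auto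
      with xy show ?thesis by (auto simp: hausdorff_gauge_def[of d \<delta> "C i"])
    qed
    then have "(\<Sum>i. hausdorff_gauge d \<delta> (C i \<inter> A)) + (\<Sum>i. hausdorff_gauge d \<delta> (C i \<inter> B))
        \<le> (\<Sum>i. hausdorff_gauge d \<delta> (C i))"
      by (subst suminf_add) (auto intro!: suminf_le)
    then show "outer_measure UNIV (hausdorff_gauge d \<delta>) A + outer_measure UNIV (hausdorff_gauge d \<delta>) B
        \<le> (\<Sum>i. hausdorff_gauge d \<delta> (C i))"
      using le[of A] le[of B] by (meson Un_upper1 Un_upper2 add_mono order_trans)
  qed
  have "hausdorff_pre d \<delta> A + hausdorff_pre d \<delta>' B \<le> hausdorff_outer d (A \<union> B)"
    if "\<delta> > 0" "\<delta>' > 0" for \<delta> \<delta>'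
  proof -
    define \<eta> where "\<eta> = min (\<epsilon>/2) (min \<delta> \<delta>')"
    have "\<eta> > 0" "\<eta> < \<epsilon>" "\<eta> \<le> \<delta>" "\<eta> \<le> \<delta>'"
      using that \<open>\<epsilon> > 0\<close> by (auto simp: \<eta>_def)
    then have "hausdorff_pre d \<delta> A + hausdorff_pre d \<delta>' B \<le> hausdorff_pre d \<eta> A + hausdorff_pre d \<eta> B"
      by (intro add_mono hausdorff_pre_antimono)
    also have "\<dots> \<le> hausdorff_pre d \<eta> (A \<union> B)" using * \<open>\<eta> < \<epsilon>\<close> by simp
    also have "\<dots> \<le> hausdorff_outer d (A \<union> B)"
      unfolding hausdorff_outer_def using \<open>\<eta> > 0\<close> by (intro SUP_upper) auto
    finally show ?thesis .
  qed
  then show ?thesis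
    unfolding hausdorff_outer_def[of d A] hausdorff_outer_def[of d B]
    by (auto simp: ennreal_SUP_add_left[symmetric] ennreal_SUP_add_right SUP_le_iff)
qed

lemma sets_borel_subset_hausdorff_measure: "sets borel \<subseteq> sets (hausdorff_measure d)"
proof -
  let ?\<mu> = "hausdorff_outer d :: 'a set \<Rightarrow> ennreal"
  have oms: "?\<mu> {} = 0" "\<And>A B. A \<subseteq> B \<Longrightarrow> ?\<mu> A \<le> ?\<mu> B"
     "\<And>A. disjoint_family A \<Longrightarrow> ?\<mu> (\<Union>i. A i) \<le> (\<Sum>i. ?\<mu> (A i))"
    using outer_measure_space_hausdorff_outer[of d, where ?'a='a]
    by (auto simp: outer_measure_space_def positive_def increasing_def countably_subadditive_def)
  have sub: "?\<mu> (\<Union>i. A i) \<le> (\<Sum>i. ?\<mu> (A i))" for A :: "nat \<Rightarrow> 'a set"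
  proof -
    have "?\<mu> (\<Union>i. A i) \<le> (\<Sum>i. ?\<mu> (disjointed A i))"
      using oms(3)[OF disjoint_family_disjointed[of A]] by (simp add: UN_disjointed_eq)
    also have "\<dots> \<le> (\<Sum>i. ?\<mu> (A i))"
      by (intro suminf_le oms(2) disjointed_subset) auto
    finally show ?thesis .
  qed
  have sub2: "?\<mu> (A \<union> B) \<le> ?\<mu> A + ?\<mu> B" for A B
  proof -
    have "?\<mu> (A \<union> B) \<le> ?\<mu> (\<Union>i::nat. if i = 0 then A else if i = 1 then B else {})"
      by (intro oms(2)) (auto split: if_splits)
    also have "\<dots> \<le> (\<Sum>i::nat. ?\<mu> (if i = 0 then A else if i = 1 then B else {}))" by (rule sub)
    also have "\<dots> = (\<Sum>i\<in>{0,1::nat}. ?\<mu> (if i = 0 then A else if i = 1 then B else {}))"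
      by (rule suminf_finite) (auto simp: oms(1))
    finally show ?thesis by simp
  qed
  have closed: "F \<in> sets (hausdorff_measure d)" if "closed F" for F :: "'a set"
  proof (cases "F = {}")
    case False
    have main: "?\<mu> (A \<inter> F) + ?\<mu> (A - F) \<le> ?\<mu> A" if fin: "?\<mu> A < \<infinity>" for A
    proof -
      define L where "L n = {x\<in>A. 1 / real (Suc n) \<le> infdist x F}" for n
      define R where "R n = L (Suc n) - L n" for n
      have sep: "?\<mu> X + ?\<mu> Y \<le> ?\<mu> (X \<union> Y)"
        if "b < a" "\<And>x. x \<in> X \<Longrightarrow> infdist x F \<le> b" "\<And>y. y \<in> Y \<Longrightarrow> a \<le> infdist y F" for X Y a b
      proof (rule hausdorff_outer_separated[of "a - b"])
        fix x y assume "x \<in> X" "y \<in> Y"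
        then have "infdist x F \<le> b" "a \<le> infdist y F" using that by auto
        moreover have "infdist y F \<le> infdist x F + dist y x" by (rule infdist_triangle)
        ultimately show "a - b \<le> dist x y" by (simp add: dist_commute)
      qed (use that in auto)
      have AL: "?\<mu> (A \<inter> F) + ?\<mu> (L n) \<le> ?\<mu> A" for n
      proof -
        have "?\<mu> (A \<inter> F) + ?\<mu> (L n) \<le> ?\<mu> ((A \<inter> F) \<union> L n)"
          by (rule sep[of 0 "1 / real (Suc n)"]) (auto simp: L_def)
        also have "\<dots> \<le> ?\<mu> A" by (rule oms(2)) (auto simp: L_def)
        finally show ?thesis .
      qed
      have Lm: "L n \<subseteq> L (Suc n)" for n
      proof -
        have "1 / real (Suc (Suc n)) \<le> 1 / real (Suc n)" by (intro frac_le) auto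
        then show ?thesis by (fastforce simp: L_def)
      qed
      have step: "?\<mu> (R (Suc n)) + ?\<mu> (L n) \<le> ?\<mu> (L (Suc (Suc n)))" for n
      proof -
        have "?\<mu> (R (Suc n)) + ?\<mu> (L n) \<le> ?\<mu> (R (Suc n) \<union> L n)"
          by (rule sep[of "1 / real (Suc (Suc n))" "1 / real (Suc n)"])
             (auto simp: R_def L_def field_simps)
        also have "\<dots> \<le> ?\<mu> (L (Suc (Suc n)))"
          by (rule oms(2)) (use Lm[of n] Lm[of "Suc n"] in \<open>auto simp: R_def\<close>)
        finally show ?thesis .
      qed
      have "(\<Sum>k<n. ?\<mu> (R (Suc k))) \<le> ?\<mu> (L n) + ?\<mu> (L (Suc n))" for n
      proof (induction n)
        case (Suc n)
        then have "(\<Sum>k<Suc n. ?\<mu> (R (Suc k))) \<le> ?\<mu> (L (Suc n)) + (?\<mu> (R (Suc n)) + ?\<mu> (L n))"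
          by (simp add: add_ac add_left_mono)
        also have "\<dots> \<le> ?\<mu> (L (Suc n)) + ?\<mu> (L (Suc (Suc n)))"
          using step by (intro add_left_mono)
        finally show ?case .
      qed simp
      also have "?\<mu> (L n) + ?\<mu> (L (Suc n)) \<le> ?\<mu> A + ?\<mu> A" for n
        by (intro add_mono oms(2)) (auto simp: L_def)
      finally have "(\<Sum>k. ?\<mu> (R (Suc k))) \<le> ?\<mu> A + ?\<mu> A"
        by (intro suminf_le_const) auto
      also have "\<dots> < \<infinity>" using fin by simp
      finally have Rfin: "(\<Sum>k. ?\<mu> (R (Suc k))) < \<infinity>" .
      define t where "t n = (\<Sum>k. ?\<mu> (R (Suc (k + n))))" for n
      have "t \<longlonglongrightarrow> 0"
      proof -
        define r where "r k = enn2real (?\<mu> (R (Suc k)))" for k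
        have r: "?\<mu> (R (Suc k)) = ennreal (r k)" for k
          using ennreal_suminf_lessD[OF Rfin, of k] by (simp add: r_def)
        have "summable r"
          using Rfin unfolding r by (intro summable_suminf_not_top) (auto simp: r_def)
        then have "(\<lambda>n. \<Sum>k. r (k + n)) \<longlonglongrightarrow> 0" by (rule suminf_exist_split2)
        moreover have "t = (\<lambda>n. ennreal (\<Sum>k. r (k + n)))"
        proof
          fix n show "t n = ennreal (\<Sum>k. r (k + n))"
            unfolding t_def r
            using summable_ignore_initial_segment[OF \<open>summable r\<close>, of n]
            by (subst suminf_ennreal2) (auto simp: r_def)
        qed
        ultimately show ?thesis
          using tendsto_ennrealI[of "\<lambda>n. \<Sum>k. r (k + n)" 0 sequentially] by simp
      qed
      have "?\<mu> (A \<inter> F) + ?\<mu> (A - F) \<le> ?\<mu> A + t n" for n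
      proof -
        have "A - F \<subseteq> L (Suc n) \<union> (\<Union>k. R (Suc (k + n)))"
        proof
          fix x assume x: "x \<in> A - F"
          then have "0 < infdist x F"
            using \<open>closed F\<close> False by (meson DiffD2 infdist_pos_not_in_closed)
          then obtain m where "inverse (real (Suc m)) < infdist x F"
            using reals_Archimedean by blast
          then have "x \<in> L m" using x by (auto simp: L_def field_simps)
          then have ex: "\<exists>m. x \<in> L m" by blast
          define m where "m = (LEAST m. x \<in> L m)"
          have m: "x \<in> L m" unfolding m_def using ex by (rule LeastI_ex)
          show "x \<in> L (Suc n) \<union> (\<Union>k. R (Suc (k + n)))"
          proof (cases "m \<le> Suc n")
            case True
            have "L m \<subseteq> L (Suc n)" using True Lm by (metis lift_Suc_mono_le)
            with m show ?thesis by blast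
          next
            case False
            then have "m = Suc (Suc ((m - Suc (Suc n)) + n))" by simp
            then obtain k where k: "m = Suc (Suc (k + n))" by blast
            have "x \<notin> L (Suc (k + n))"
              using not_less_Least[of "Suc (k + n)" "\<lambda>m. x \<in> L m"] k by (auto simp: m_def[symmetric])
            with m k show ?thesis by (auto simp: R_def)
          qed
        qed
        then have "?\<mu> (A - F) \<le> ?\<mu> (L (Suc n) \<union> (\<Union>k. R (Suc (k + n))))"
          by (rule oms(2))
        also have "\<dots> \<le> ?\<mu> (L (Suc n)) + t n"
          unfolding t_def by (rule order_trans[OF sub2]) (intro add_left_mono sub)
        finally have "?\<mu> (A \<inter> F) + ?\<mu> (A - F) \<le> (?\<mu> (A \<inter> F) + ?\<mu> (L (Suc n))) + t n"
          by (simp add: add_left_mono add.assoc)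
        also have "\<dots> \<le> ?\<mu> A + t n" using AL by (rule add_right_mono)
        finally show ?thesis .
      qed
      moreover have "(\<lambda>n. ?\<mu> A + t n) \<longlonglongrightarrow> ?\<mu> A + 0"
        using \<open>t \<longlonglongrightarrow> 0\<close> by (intro tendsto_add) auto
      ultimately show ?thesis
        by (intro LIMSEQ_le_const[of "\<lambda>n. ?\<mu> A + t n"]) auto
    qed
    have "?\<mu> (F \<inter> A) + ?\<mu> ((UNIV - F) \<inter> A) = ?\<mu> A" for A
    proof (rule antisym)
      have eq: "F \<inter> A = A \<inter> F" "(UNIV - F) \<inter> A = A - F" by auto
      show "?\<mu> (F \<inter> A) + ?\<mu> ((UNIV - F) \<inter> A) \<le> ?\<mu> A"
        unfolding eq using main[of A] by (cases "?\<mu> A < \<infinity>") (auto simp: not_less top_unique)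
      show "?\<mu> A \<le> ?\<mu> (F \<inter> A) + ?\<mu> ((UNIV - F) \<inter> A)"
        unfolding eq using sub2[of "A \<inter> F" "A - F"] by (simp add: Int_Diff_Un)
    qed
    then show ?thesis by (simp add: sets_hausdorff_measure lambda_system_def)
  qed simp
  have "sigma_sets UNIV (Collect closed) \<subseteq> sets (hausdorff_measure d :: 'a measure)"
    using closed sets.sigma_sets_subset[of "Collect closed" "hausdorff_measure d :: 'a measure"]
    by auto
  then show ?thesis by (simp add: borel_eq_closed)
qed


section \<open>Smooth functions and open sets with \<open>C\<^sup>1\<close> boundary\<close>

text \<open>
  \<open>Ck_on k U f\<close> is meant for open \<open>U\<close>: all iterated partial derivatives of \<open>f\<close> up to
  order \<open>k\<close> exist and are continuous on \<open>U\<close>.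
\<close>

primrec Ck_on :: "nat \<Rightarrow> 'a::euclidean_space set \<Rightarrow> ('a \<Rightarrow> real) \<Rightarrow> bool" where
  "Ck_on 0 U f \<longleftrightarrow> continuous_on U f"
| "Ck_on (Suc k) U f \<longleftrightarrow>
     (\<forall>x\<in>U. f differentiable (at x)) \<and>
     (\<forall>b\<in>Basis. Ck_on k U (\<lambda>x. frechet_derivative f (at x) b))"

definition test_function :: "('a::euclidean_space \<Rightarrow> real) \<Rightarrow> bool" where
  "test_function \<psi> \<longleftrightarrow> (\<forall>k. Ck_on k UNIV \<psi>) \<and> compact (closure {x. \<psi> x \<noteq> 0})"

definition grad :: "('a::euclidean_space \<Rightarrow> real) \<Rightarrow> 'a \<Rightarrow> 'a" where
  "grad f x = (\<Sum>b\<in>Basis. frechet_derivative f (at x) b *\<^sub>R b)"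

lemma GDERIV_grad:
  assumes "f differentiable (at x)" shows "GDERIV f x :> grad f x"
proof -
  have f: "(f has_derivative frechet_derivative f (at x)) (at x)"
    using assms by (simp add: frechet_derivative_works)
  interpret linear "frechet_derivative f (at x)"
    using f by (rule has_derivative_linear)
  have "frechet_derivative f (at x) h = inner h (grad f x)" for h
  proof -
    have "frechet_derivative f (at x) h = frechet_derivative f (at x) (\<Sum>b\<in>Basis. inner h b *\<^sub>R b)"
      by (simp add: euclidean_representation)
    also have "\<dots> = inner h (grad f x)"
      by (simp add: sum scale grad_def inner_sum_right mult.commute)
    finally show ?thesis .
  qed
  then have "frechet_derivative f (at x) = (\<lambda>h. inner h (grad f x))" by auto
  with f show ?thesis by (simp add: gderiv_def)
qed

definition C1_level_function :: "'a::euclidean_space set \<Rightarrow> ('a \<Rightarrow> real) \<Rightarrow> bool" where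
  "C1_level_function U \<phi> \<longleftrightarrow> open U \<and> Ck_on 1 U \<phi> \<and> (\<forall>x\<in>U. grad \<phi> x \<noteq> 0)"

text \<open>
  Near each boundary point the domain is the set where a \<open>C\<^sup>1\<close> defining function with
  nonvanishing gradient is negative; in particular it lies on one side of its boundary only, and
  the gradient points outwards.
\<close>

definition C1_domain :: "'a::euclidean_space set \<Rightarrow> bool" where
  "C1_domain E \<longleftrightarrow> open E \<and>
     (\<forall>p\<in>frontier E. \<exists>U \<phi>. p \<in> U \<and> C1_level_function U \<phi> \<and> E \<inter> U = {x\<in>U. \<phi> x < 0})"

definition outer_normal :: "'a::euclidean_space set \<Rightarrow> 'a \<Rightarrow> 'a \<Rightarrow> bool" where
  "outer_normal E p v \<longleftrightarrow> p \<in> frontier E \<and>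
     (\<exists>U \<phi>. p \<in> U \<and> C1_level_function U \<phi> \<and> E \<inter> U = {x\<in>U. \<phi> x < 0} \<and> v = sgn (grad \<phi> p))"


section \<open>Bounded divergence-measure fields\<close>

definition bounded_field :: "('a::euclidean_space \<Rightarrow> 'a) \<Rightarrow> bool" where
  "bounded_field \<xi> \<longleftrightarrow>
     \<xi> \<in> borel_measurable lebesgue \<and> (\<exists>C. AE x in lebesgue. norm (\<xi> x) \<le> C)"

definition Linf_norm :: "('a::euclidean_space \<Rightarrow> 'a) \<Rightarrow> real" where
  "Linf_norm \<xi> = real_of_ereal (esssup lebesgue (\<lambda>x. ereal (norm (\<xi> x))))"

definition radon_measure :: "'a::euclidean_space measure \<Rightarrow> bool" where
  "radon_measure \<mu> \<longleftrightarrow> sets \<mu> = sets borel \<and> (\<forall>K. compact K \<longrightarrow> emeasure \<mu> K < \<infinity>)"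

text \<open>
  A signed, locally finite Radon measure is represented by a pair \<open>(\<mu>, \<nu>)\<close> of positive Radon
  measures and stands for \<open>\<mu> - \<nu>\<close>, which as a set function is only defined on bounded
  Borel sets. The pair is not unique (it need not be the Jordan decomposition), but
  \<open>\<integral> \<psi> d\<mu> - \<integral> \<psi> d\<nu>\<close> depends only on the difference for bounded Borel \<open>\<psi>\<close> of
  compact support.
\<close>

definition signed_integral ::
  "'a::euclidean_space measure \<times> 'a measure \<Rightarrow> 'a set \<Rightarrow> ('a \<Rightarrow> real) \<Rightarrow> real" where
  "signed_integral m E \<psi> = (LINT x:E|fst m. \<psi> x) - (LINT x:E|snd m. \<psi> x)"

definition has_divergence ::
  "('a::euclidean_space \<Rightarrow> 'a) \<Rightarrow> 'a measure \<times> 'a measure \<Rightarrow> bool" where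
  "has_divergence \<xi> m \<longleftrightarrow> radon_measure (fst m) \<and> radon_measure (snd m) \<and>
     (\<forall>\<psi>. test_function \<psi> \<longrightarrow>
        (LINT x|lebesgue. inner (\<xi> x) (grad \<psi> x)) = - signed_integral m UNIV \<psi>)"

definition DM_inf :: "('a::euclidean_space \<Rightarrow> 'a) set" where
  "DM_inf = {\<xi>. bounded_field \<xi> \<and> (\<exists>m. has_divergence \<xi> m)}"


section \<open>Oriented rectifiable sets\<close>

abbreviation surface_measure :: "'a::euclidean_space measure" where
  "surface_measure \<equiv> hausdorff_measure (DIM('a) - 1)"

text \<open>
  Countable rectifiability; the \<open>k\<close>-dimensional parameter space is a linear subspace of
  dimension \<open>k\<close> of the ambient space, a copy of \<open>k\<close>-dimensional Euclidean space.
\<close>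

definition rectifiable :: "nat \<Rightarrow> 'a::euclidean_space set \<Rightarrow> bool" where
  "rectifiable k S \<longleftrightarrow> S \<in> sets (hausdorff_measure k) \<and>
     (\<exists>V (f :: nat \<Rightarrow> 'a \<Rightarrow> 'a). subspace V \<and> dim V = k \<and> (\<forall>i. \<exists>L. L-lipschitz_on V (f i)) \<and>
        (AE x in hausdorff_measure k. x \<in> S \<longrightarrow> x \<in> (\<Union>i. f i ` V)))"

text \<open>
  The field \<open>\<nu>\<close> is a unit normal to \<open>S\<close> in the sense of the approximate tangent space, which
  almost everywhere on \<open>S \<inter> \<Gamma>\<close> is the classical tangent space of \<open>\<Gamma>\<close>, for every
  hypersurface \<open>\<Gamma>\<close> of class \<open>C\<^sup>1\<close> (given below as a regular zero set). The set \<open>D\<close> is where \<open>\<nu>\<close>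
  is defined; its values outside \<open>D\<close> are irrelevant.
\<close>

definition oriented_rectifiable :: "'a::euclidean_space set \<Rightarrow> ('a \<Rightarrow> 'a) \<Rightarrow> bool" where
  "oriented_rectifiable S \<nu> \<longleftrightarrow> rectifiable (DIM('a) - 1) S \<and>
     (\<exists>D\<subseteq>S. (AE x in surface_measure. x \<in> S \<longrightarrow> x \<in> D) \<and>
        \<nu> \<in> borel_measurable (restrict_space borel D) \<and> (\<forall>x\<in>D. norm (\<nu> x) = 1)) \<and>
     (\<forall>U \<phi>. C1_level_function U \<phi> \<longrightarrow>
        (AE x in surface_measure. x \<in> S \<inter> U \<and> \<phi> x = 0 \<longrightarrow>
           \<nu> x = sgn (grad \<phi> x) \<or> \<nu> x = - sgn (grad \<phi> x)))"

definition locally_finite_measure :: "nat \<Rightarrow> 'a::euclidean_space set \<Rightarrow> bool" where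
  "locally_finite_measure k S \<longleftrightarrow>
     (\<forall>K. compact K \<longrightarrow> emeasure (hausdorff_measure k) (S \<inter> K) < \<infinity>)"


section \<open>Weak normal traces\<close>

text \<open>
  Traces are defined almost everywhere, so \<open>h\<close> below is any representative of the trace.
\<close>

definition weak_normal_trace ::
  "('a::euclidean_space \<Rightarrow> 'a) \<Rightarrow> 'a set \<Rightarrow> ('a \<Rightarrow> real) \<Rightarrow> bool" where
  "weak_normal_trace \<xi> E h \<longleftrightarrow>
     set_borel_measurable surface_measure (frontier E) h \<and>
     (\<exists>C. AE x in surface_measure. x \<in> frontier E \<longrightarrow> \<bar>h x\<bar> \<le> C) \<and>
     (\<exists>m. has_divergence \<xi> m \<and>
        (\<forall>\<psi>. test_function \<psi> \<longrightarrow>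
           signed_integral m E \<psi> + (LINT x:E|lebesgue. inner (\<xi> x) (grad \<psi> x)) =
           (LINT x:frontier E|surface_measure. \<psi> x * h x)))"

definition weak_normal_trace_on ::
  "('a::euclidean_space \<Rightarrow> 'a) \<Rightarrow> 'a set \<Rightarrow> ('a \<Rightarrow> 'a) \<Rightarrow> ('a \<Rightarrow> real) \<Rightarrow> bool" where
  "weak_normal_trace_on \<xi> S \<nu> g \<longleftrightarrow>
     (\<exists>(A :: nat \<Rightarrow> 'a set) (E :: nat \<Rightarrow> 'a set) (h :: nat \<Rightarrow> 'a \<Rightarrow> real).
        disjoint_family A \<and>
        (\<forall>i. A i \<in> sets borel \<and> A i \<subseteq> S \<inter> frontier (E i) \<and>
             bounded (E i) \<and> C1_domain (E i) \<and> (\<forall>x\<in>A i. outer_normal (E i) x (\<nu> x)) \<and>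
             weak_normal_trace \<xi> (E i) (h i) \<and>
             (AE x in surface_measure. x \<in> A i \<longrightarrow> g x = h i x)) \<and>
        (AE x in surface_measure. x \<in> S \<longrightarrow> x \<in> (\<Union>i. A i)))"


section \<open>One-sided approximate limits\<close>

definition half_ball :: "'a::euclidean_space \<Rightarrow> real \<Rightarrow> 'a \<Rightarrow> 'a set" where
  "half_ball v r z = {x \<in> ball z r. inner (x - z) v > 0}"

definition density_zero :: "'a::euclidean_space set \<Rightarrow> 'a \<Rightarrow> bool" where
  "density_zero N z \<longleftrightarrow>
     ((\<lambda>r. measure lebesgue (N \<inter> ball z r) / measure lebesgue (ball z r)) \<longlongrightarrow> 0) (at_right 0)"

text \<open>
  The limit from the side that \<open>- v\<close> points to, as in \<open>x \<rightarrow> z\<^sup>-\<close> for \<open>v = \<nu>\<^sub>S z\<close>.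
\<close>

definition has_ap_lim_minus ::
  "('a::euclidean_space \<Rightarrow> 'a) \<Rightarrow> 'a \<Rightarrow> 'a \<Rightarrow> 'a \<Rightarrow> bool" where
  "has_ap_lim_minus f v z w \<longleftrightarrow>
     (\<forall>\<alpha>>0. density_zero {x \<in> half_ball (- v) 1 z. norm (f x - w) \<ge> \<alpha>} z)"

end

theory Submission
  imports Defs
begin

text \<open>
  Write \<open>M\<close> for the \<open>L\<^sup>\<infinity>\<close> norm of \<open>\<xi>\<close> and \<open>\<eta> = M \<nu> - \<xi>\<close>, where \<open>\<nu>\<close> is the outer normal at a
  boundary point \<open>p\<close> of a \<open>C\<^sup>1\<close> domain \<open>E\<close> at which the trace equals \<open>M\<close>. Since
  \<open>\<bar>\<xi>\<bar> \<le> M\<close>, we have \<open>\<bar>\<eta>\<bar>\<^sup>2 \<le> 2 M \<eta>\<cdot>\<nu>\<close>. For almost every such \<open>p\<close> both the divergence inside \<open>E\<close>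
  and \<open>M\<close> minus the trace, as a measure on the boundary, have mass \<open>o(r)\<close> in \<open>B\<^sub>r(p)\<close>, so
  \<open>\<integral>\<^sub>E \<eta>\<cdot>\<nabla>\<psi> \<le> o(r) sup \<psi>\<close> for nonnegative test functions supported in \<open>B\<^sub>r(p)\<close>. In the coordinates
  \<open>(s, t)\<close> along the tangent and the normal, take \<open>\<psi> = r a(s/(L r)) b(t/r)\<close> with \<open>b\<close> increasing on the
  relevant range, \<open>\<bar>a'\<bar>\<^sup>2 \<le> C a\<close> and \<open>b\<^sup>2 \<le> C b'\<close>. The tangential term is at most
  \<open>(2 M \<eta>\<cdot>\<nu>)\<^bsup>1/2\<^esup> \<bar>a'\<bar> b / L\<close>, and Young's inequality absorbs it into half of \<open>\<eta>\<cdot>\<nu> a b'\<close> up to a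
  constant times \<open>M / L\<^sup>2\<close>, which integrates to \<open>O(r\<^sup>2 / L)\<close> over the support. Hence
  \<open>\<integral> \<eta>\<cdot>\<nu>\<close> over \<open>E \<inter> B\<^sub>r(p)\<close> is \<open>O(r\<^sup>2 / L) + o(r\<^sup>2)\<close> for every \<open>L\<close>. Only in dimension two does
  the area of the support grow more slowly than \<open>L\<^sup>2\<close>.
\<close>


section \<open>Smooth cut-off functions\<close>

text \<open>Everything is quantitative at one small scale \<open>r\<close>; no blow-up limit of
  \<xi> is taken. The normal profile vanishes below depth \<open>3 * r\<close> and is still rising
  at height \<open>r\<close>, while the boundary stays within \<open>r\<close> of its tangent line.
  Its decreasing part therefore meets only the complement of \<open>E\<close>: the normal derivative
  is nonnegative on \<open>E\<close>, and the cut-off from below costs nothing. Only the cut-off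
  along the tangent has a derivative without sign, and that one is stretched by \<open>L\<close>.

  The curvature of the boundary causes no error term, because only one inequality is used: the flux
  of the constant field \<nu> through the boundary, weighted by \<psi>, is at most the integral of
  \<psi> over it.

  The \<open>o(r)\<close> statements come from a covering argument. The divergence inside
  \<open>E\<close> gives no mass to the frontier, and the trace defect gives none to the points of
  maximal trace; a finite measure has vanishing one-dimensional density at almost every point of
  such a set. These errors live in a ball of radius \<open>10 * L * r\<close> and are not uniform in
  \<open>L\<close>, so \<open>L\<close> is fixed before \<open>r\<close> tends to 0.\<close>

definition flat_exp :: "nat \<Rightarrow> real \<Rightarrow> real" where
  "flat_exp n x = (if x > 0 then exp (- 1 / x) / x ^ n else 0)"

lemma flat_exp_nonneg [simp]: "0 \<le> flat_exp n x"
  by (simp add: flat_exp_def)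

text \<open>The single term of order \<open>n + k\<close> in the exponential series at
  \<open>1 / x\<close> gives the bound. It is used with \<open>k = 2\<close> for flatness at the
  origin and with \<open>k = 0\<close> for boundedness.\<close>

lemma flat_exp_le_power:
  assumes "0 < x"
  shows "flat_exp n x \<le> fact (n + k) * x ^ k"
proof -
  have "(1 / x) ^ (n + k) / fact (n + k) \<le> exp (1 / x)"
    using sum_le_suminf[OF summable_exp_generic[of "1 / x"], of "{n + k}"] assms
    by (simp add: exp_def divide_inverse mult.commute)
  then have "exp (- 1 / x) * (1 / x) ^ (n + k) \<le> exp (- 1 / x) * (exp (1 / x) * fact (n + k))"
    by (intro mult_left_mono) (simp_all add: pos_divide_le_eq)
  also have "\<dots> = fact (n + k)"
    by (simp add: mult.assoc[symmetric] flip: exp_add)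
  finally have "exp (- 1 / x) * (1 / x) ^ (n + k) \<le> fact (n + k)" .
  then have "exp (- 1 / x) * (1 / x) ^ (n + k) * x ^ k \<le> fact (n + k) * x ^ k"
    using assms by (intro mult_right_mono) auto
  then show ?thesis
    using assms by (simp add: flat_exp_def power_add power_divide)
qed

text \<open>Differentiation only raises the power in the denominator, so the family spans a space
  closed under derivatives. Smoothness could fail only at 0; there the difference quotient is of
  order \<open>\<bar>h\<bar>\<close> by \<open>flat_exp_le_power\<close> with
  \<open>k = 2\<close>.\<close>

lemma flat_exp_has_derivative:
  "(flat_exp n has_real_derivative flat_exp (n + 2) x - real n * flat_exp (n + 1) x) (at x)"
proof -
  consider "x < 0" | "x > 0" | "x = 0" by linarith
  then show ?thesis
  proof cases
    case 1
    have "((\<lambda>_. 0) has_real_derivative 0) (at x)" by simp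
    then have "(flat_exp n has_real_derivative 0) (at x)"
      by (rule has_field_derivative_transform_within_open[of _ _ _ "{..<0}"]) (use 1 in \<open>auto simp: flat_exp_def\<close>)
    with 1 show ?thesis by (simp add: flat_exp_def)
  next
    case 2
    have "((\<lambda>x. exp (- 1 / x)) has_real_derivative exp (- 1 / x) / x\<^sup>2) (at x)"
      using 2 by (auto intro!: derivative_eq_intros simp: power2_eq_square)
    then have "((\<lambda>x. exp (- 1 / x) / x ^ n) has_real_derivative
        (exp (- 1 / x) / x\<^sup>2 * x ^ n - exp (- 1 / x) * (real n * x ^ (n - 1))) / (x ^ n * x ^ n)) (at x)"
      using 2 by (intro DERIV_divide) (auto intro!: derivative_eq_intros)
    moreover have "(exp (- 1 / x) / x\<^sup>2 * x ^ n - exp (- 1 / x) * (real n * x ^ (n - 1))) / (x ^ n * x ^ n) =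
        flat_exp (n + 2) x - real n * flat_exp (n + 1) x"
      using 2 by (cases n) (simp_all add: flat_exp_def field_simps power2_eq_square)
    ultimately have "((\<lambda>x. exp (- 1 / x) / x ^ n) has_real_derivative
        flat_exp (n + 2) x - real n * flat_exp (n + 1) x) (at x)" by simp
    then show ?thesis
      by (rule has_field_derivative_transform_within_open[of _ _ _ "{0<..}"]) (use 2 in \<open>auto simp: flat_exp_def\<close>)
  next
    case 3
    have "((\<lambda>h. flat_exp n h / h) \<longlongrightarrow> 0) (at 0)"
    proof (rule Lim_null_comparison)
      show "\<forall>\<^sub>F h in at 0. norm (flat_exp n h / h) \<le> fact (n + 2) * \<bar>h\<bar>"
      proof (rule always_eventually, rule allI)
        fix h :: real
        show "norm (flat_exp n h / h) \<le> fact (n + 2) * \<bar>h\<bar>"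
        proof (cases "h > 0")
          case True
          then have "flat_exp n h / h \<le> fact (n + 2) * h\<^sup>2 / h"
            using flat_exp_le_power[of h n 2] by (intro divide_right_mono) auto
          with True show ?thesis by (simp add: power2_eq_square del: fact_Suc)
        next
          case False
          have "0 \<le> fact (n + 2) * \<bar>h\<bar>" by (intro mult_nonneg_nonneg) auto
          with False show ?thesis by (simp add: flat_exp_def)
        qed
      qed
      show "((\<lambda>h. fact (n + 2) * \<bar>h\<bar>) \<longlongrightarrow> (0::real)) (at 0)"
        by (auto intro!: tendsto_eq_intros)
    qed
    with 3 show ?thesis by (simp add: DERIV_def flat_exp_def)
  qed
qed

text \<open>\<open>Ck_on\<close> iterates partial derivatives, so smoothness is proved by induction
  over a class closed under taking them. The product rule calls for both sums and products.\<close>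

inductive flat_exp_algebra :: "('a::euclidean_space \<Rightarrow> real) \<Rightarrow> bool" where
  flat: "flat_exp_algebra (\<lambda>x. flat_exp n (c + inner x w))"
| const: "flat_exp_algebra (\<lambda>x. c)"
| add: "flat_exp_algebra u \<Longrightarrow> flat_exp_algebra u' \<Longrightarrow> flat_exp_algebra (\<lambda>x. u x + u' x)"
| mult: "flat_exp_algebra u \<Longrightarrow> flat_exp_algebra u' \<Longrightarrow> flat_exp_algebra (\<lambda>x. u x * u' x)"

lemma flat_exp_algebra_derivative:
  assumes "flat_exp_algebra u"
  shows "\<exists>u'. \<forall>x. (u has_derivative (\<lambda>h. u' h x)) (at x) \<and> (\<forall>b. flat_exp_algebra (u' b))"
  using assms
proof induction
  case (flat n c w)
  define D where "D x = flat_exp (n + 2) x + (- real n) * flat_exp (n + 1) x" for x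
  have "((\<lambda>x. flat_exp n (c + inner x w)) has_derivative (\<lambda>h. D (c + inner x w) * inner h w)) (at x)" for x
  proof -
    have "(flat_exp n has_derivative (*) (D (c + inner x w))) (at (c + inner x w))"
      using flat_exp_has_derivative[of n "c + inner x w"]
      by (simp add: has_field_derivative_def D_def)
    then show ?thesis
      by (rule has_derivative_compose[rotated]) (auto intro!: derivative_eq_intros)
  qed
  moreover have "flat_exp_algebra (\<lambda>x. D (c + inner x w) * inner h w)" for h
    unfolding D_def by (intro flat_exp_algebra.intros)
  ultimately show ?case by (intro exI[of _ "\<lambda>h x. D (c + inner x w) * inner h w"]) auto
next
  case (const c)
  show ?case
    by (intro exI[of _ "\<lambda>h x. 0"]) (auto intro: flat_exp_algebra.intros)
next
  case (add u w)
  then obtain u' w' where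
    "\<And>x. (u has_derivative (\<lambda>h. u' h x)) (at x)" "\<And>b. flat_exp_algebra (u' b)"
    "\<And>x. (w has_derivative (\<lambda>h. w' h x)) (at x)" "\<And>b. flat_exp_algebra (w' b)" by metis
  then show ?case
    by (intro exI[of _ "\<lambda>h x. u' h x + w' h x"])
       (auto intro: has_derivative_add flat_exp_algebra.intros)
next
  case (mult u w)
  then obtain u' w' where
    "\<And>x. (u has_derivative (\<lambda>h. u' h x)) (at x)" "\<And>b. flat_exp_algebra (u' b)"
    "\<And>x. (w has_derivative (\<lambda>h. w' h x)) (at x)" "\<And>b. flat_exp_algebra (w' b)" by metis
  with mult.hyps show ?case
    by (intro exI[of _ "\<lambda>h x. u x * w' h x + u' h x * w x"] allI conjI has_derivative_mult
          flat_exp_algebra.add flat_exp_algebra.mult) auto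
qed

lemma flat_exp_algebra_Ck_on:
  assumes "flat_exp_algebra u" shows "Ck_on k UNIV u"
  using assms
proof (induction k arbitrary: u)
  case 0
  then obtain u' where "\<And>x. (u has_derivative (\<lambda>h. u' h x)) (at x)"
    using flat_exp_algebra_derivative by blast
  then have "isCont u x" for x using has_derivative_continuous by blast
  then show ?case by (simp add: continuous_on_eq_continuous_at)
next
  case (Suc k)
  then obtain u' where u': "\<And>x. (u has_derivative (\<lambda>h. u' h x)) (at x)" "\<And>b. flat_exp_algebra (u' b)"
    using flat_exp_algebra_derivative by blast
  then have "frechet_derivative u (at x) = (\<lambda>h. u' h x)" for x
    using frechet_derivative_at by metis
  with u' Suc.IH show ?case by (auto simp: differentiable_def)
qed

text \<open>
  The square in \<open>bump\<close> makes its derivative \<open>O(sqrt bump)\<close>, and the constants in \<open>ramp\<close> make it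
  increasing on \<open>(-3, 2)\<close>.
\<close>

definition bump :: "real \<Rightarrow> real" where
  "bump x = (flat_exp 0 (2 - x) * flat_exp 0 (2 + x))\<^sup>2"

definition bump' :: "real \<Rightarrow> real" where
  "bump' x = 2 * (flat_exp 0 (2 - x) * flat_exp 0 (2 + x)) *
     (flat_exp 0 (2 - x) * flat_exp 2 (2 + x) - flat_exp 2 (2 - x) * flat_exp 0 (2 + x))"

definition ramp :: "real \<Rightarrow> real" where
  "ramp x = flat_exp 0 (3 + x) * flat_exp 0 (7 - x)"

definition ramp' :: "real \<Rightarrow> real" where
  "ramp' x = flat_exp 2 (3 + x) * flat_exp 0 (7 - x) - flat_exp 0 (3 + x) * flat_exp 2 (7 - x)"

section \<open>Bounds for the tangential and the normal profile\<close>

lemma flat_exp_0_le_1: "flat_exp 0 x \<le> 1"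
  by (simp add: flat_exp_def)

lemma flat_exp_2_eq: "flat_exp 2 x = flat_exp 0 x / x\<^sup>2"
  by (simp add: flat_exp_def)

lemma flat_exp_0_ge:
  assumes "0 < c" "c \<le> x" shows "exp (- 1 / c) \<le> flat_exp 0 x"
proof -
  have "1 / x \<le> 1 / c" using assms by (intro divide_left_mono) auto
  with assms show ?thesis by (simp add: flat_exp_def)
qed

lemma flat_exp_2_le_2: "flat_exp 2 x \<le> 2"
  using flat_exp_le_power[of x 2 0] by (cases "x > 0") (auto simp: flat_exp_def)

lemma DERIV_flat_exp_0 [derivative_intros]:
  assumes "(g has_real_derivative d) (at x)"
  shows "((\<lambda>x. flat_exp 0 (g x)) has_real_derivative flat_exp 2 (g x) * d) (at x)"
  using DERIV_chain2[OF flat_exp_has_derivative[of 0] assms] by (simp add: numeral_2_eq_2)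

lemma bump_derivative: "(bump has_real_derivative bump' x) (at x)"
  unfolding bump_def bump'_def
  by (auto intro!: derivative_eq_intros simp: algebra_simps power2_eq_square)

lemma ramp_derivative: "(ramp has_real_derivative ramp' x) (at x)"
  unfolding ramp_def ramp'_def
  by (auto intro!: derivative_eq_intros simp: algebra_simps)

lemma bump_bounds: "0 \<le> bump x" "bump x \<le> 1"
proof -
  have "flat_exp 0 (2 - x) * flat_exp 0 (2 + x) \<le> 1 * 1"
    by (intro mult_mono flat_exp_0_le_1) auto
  then show "0 \<le> bump x" "bump x \<le> 1"
    by (auto simp: bump_def power_le_one)
qed

lemma bump_eq_0: "2 \<le> \<bar>x\<bar> \<Longrightarrow> bump x = 0" "2 \<le> \<bar>x\<bar> \<Longrightarrow> bump' x = 0"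
  by (auto simp: bump_def bump'_def flat_exp_def)

text \<open>Both factors are at least \<open>exp (- 1)\<close> here; the square of their product
  gives the exponent 4.\<close>

lemma bump_lower: assumes "\<bar>x\<bar> \<le> 1" shows "exp (- 4) \<le> bump x"
proof -
  have "exp (- 1) \<le> flat_exp 0 (2 + y)" if "\<bar>y\<bar> \<le> 1" for y
    using that flat_exp_0_ge[of 1 "2 + y"] by auto
  from this[of x] this[of "-x"] assms
  have "exp (- 1) * exp (- 1) \<le> flat_exp 0 (2 - x) * flat_exp 0 (2 + x)"
    by (intro mult_mono) auto
  then have "exp (- 2) \<le> flat_exp 0 (2 - x) * flat_exp 0 (2 + x)"
    by (simp flip: exp_add)
  then have "(exp (- 2))\<^sup>2 \<le> bump x"
    unfolding bump_def by (intro power_mono) auto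
  then show ?thesis by (simp flip: exp_double)
qed

text \<open>As \<open>bump\<close> is a square \<open>f\<^sup>2\<close>, its derivative is
  \<open>2 * f * c\<close>, where \<open>c\<close> is a difference of two numbers between 0 and 2.
  Hence the constant \<open>4 * 2\<^sup>2\<close>.\<close>

lemma bump'_sq_le: "(bump' x)\<^sup>2 \<le> 16 * bump x"
proof -
  let ?c = "flat_exp 0 (2 - x) * flat_exp 2 (2 + x) - flat_exp 2 (2 - x) * flat_exp 0 (2 + x)"
  have up: "flat_exp 0 y * flat_exp 2 z \<le> 1 * 2" for y z
    by (intro mult_mono flat_exp_0_le_1 flat_exp_2_le_2) auto
  have low: "0 \<le> flat_exp 0 y * flat_exp 2 z" for y z by simp
  have "\<bar>?c\<bar> \<le> 2"
    using up[of "2 - x" "2 + x"] up[of "2 + x" "2 - x"] low[of "2 - x" "2 + x"] low[of "2 + x" "2 - x"]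
    by (simp only: abs_le_iff mult.commute[of "flat_exp 2 (2 - x)"]) linarith
  then have "?c\<^sup>2 \<le> 2\<^sup>2" by (simp only: abs_le_square_iff[symmetric])
  then have "4 * (flat_exp 0 (2 - x) * flat_exp 0 (2 + x))\<^sup>2 * ?c\<^sup>2 \<le> 4 * (flat_exp 0 (2 - x) * flat_exp 0 (2 + x))\<^sup>2 * 4"
    by (intro mult_left_mono) auto
  then show ?thesis
    by (simp add: bump_def bump'_def power_mult_distrib)
qed

lemma ramp_bounds: "0 \<le> ramp x" "ramp x \<le> 1"
proof -
  show "0 \<le> ramp x" "ramp x \<le> 1"
    using mult_mono[OF flat_exp_0_le_1 flat_exp_0_le_1, of "7 - x" "3 + x"]
    by (simp_all add: ramp_def)
qed

lemma ramp_eq_0: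
  "x \<le> - 3 \<or> 7 \<le> x \<Longrightarrow> ramp x = 0" "x \<le> - 3 \<or> 7 \<le> x \<Longrightarrow> ramp' x = 0"
  by (auto simp: ramp_def ramp'_def flat_exp_def)

text \<open>The logarithmic derivative of \<open>ramp\<close> is
  \<open>1 / (3 + x)\<^sup>2 - 1 / (7 - x)\<^sup>2\<close>, which is at least
  \<open>1 / 16 - 1 / 36 = 5 / 144\<close> for \<open>- 3 < x \<le> 1\<close>. The range reaches up
  to 1 because the points of \<open>E\<close> in the window lie below height
  \<open>r\<close>.\<close>

lemma ramp'_ge: assumes "x \<le> 1" shows "5 / 144 * ramp x \<le> ramp' x"
proof (cases "- 3 < x")
  case True
  have "1 / 16 \<le> 1 / (3 + x)\<^sup>2"
    using True assms power_mono[of "3 + x" 4 2] by (intro divide_left_mono) auto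
  moreover have "1 / (7 - x)\<^sup>2 \<le> 1 / 36"
    using True assms power_mono[of 6 "7 - x" 2] by (intro divide_left_mono) auto
  ultimately have "5 / 144 \<le> 1 / (3 + x)\<^sup>2 - 1 / (7 - x)\<^sup>2" by linarith
  then have "5 / 144 * ramp x \<le> (1 / (3 + x)\<^sup>2 - 1 / (7 - x)\<^sup>2) * ramp x"
    using ramp_bounds(1) by (rule mult_right_mono)
  also have "\<dots> = ramp' x"
    by (simp add: ramp_def ramp'_def flat_exp_2_eq left_diff_distrib)
  finally show ?thesis .
qed (simp add: ramp_eq_0)

lemma ramp_lower: assumes "\<bar>x\<bar> \<le> 1" shows "exp (- 1) \<le> ramp x"
proof -
  have "exp (- 1 / 2) \<le> flat_exp 0 (3 + x)" "exp (- 1 / 2) \<le> flat_exp 0 (7 - x)"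
    using assms flat_exp_0_ge[of 2 "3 + x"] flat_exp_0_ge[of 2 "7 - x"] by auto
  then have "exp (- 1 / 2) * exp (- 1 / 2) \<le> ramp x"
    unfolding ramp_def by (intro mult_mono) auto
  then show ?thesis by (simp flip: exp_add)
qed


section \<open>One-dimensional Hausdorff measure\<close>

text \<open>The volume 2 of the one-dimensional unit ball cancels the division by 2 in the
  gauge.\<close>

lemma hausdorff_gauge_1_le:
  fixes C :: "'a::metric_space set"
  assumes "bounded C" "diameter C \<le> \<delta>"
  shows "hausdorff_gauge 1 \<delta> C \<le> ennreal (diameter C)"
  using assms by (auto simp: hausdorff_gauge_def unit_ball_vol_1)

section \<open>Covers, null sets and Borel hulls\<close>

context
  fixes \<mu> :: "'a set \<Rightarrow> ennreal"
  assumes oms: "outer_measure_space UNIV \<mu>"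
begin

lemma outer_measure_mono: "A \<subseteq> B \<Longrightarrow> \<mu> A \<le> \<mu> B"
  using oms by (auto simp: outer_measure_space_def increasing_def)

text \<open>Subadditivity is given for disjoint families only; making a family disjoint shrinks its
  members, and monotonicity absorbs that.\<close>

lemma outer_measure_UN_le: "\<mu> (\<Union>i::nat. A i) \<le> (\<Sum>i. \<mu> (A i))"
proof -
  have "\<mu> (\<Union>i. A i) \<le> (\<Sum>i. \<mu> (disjointed A i))"
    using oms disjoint_family_disjointed[of A]
    unfolding outer_measure_space_def countably_subadditive_def by (metis UNIV_I UN_disjointed_eq subset_UNIV)
  also have "\<dots> \<le> (\<Sum>i. \<mu> (A i))"
    by (intro suminf_le outer_measure_mono disjointed_subset) auto
  finally show ?thesis .
qed

end

lemma hausdorff_pre_UN_le: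
  "hausdorff_pre d \<delta> (\<Union>i::nat. A i) \<le> (\<Sum>i. hausdorff_gauge d \<delta> (A i))"
proof -
  have "hausdorff_pre d \<delta> (\<Union>i. A i) \<le> (\<Sum>i. hausdorff_gauge d \<delta> (disjointed A i))"
    unfolding hausdorff_pre_def outer_measure_def
    by (rule INF_lower) (auto simp: disjoint_family_disjointed UN_disjointed_eq)
  also have "\<dots> \<le> (\<Sum>i. hausdorff_gauge d \<delta> (A i))"
    by (intro suminf_le hausdorff_gauge_mono disjointed_subset) auto
  finally show ?thesis .
qed

lemma hausdorff_pre_1_le:
  fixes A :: "nat \<Rightarrow> 'a::metric_space set"
  assumes "X \<subseteq> (\<Union>i. A i)" "\<And>i. bounded (A i)" "\<And>i. diameter (A i) \<le> \<delta>"
  shows "hausdorff_pre 1 \<delta> X \<le> (\<Sum>i. ennreal (diameter (A i)))"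
proof -
  have "hausdorff_pre 1 \<delta> X \<le> hausdorff_pre 1 \<delta> (\<Union>i. A i)"
    using outer_measure_mono[OF outer_measure_space_hausdorff_pre] assms(1) by blast
  also have "\<dots> \<le> (\<Sum>i. hausdorff_gauge 1 \<delta> (A i))" by (rule hausdorff_pre_UN_le)
  also have "\<dots> \<le> (\<Sum>i. ennreal (diameter (A i)))"
    using assms by (intro suminf_le hausdorff_gauge_1_le) auto
  finally show ?thesis .
qed

text \<open>A set of outer measure 0 satisfies Caratheodory's criterion. The exceptional sets of the
  covering argument are not visibly Borel, so their measurability has to come from here.\<close>

lemma hausdorff_null_setsI:
  fixes N :: "'a::metric_space set"
  assumes "hausdorff_outer d N = 0"
  shows "N \<in> null_sets (hausdorff_measure d)"
proof -
  note mono = outer_measure_mono[OF outer_measure_space_hausdorff_outer[of d, where 'a='a]]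
  have "hausdorff_outer d (N \<inter> A) = 0" for A
    using mono[of "N \<inter> A" N] assms by auto
  moreover have "hausdorff_outer d ((UNIV - N) \<inter> A) = hausdorff_outer d A" for A
  proof (rule antisym)
    show "hausdorff_outer d ((UNIV - N) \<inter> A) \<le> hausdorff_outer d A" by (rule mono) auto
    \<comment> \<open>All indices other than 0 carry the null set \<open>N\<close>, which turns
      countable subadditivity into the binary one.\<close>
    have "hausdorff_outer d A \<le> hausdorff_outer d (\<Union>i::nat. if i = 0 then (UNIV - N) \<inter> A else N)"
      by (rule mono) auto
    also have "\<dots> \<le> (\<Sum>i::nat. hausdorff_outer d (if i = 0 then (UNIV - N) \<inter> A else N))"
      by (rule outer_measure_UN_le[OF outer_measure_space_hausdorff_outer])
    also have "\<dots> = (\<Sum>i\<in>{0::nat}. hausdorff_outer d (if i = 0 then (UNIV - N) \<inter> A else N))"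
      by (rule suminf_finite) (auto simp: assms)
    finally show "hausdorff_outer d A \<le> hausdorff_outer d ((UNIV - N) \<inter> A)" by simp
  qed
  ultimately have "N \<in> sets (hausdorff_measure d)"
    by (simp add: sets_hausdorff_measure lambda_system_def)
  with assms show ?thesis by (auto simp: emeasure_hausdorff_measure)
qed

lemma hausdorff_pre_le_outer:
  "\<delta> > 0 \<Longrightarrow> hausdorff_pre d \<delta> A \<le> hausdorff_outer d A"
  unfolding hausdorff_outer_def by (rule SUP_upper) auto

text \<open>Closure preserves boundedness and diameter, so covers may be taken closed; this is what
  makes the hull below Borel.\<close>

lemma hausdorff_gauge_closure:
  fixes C :: "'a::metric_space set"
  shows "hausdorff_gauge d \<delta> (closure C) = hausdorff_gauge d \<delta> C"
proof (cases "bounded C")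
  case True
  then show ?thesis by (simp add: hausdorff_gauge_def diameter_closure bounded_closure)
qed (auto simp: hausdorff_gauge_def dest: bounded_subset[OF _ closure_subset])

text \<open>The hull is the intersection, over the scales \<open>1 / (n + 1)\<close>, of
  near-optimal covers by closed sets. Finiteness leaves room at each scale for an excess of at most
  \<open>1 / (n + 1)\<close>.\<close>

lemma hausdorff_borel_hull:
  fixes A :: "'a::metric_space set"
  assumes fin: "hausdorff_outer d A < \<infinity>"
  obtains B where "B \<in> sets borel" "A \<subseteq> B" "hausdorff_outer d B = hausdorff_outer d A"
proof -
  have "\<exists>C. A \<subseteq> C \<and> C \<in> sets borel \<and>
     hausdorff_pre d (1 / real (Suc n)) C \<le> hausdorff_outer d A + ennreal (1 / real (Suc n))" for n
  proof -
    let ?\<delta> = "1 / real (Suc n)"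
    have "hausdorff_pre d ?\<delta> A < hausdorff_outer d A + ennreal ?\<delta>"
    proof -
      have "hausdorff_pre d ?\<delta> A \<le> hausdorff_outer d A"
        by (rule hausdorff_pre_le_outer) simp
      also have "\<dots> < hausdorff_outer d A + ennreal ?\<delta>"
        using fin by (cases "hausdorff_outer d A") (auto simp flip: ennreal_plus simp: ennreal_less_iff)
      finally show ?thesis .
    qed
    then obtain C :: "nat \<Rightarrow> 'a set" where C: "A \<subseteq> (\<Union>i. C i)"
      "(\<Sum>i. hausdorff_gauge d ?\<delta> (C i)) < hausdorff_outer d A + ennreal ?\<delta>"
      unfolding hausdorff_pre_def outer_measure_def INF_less_iff by auto
    have "hausdorff_pre d ?\<delta> (\<Union>i. closure (C i)) \<le> (\<Sum>i. hausdorff_gauge d ?\<delta> (closure (C i)))"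
      by (rule hausdorff_pre_UN_le)
    also have "\<dots> = (\<Sum>i. hausdorff_gauge d ?\<delta> (C i))"
      by (simp add: hausdorff_gauge_closure)
    also have "\<dots> \<le> hausdorff_outer d A + ennreal ?\<delta>" using C(2) by (rule less_imp_le)
    finally have "hausdorff_pre d ?\<delta> (\<Union>i. closure (C i)) \<le> hausdorff_outer d A + ennreal ?\<delta>" .
    moreover have "A \<subseteq> (\<Union>i. closure (C i))"
      using C(1) closure_subset by blast
    moreover have "(\<Union>i. closure (C i)) \<in> sets borel" by auto
    ultimately show ?thesis by blast
  qed
  then obtain C where C: "\<And>n. A \<subseteq> C n" "\<And>n::nat. C n \<in> sets borel"
     "\<And>n. hausdorff_pre d (1 / real (Suc n)) (C n) \<le> hausdorff_outer d A + ennreal (1 / real (Suc n))"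
    by metis
  note mono = outer_measure_mono[OF outer_measure_space_hausdorff_pre[of d, where 'a='a]]
  show thesis
  proof
    show "(\<Inter>n. C n) \<in> sets borel" using C by (intro sets.countable_INT) auto
    show "A \<subseteq> (\<Inter>n. C n)" using C by auto
    show "hausdorff_outer d (\<Inter>n. C n) = hausdorff_outer d A"
    proof (rule antisym)
      show "hausdorff_outer d A \<le> hausdorff_outer d (\<Inter>n. C n)"
        using C(1) by (intro outer_measure_mono[OF outer_measure_space_hausdorff_outer]) auto
      show "hausdorff_outer d (\<Inter>n. C n) \<le> hausdorff_outer d A"
        unfolding hausdorff_outer_def[of d "\<Inter>n. C n"]
      proof (rule SUP_least, rule ennreal_le_epsilon)
        fix \<delta> e :: real assume "\<delta> \<in> {0<..}" "0 < e"
        then obtain n where n: "1 / real (Suc n) < min \<delta> e"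
          using reals_Archimedean[of "min \<delta> e"] by (auto simp: inverse_eq_divide)
        have "hausdorff_pre d \<delta> (\<Inter>n. C n) \<le> hausdorff_pre d (1 / real (Suc n)) (\<Inter>n. C n)"
          using n by (intro hausdorff_pre_antimono) auto
        also have "\<dots> \<le> hausdorff_pre d (1 / real (Suc n)) (C n)" by (rule mono) auto
        also have "\<dots> \<le> hausdorff_outer d A + ennreal (1 / real (Suc n))" by (rule C)
        also have "\<dots> \<le> hausdorff_outer d A + ennreal e"
          using n by (intro add_left_mono ennreal_leI) auto
        finally show "hausdorff_pre d \<delta> (\<Inter>n. C n) \<le> hausdorff_outer d A + ennreal e" .
      qed
    qed
  qed
qed

text \<open>\<open>N k\<close> collects the points of \<open>A\<close> where the density stays above
  \<open>1 / (k + 1)\<close> along arbitrarily small radii. Disjoint Vitali balls inside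
  \<open>U\<close> have radii summing to at most \<open>(k + 1) * \<mu> U\<close>, and their
  fivefold enlargements cover \<open>N k\<close>. Smallness is expressed through open neighbourhoods
  because \<open>A\<close> may fail to be Borel, in which case its own \<mu>-measure would be 0 by
  convention.\<close>

lemma AE_hausdorff_1_density_zero:
  fixes \<mu> :: "'a::euclidean_space measure" and A :: "'a set"
  assumes sets: "sets \<mu> = sets borel" and fin: "emeasure \<mu> UNIV < \<infinity>"
    and outer: "\<And>\<epsilon>::real. \<epsilon> > 0 \<Longrightarrow> \<exists>U. open U \<and> A \<subseteq> U \<and> emeasure \<mu> U < ennreal \<epsilon>"
  shows "AE x in hausdorff_measure 1. x \<in> A \<longrightarrow> ((\<lambda>r. measure \<mu> (ball x r) / r) \<longlongrightarrow> 0) (at_right 0)"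
proof -
  define N where "N k = {x\<in>A. \<forall>\<delta>>0. \<exists>r. 0 < r \<and> r < \<delta> \<and> r < real (Suc k) * measure \<mu> (ball x r)}" for k
  interpret finite_measure \<mu>
    using fin sets_eq_imp_space_eq[OF sets] by (intro finite_measureI) auto
  have [measurable]: "ball x r \<in> sets \<mu>" for x r by (simp add: sets)
  have "hausdorff_pre 1 \<delta> (N k) = 0" if "\<delta> > 0" for k \<delta>
  proof -
    have "hausdorff_pre 1 \<delta> (N k) \<le> 0 + ennreal \<epsilon>" if "\<epsilon> > 0" for \<epsilon> :: real
    proof -
      \<comment> \<open>A ball enlarged to radius \<open>5 * r\<close> has diameter
        \<open>10 * r\<close>, and \<open>r\<close> is below \<open>(k + 1)\<close> times the mass
        of the original ball; this fixes the divisor.\<close>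
      obtain U where U: "open U" "A \<subseteq> U" "emeasure \<mu> U < ennreal (\<epsilon> / (10 * real (Suc k)))"
        using outer[of "\<epsilon> / (10 * real (Suc k))"] \<open>\<epsilon> > 0\<close> by auto
      \<comment> \<open>Radii below \<open>\<delta> / 10\<close> keep the enlarged balls within
        diameter \<delta>.\<close>
      have "\<exists>r. 0 < r \<and> r < \<delta> / 10 \<and> ball x r \<subseteq> U \<and> r < real (Suc k) * measure \<mu> (ball x r)"
        if "x \<in> N k" for x
      proof -
        have "x \<in> U" using that U by (auto simp: N_def)
        then obtain e where e: "e > 0" "ball x e \<subseteq> U" using U(1) open_contains_ball by blast
        have "0 < min e (\<delta> / 10)" using e(1) \<open>\<delta> > 0\<close> by simp
        then obtain r where "0 < r" "r < min e (\<delta> / 10)" "r < real (Suc k) * measure \<mu> (ball x r)"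
          using \<open>x \<in> N k\<close> unfolding N_def by blast
        moreover from this have "ball x r \<subseteq> U" using e(2) subset_ball[of r e x] by auto
        ultimately show ?thesis by auto
      qed
      then obtain r where r: "\<And>x. x \<in> N k \<Longrightarrow> 0 < r x \<and> r x < \<delta> / 10 \<and> ball x (r x) \<subseteq> U \<and>
           r x < real (Suc k) * measure \<mu> (ball x (r x))" by metis
      obtain C where C: "countable C" "C \<subseteq> N k"
        "pairwise (\<lambda>i j. disjnt (ball i (r i)) (ball j (r j))) C" "N k \<subseteq> (\<Union>i\<in>C. ball i (5 * r i))"
      proof (rule Vitali_covering_lemma_balls[where S = "N k" and K = "N k" and a = "\<lambda>x. x" and r = r and B = "\<delta> / 10"])
        show "N k \<subseteq> (\<Union>i\<in>N k. ball i (r i))" using r by (meson UN_I centre_in_ball subsetI)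
        show "\<And>i. i \<in> N k \<Longrightarrow> 0 < r i \<and> r i \<le> \<delta> / 10" using r by (meson less_imp_le)
      qed
      show ?thesis
      proof (cases "C = {}")
        case True
        then have "N k = {}" using C by auto
        then show ?thesis
          using outer_measure_space_hausdorff_pre[of 1 \<delta>, where 'a='a]
          by (simp add: outer_measure_space_def positive_def)
      next
        case False
        have cd: "emeasure \<mu> (\<Union>i\<in>C. ball i (r i)) = (\<integral>\<^sup>+i. emeasure \<mu> (ball i (r i)) \<partial>count_space C)"
          using C by (intro emeasure_UN_countable)
            (auto simp: disjoint_family_on_def pairwise_def disjnt_def)
        \<comment> \<open>Covers are sequences, so the countable family \<open>C\<close> is
          enumerated and padded with empty sets.\<close>
        define D where "D n = (if n \<in> to_nat_on C ` C then ball (from_nat_into C n) (5 * r (from_nat_into C n)) else {})" for n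
        have D_in: "D (to_nat_on C x) = ball x (5 * r x)" if "x \<in> C" for x
          using that C by (simp add: D_def)
        have diamD: "diameter (ball x (5 * r x)) = 10 * r x" if "x \<in> C" for x
          using r[of x] that C by (simp add: diameter_ball subset_iff)
        have "hausdorff_pre 1 \<delta> (N k) \<le> (\<Sum>n. ennreal (diameter (D n)))"
        proof (rule hausdorff_pre_1_le)
          show "N k \<subseteq> (\<Union>n. D n)"
          proof
            fix x assume "x \<in> N k"
            then obtain i where "i \<in> C" "x \<in> ball i (5 * r i)" using C by auto
            then show "x \<in> (\<Union>n. D n)" using D_in[of i] by blast
          qed
          show "bounded (D n)" for n by (simp add: D_def)
          show "diameter (D n) \<le> \<delta>" for n
          proof (cases "n \<in> to_nat_on C ` C")
            case True
            then obtain x where "x \<in> C" "n = to_nat_on C x" by auto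
            then show ?thesis using D_in diamD r[of x] C by (simp add: subset_iff)
          qed (use \<open>\<delta> > 0\<close> in \<open>auto simp: D_def\<close>)
        qed
        also have "\<dots> = (\<integral>\<^sup>+n. ennreal (diameter (D n)) \<partial>count_space UNIV)"
          by (simp add: nn_integral_count_space_nat)
        also have "\<dots> = (\<integral>\<^sup>+n. ennreal (diameter (D n)) \<partial>count_space (to_nat_on C ` C))"
          by (rule nn_integral_count_space_eq) (auto simp: D_def)
        also have "\<dots> = (\<integral>\<^sup>+x. ennreal (diameter (D (to_nat_on C x))) \<partial>count_space C)"
          by (rule nn_integral_bij_count_space[symmetric]) (simp add: bij_betw_def C inj_on_to_nat_on)
        also have "\<dots> \<le> (\<integral>\<^sup>+x. ennreal (10 * real (Suc k)) * emeasure \<mu> (ball x (r x)) \<partial>count_space C)"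
        proof (rule nn_integral_mono)
          fix x assume "x \<in> space (count_space C)"
          then have x: "x \<in> C" by simp
          then have "r x < real (Suc k) * measure \<mu> (ball x (r x))"
            using r C by blast
          then have "10 * r x \<le> (10 * real (Suc k)) * measure \<mu> (ball x (r x))"
            by (simp only: mult.assoc)
          then show "ennreal (diameter (D (to_nat_on C x))) \<le> ennreal (10 * real (Suc k)) * emeasure \<mu> (ball x (r x))"
            unfolding D_in[OF x] diamD[OF x] emeasure_eq_measure
            by (subst ennreal_mult'[symmetric]) (auto intro: ennreal_leI)
        qed
        also have "\<dots> = ennreal (10 * real (Suc k)) * emeasure \<mu> (\<Union>i\<in>C. ball i (r i))"
          by (simp add: nn_integral_cmult cd)
        also have "\<dots> \<le> ennreal (10 * real (Suc k)) * emeasure \<mu> U"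
          using r C U by (intro mult_left_mono emeasure_mono) (auto simp: sets subset_iff)
        also have "\<dots> \<le> ennreal (10 * real (Suc k)) * ennreal (\<epsilon> / (10 * real (Suc k)))"
          using U by (intro mult_left_mono) auto
        also have "\<dots> = ennreal \<epsilon>"
          using \<open>\<epsilon> > 0\<close> by (subst ennreal_mult'[symmetric]) auto
        finally show ?thesis by simp
      qed
    qed
    then have "hausdorff_pre 1 \<delta> (N k) \<le> 0" by (rule ennreal_le_epsilon)
    then show ?thesis by simp
  qed
  then have "hausdorff_outer 1 (N k) = 0" for k
    by (simp add: hausdorff_outer_def)
  then have "N k \<in> null_sets (hausdorff_measure 1)" for k by (rule hausdorff_null_setsI)
  then have "AE x in hausdorff_measure 1. \<forall>k. x \<notin> N k"
    by (simp add: AE_all_countable AE_not_in)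
  then show ?thesis
  proof (rule AE_mp, intro AE_I2 impI)
    fix x assume nN: "\<forall>k. x \<notin> N k" and "x \<in> A"
    show "((\<lambda>r. measure \<mu> (ball x r) / r) \<longlongrightarrow> 0) (at_right 0)"
    proof (rule tendstoI)
      fix e :: real assume "e > 0"
      then obtain k where k: "1 / real (Suc k) < e"
        using reals_Archimedean by (auto simp: inverse_eq_divide)
      obtain \<delta> where \<delta>: "\<delta> > 0" "\<And>r. 0 < r \<Longrightarrow> r < \<delta> \<Longrightarrow> real (Suc k) * measure \<mu> (ball x r) \<le> r"
      proof -
        have "x \<notin> N k" using nN by blast
        then show ?thesis using \<open>x \<in> A\<close> that unfolding N_def by (auto simp: not_less not_le) (meson not_less)
      qed
      have "dist (measure \<mu> (ball x r) / r) 0 < e" if "0 < r" "r < \<delta>" for r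
      proof -
        have "measure \<mu> (ball x r) / r \<le> 1 / real (Suc k)"
          using \<delta>(2)[OF that] that by (simp add: field_simps)
        with k that show ?thesis by (simp add: dist_real_def)
      qed
      with \<delta>(1) show "\<forall>\<^sub>F r in at_right 0. dist (measure \<mu> (ball x r) / r) 0 < e"
        by (auto simp: eventually_at_right_field)
    qed
  qed
qed

lemma outer_regular_null_set:
  fixes M :: "'a::euclidean_space measure"
  assumes "sets M = sets borel" "emeasure M UNIV < \<infinity>" "B \<in> sets borel" "emeasure M B = 0" "\<epsilon> > (0::real)"
  shows "\<exists>U. open U \<and> B \<subseteq> U \<and> emeasure M U < ennreal \<epsilon>"
proof -
  have "emeasure M (space M) \<noteq> \<infinity>"
    using assms(2) sets_eq_imp_space_eq[OF assms(1)] by auto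
  then have "(INF U\<in>{U. B \<subseteq> U \<and> open U}. emeasure M U) < ennreal \<epsilon>"
    using outer_regular[OF assms(1) _ assms(3)] assms(4,5) by simp
  then show ?thesis by (auto simp: INF_less_iff)
qed

section \<open>Measurability, and comparison of length with Lebesgue measure\<close>

lemma sets_hausdorff_measureI:
  "A \<in> sets borel \<Longrightarrow> A \<in> sets (hausdorff_measure d)"
  using sets_borel_subset_hausdorff_measure by blast

lemma measurable_hausdorff_measureI:
  fixes f :: "'a::metric_space \<Rightarrow> 'b::topological_space"
  assumes "f \<in> borel_measurable borel" shows "f \<in> borel_measurable (hausdorff_measure d)"
  using assms by (auto simp: measurable_def intro: sets_hausdorff_measureI)

text \<open>Each covering set is traded for the interval between the infimum and the supremum of
  \<open>f\<close> on it, whose length is at most the diameter of the set. Lebesgue measure is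
  countably subadditive, so covers at the single scale 1 suffice. The image of \<open>X\<close> need
  not be Borel, hence the Borel subset \<open>B\<close>.\<close>

lemma lborel_le_hausdorff_outer_1:
  fixes f :: "'a::metric_space \<Rightarrow> real"
  assumes lip: "\<And>x y. \<bar>f x - f y\<bar> \<le> dist x y" and B: "B \<in> sets borel" "B \<subseteq> f ` X"
  shows "emeasure lborel B \<le> hausdorff_outer 1 X"
proof -
  have "emeasure lborel B \<le> hausdorff_pre 1 1 X"
    unfolding hausdorff_pre_def outer_measure_def
  proof (rule INF_greatest)
    fix C :: "nat \<Rightarrow> 'a set"
    assume C: "C \<in> {A. range A \<subseteq> UNIV \<and> disjoint_family A \<and> X \<subseteq> (\<Union>i. A i)}"
    show "emeasure lborel B \<le> (\<Sum>i. hausdorff_gauge 1 1 (C i))"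
    proof (cases "\<exists>i. hausdorff_gauge 1 1 (C i) = \<infinity>")
      case True
      then obtain i where "hausdorff_gauge 1 1 (C i) = \<infinity>" by blast
      then have "(\<Sum>i. hausdorff_gauge 1 1 (C i)) = \<infinity>"
        using sum_le_suminf[of "\<lambda>i. hausdorff_gauge 1 1 (C i)" "{i}"] by (simp add: top_unique)
      then show ?thesis by simp
    next
      case False
      then have bd: "bounded (C i)" "diameter (C i) \<le> 1" if "C i \<noteq> {}" for i
        using that by (auto simp: hausdorff_gauge_def split: if_splits)
      define J where "J i = (if C i = {} then {} else {Inf (f ` C i) .. Sup (f ` C i)})" for i
      have J: "f ` C i \<subseteq> J i \<and> emeasure lborel (J i) \<le> hausdorff_gauge 1 1 (C i)" for i
      proof (cases "C i = {}")
        case ne: False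
        have le: "f x \<le> f y + diameter (C i)" if "x \<in> C i" "y \<in> C i" for x y
          using lip[of x y] diameter_bounded_bound[OF bd(1)[OF ne] that] by linarith
        obtain z where z: "z \<in> C i" using ne by auto
        have bdd: "bdd_above (f ` C i)" "bdd_below (f ` C i)"
          using le[OF _ z] le[OF z] by (auto intro!: bdd_aboveI2[of _ _ "f z + diameter (C i)"]
              bdd_belowI2[of _ "f z - diameter (C i)"] simp: diff_le_eq)
        have "Sup (f ` C i) - diameter (C i) \<le> Inf (f ` C i)"
        proof (rule cINF_greatest)
          fix y assume y: "y \<in> C i"
          have "Sup (f ` C i) \<le> f y + diameter (C i)"
            using ne y le by (intro cSUP_least) auto
          then show "Sup (f ` C i) - diameter (C i) \<le> f y" by simp
        qed (use ne in auto)
        moreover have "Inf (f ` C i) \<le> Sup (f ` C i)"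
          using cINF_lower[OF bdd(2) z] cSUP_upper[OF z bdd(1)] by linarith
        moreover have "f ` C i \<subseteq> {Inf (f ` C i) .. Sup (f ` C i)}"
          using bdd by (auto intro: cINF_lower cSUP_upper)
        ultimately show ?thesis
          using ne bd[OF ne] by (auto simp: J_def hausdorff_gauge_def unit_ball_vol_1 intro!: ennreal_leI)
      qed (simp add: J_def)
      have "B \<subseteq> (\<Union>i. J i)"
      proof
        fix b assume "b \<in> B"
        then obtain x where "x \<in> X" "b = f x" using B(2) by auto
        moreover from this obtain i where "x \<in> C i" using C by auto
        ultimately show "b \<in> (\<Union>i. J i)" using J[of i] by blast
      qed
      then have "emeasure lborel B \<le> emeasure lborel (\<Union>i. J i)"
        by (rule emeasure_mono) (auto simp: J_def)
      also have "\<dots> \<le> (\<Sum>i. emeasure lborel (J i))"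
        by (rule emeasure_subadditive_countably) (auto simp: J_def)
      also have "\<dots> \<le> (\<Sum>i. hausdorff_gauge 1 1 (C i))"
        using J by (intro suminf_le) auto
      finally show ?thesis .
    qed
  qed
  also have "\<dots> \<le> hausdorff_outer 1 X" by (rule hausdorff_pre_le_outer) simp
  finally show ?thesis .
qed

text \<open>Slicing \<open>X\<close> by short level intervals of \<open>f\<close> gives pieces whose
  diameter is at most \<open>K\<close> times the length of the interval.\<close>

lemma hausdorff_outer_1_graph_finite:
  fixes f :: "'a::real_normed_vector \<Rightarrow> real"
  assumes expand: "\<And>x y. x \<in> X \<Longrightarrow> y \<in> X \<Longrightarrow> dist x y \<le> K * \<bar>f x - f y\<bar>"
    and bound: "\<And>x. x \<in> X \<Longrightarrow> \<bar>f x\<bar> \<le> a" and "0 < K" "0 < a"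
  shows "hausdorff_outer 1 X < \<infinity>"
proof -
  have "hausdorff_pre 1 \<delta> X \<le> ennreal (4 * a * K)" if "\<delta> > 0" for \<delta>
  proof -
    \<comment> \<open>With slices of height \<open>2 * a / n\<close>, this makes \<open>K\<close>
      times the height at most \<delta>.\<close>
    obtain n where n: "2 * a * K / \<delta> < real n" using reals_Archimedean2 by blast
    have "0 < 2 * a * K / \<delta>" using assms that by simp
    with n have n0: "n > 0" by (metis less_trans of_nat_0_less_iff)
    define h where "h = 2 * a / real n"
    have h: "h > 0" "K * h \<le> \<delta>"
      using n n0 assms that by (auto simp: h_def field_simps)
    \<comment> \<open>The index \<open>n\<close> itself occurs when \<open>f x = a\<close>, so there
      are \<open>n + 1\<close> slices; estimating \<open>n + 1\<close> by \<open>2 * n\<close>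
      produces the 4 in the bound.\<close>
    define A where "A i = (if i \<le> n then {x\<in>X. f x + a \<in> {real i * h .. (real i + 1) * h}} else {})" for i
    have dist_A: "dist x y \<le> K * h" if "x \<in> A i" "y \<in> A i" for x y i
    proof -
      have "\<bar>f x - f y\<bar> \<le> h"
        using that by (auto simp: A_def algebra_simps split: if_splits)
      then have "K * \<bar>f x - f y\<bar> \<le> K * h" using assms by simp
      moreover have "x \<in> X" "y \<in> X" using that by (auto simp: A_def split: if_splits)
      ultimately show ?thesis using expand[of x y] by linarith
    qed
    have bdA: "bounded (A i)" for i
    proof (cases "A i = {}")
      case False
      then obtain z where "z \<in> A i" by blast
      then show ?thesis using dist_A unfolding bounded_def by blast
    qed simp
    have diamA: "diameter (A i) \<le> K * h" for i
      using dist_A h(1) \<open>0 < K\<close> by (intro diameter_le) (auto simp: dist_norm[symmetric])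
    have "X \<subseteq> (\<Union>i. A i)"
    proof
      fix x assume x: "x \<in> X"
      define i where "i = nat \<lfloor>(f x + a) / h\<rfloor>"
      have nn: "0 \<le> (f x + a) / h" using bound[OF x] h by auto
      have i: "real i \<le> (f x + a) / h" "(f x + a) / h < real i + 1"
        using nn by (auto simp: i_def)
      have "f x + a \<le> 2 * a" using bound[OF x] by auto
      then have "(f x + a) / h \<le> 2 * a / h" using h by (intro divide_right_mono) auto
      also have "2 * a / h = real n" using assms n0 by (simp add: h_def)
      finally have "i \<le> n" using i(1) by linarith
      moreover have "real i * h \<le> f x + a" "f x + a \<le> (real i + 1) * h"
        using i h by (auto simp: field_simps)
      ultimately show "x \<in> (\<Union>i. A i)" using x by (auto simp: A_def)
    qed
    then have "hausdorff_pre 1 \<delta> X \<le> (\<Sum>i. ennreal (diameter (A i)))"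
      using bdA diamA h by (intro hausdorff_pre_1_le) (auto intro: order_trans)
    also have "\<dots> = (\<Sum>i\<in>{..n}. ennreal (diameter (A i)))"
      by (rule suminf_finite) (auto simp: A_def)
    also have "\<dots> \<le> (\<Sum>i\<in>{..n}. ennreal (K * h))"
      using diamA by (intro sum_mono ennreal_leI) auto
    also have "\<dots> = ennreal ((real n + 1) * (K * h))"
      using assms h by (simp add: ennreal_mult' add.commute flip: ennreal_of_nat_eq_real_of_nat)
    also have "\<dots> \<le> ennreal (4 * a * K)"
    proof (rule ennreal_leI)
      have "(real n + 1) * (K * h) \<le> (2 * real n) * (K * h)"
        using n0 assms h by (intro mult_right_mono) auto
      also have "\<dots> = 4 * a * K" using n0 by (simp add: h_def)
      finally show "(real n + 1) * (K * h) \<le> 4 * a * K" .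
    qed
    finally show ?thesis .
  qed
  then have "hausdorff_outer 1 X \<le> ennreal (4 * a * K)"
    unfolding hausdorff_outer_def by (intro SUP_least) auto
  then show ?thesis by (auto simp: order_le_less_trans)
qed


section \<open>Flux through a graph in orthonormal coordinates\<close>

locale orthonormal_frame =
  fixes p v \<nu> :: "real ^ 2"
  assumes frame: "norm v = 1" "norm \<nu> = 1" "inner v \<nu> = 0"
begin

definition point :: "real \<Rightarrow> real \<Rightarrow> real ^ 2" where
  "point s t = p + s *\<^sub>R v + t *\<^sub>R \<nu>"

definition tang :: "real ^ 2 \<Rightarrow> real" where "tang x = inner (x - p) v"
definition normal :: "real ^ 2 \<Rightarrow> real" where "normal x = inner (x - p) \<nu>"

lemma inner_frame [simp]: "inner v v = 1" "inner \<nu> \<nu> = 1" "inner v \<nu> = 0" "inner \<nu> v = 0"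
  using frame by (auto simp: norm_eq_1 inner_commute)

lemma coords_point [simp]: "tang (point s t) = s" "normal (point s t) = t"
  by (simp_all add: tang_def normal_def point_def inner_add_left)

text \<open>Two orthonormal vectors are independent, and the plane has dimension 2, so they span
  it.\<close>

lemma frame_expand: "x = inner x v *\<^sub>R v + inner x \<nu> *\<^sub>R \<nu>" for x :: "real ^ 2"
proof -
  have "pairwise orthogonal {v, \<nu>}" "v \<noteq> \<nu>" "v \<noteq> 0" "\<nu> \<noteq> 0"
    using inner_frame by (auto simp: pairwise_def orthogonal_def simp del: inner_frame)
  then have "independent {v, \<nu>}" by (intro pairwise_orthogonal_independent) auto
  then have "UNIV \<subseteq> span {v, \<nu>}"
    using \<open>v \<noteq> \<nu>\<close> by (intro card_ge_dim_independent) auto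
  then have "x \<in> span {v, \<nu>}" by blast
  then obtain a b where "x - a *\<^sub>R v = b *\<^sub>R \<nu>"
    by (auto simp: span_breakdown_eq)
  then have "x = a *\<^sub>R v + b *\<^sub>R \<nu>" by (simp add: diff_eq_eq add.commute)
  then show ?thesis by (simp add: inner_add_left)
qed

lemma point_coords [simp]: "point (tang x) (normal x) = x"
proof -
  have "point (tang x) (normal x) = p + (inner (x - p) v *\<^sub>R v + inner (x - p) \<nu> *\<^sub>R \<nu>)"
    by (simp only: point_def tang_def normal_def add.assoc)
  also have "\<dots> = p + (x - p)" using frame_expand[of "x - p"] by metis
  finally show ?thesis by simp
qed

lemma norm_frame: "(norm x)\<^sup>2 = (inner x v)\<^sup>2 + (inner x \<nu>)\<^sup>2" for x :: "real ^ 2"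
proof -
  have "(norm x)\<^sup>2 = inner x (inner x v *\<^sub>R v + inner x \<nu> *\<^sub>R \<nu>)"
    using frame_expand[of x] by (simp add: power2_norm_eq_inner)
  then show ?thesis by (simp add: inner_add_right power2_eq_square)
qed

lemma abs_tang_diff_le: "\<bar>tang x - tang y\<bar> \<le> dist x y"
  using Cauchy_Schwarz_ineq2[of "x - y" v] frame
  by (simp add: tang_def dist_norm inner_diff_left)

lemma continuous_point: "continuous_on UNIV (\<lambda>z. point (fst z) (snd z))"
  unfolding point_def by (intro continuous_intros)

lemma continuous_coords [continuous_intros]:
  "continuous_on A tang" "continuous_on A normal"
  unfolding tang_def normal_def by (auto intro!: continuous_intros)

lemma measurable_point [measurable]: "(\<lambda>z. point (fst z) (snd z)) \<in> borel_measurable borel"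
  using continuous_point by (rule borel_measurable_continuous_onI)

lemma measurable_coords [measurable]: "tang \<in> borel_measurable borel" "normal \<in> borel_measurable borel"
  by (auto intro!: borel_measurable_continuous_onI continuous_coords)

text \<open>\<open>point\<close> is a composition of three measure-preserving maps: the
  identification \<open>?J\<close> of pairs with vectors, the orthogonal map \<open>?R\<close>
  taking the standard basis to the frame, and the translation by \<open>p\<close>. Pairs serve as
  the source so that Fubini's theorem can integrate along normal lines.\<close>

lemma lborel_eq_distr_point:
  "(lborel :: (real ^ 2) measure) = distr lborel borel (\<lambda>z. point (fst z) (snd z))"
proof -
  let ?J = "\<lambda>z::real \<times> real. fst z *\<^sub>R axis 1 1 + snd z *\<^sub>R axis 2 1 :: real ^ 2"
  let ?R = "\<lambda>x::real ^ 2. (x $ 1) *\<^sub>R v + (x $ 2) *\<^sub>R \<nu>"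
  have J_cont: "continuous_on UNIV ?J"
    by (intro continuous_intros)
  then have J[measurable]: "?J \<in> borel_measurable borel"
    by (rule borel_measurable_continuous_onI)
  have R[measurable]: "?R \<in> borel_measurable borel"
    by (intro borel_measurable_continuous_onI continuous_intros)
  have 1: "(lborel :: (real ^ 2) measure) = distr lborel borel ?J"
  proof (rule lborel_eqI)
    fix l u :: "real ^ 2" assume lu: "\<And>b. b \<in> Basis \<Longrightarrow> l \<bullet> b \<le> u \<bullet> b"
    then have lu': "l $ 1 \<le> u $ 1" "l $ 2 \<le> u $ 2"
      by (auto simp: cart_eq_inner_axis axis_in_Basis_iff)
    have "?J -` box l u = box (l $ 1, l $ 2) (u $ 1, u $ 2)"
      by (auto simp: mem_box_cart forall_2 mem_box Basis_prod_def axis_def)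
    then have "emeasure (distr lborel borel ?J) (box l u) = emeasure lborel (box (l $ 1, l $ 2) (u $ 1, u $ 2))"
      by (subst emeasure_distr) (auto simp: J[unfolded measurable_lborel1[symmetric]])
    also have "\<dots> = ennreal ((u $ 1 - l $ 1) * (u $ 2 - l $ 2))"
      using lu' by (subst emeasure_lborel_box)
        (auto simp: Basis_prod_def prod.union_disjoint image_iff ennreal_mult mult.commute)
    also have "(u $ 1 - l $ 1) * (u $ 2 - l $ 2) = (\<Prod>b\<in>Basis. (u - l) \<bullet> b)"
    proof -
      have "(Basis :: (real ^ 2) set) = {axis 1 1, axis 2 1}"
        by (auto simp: Basis_vec_def) (metis exhaust_2)
      then have "(\<Prod>b\<in>Basis. (u - l) \<bullet> b) = (\<Prod>b\<in>{axis 1 1, axis 2 1}. (u - l) \<bullet> b)"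
        by (rule arg_cong)
      then show ?thesis by (simp add: axis_eq_axis inner_axis)
    qed
    finally show "emeasure (distr lborel borel ?J) (box l u) = ennreal (\<Prod>b\<in>Basis. (u - l) \<bullet> b)" .
  qed simp
  have 2: "(lborel :: (real ^ 2) measure) = distr lborel borel ?R"
  proof (rule lborel_eqI)
    fix l u :: "real ^ 2" assume lu: "\<And>b. b \<in> Basis \<Longrightarrow> l \<bullet> b \<le> u \<bullet> b"
    \<comment> \<open>\<open>?R'\<close> is the inverse of \<open>?R\<close>, so a preimage under
      \<open>?R\<close> is an image under \<open>?R'\<close>, and orthogonal maps preserve the
      measure of images.\<close>
    let ?R' = "\<lambda>x::real ^ 2. vector [inner x v, inner x \<nu>] :: real ^ 2"
    have lin: "linear ?R'"
      by (rule linearI) (simp_all add: vec_eq_iff forall_2 inner_add_left)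
    have orth: "orthogonal_transformation ?R'"
    proof (rule orthogonal_transformation[THEN iffD2], intro conjI allI lin)
      fix x
      have "(norm (vector [a, b] :: real ^ 2))\<^sup>2 = a\<^sup>2 + b\<^sup>2" for a b
        unfolding power2_norm_eq_inner by (simp add: inner_vec_def sum_2 power2_eq_square)
      then have "(norm (?R' x))\<^sup>2 = (norm x)\<^sup>2"
        by (simp only: norm_frame[of x])
      then show "norm (?R' x) = norm x" by simp
    qed
    have RR: "?R (?R' x) = x" for x using frame_expand[of x] by simp
    have R'R: "?R' (?R x) = x" for x by (simp add: vec_eq_iff forall_2 inner_add_left)
    have eq: "?R -` box l u = ?R' ` box l u"
    proof (intro set_eqI iffI)
      fix x assume "x \<in> ?R -` box l u"
      then show "x \<in> ?R' ` box l u" using R'R[of x] by (intro image_eqI[of _ _ "?R x"]) auto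
    next
      fix x assume "x \<in> ?R' ` box l u"
      then show "x \<in> ?R -` box l u" using RR by auto
    qed
    have ms: "?R' ` box l u \<in> lmeasurable" "measure lebesgue (?R' ` box l u) = measure lebesgue (box l u)"
      using measurable_orthogonal_image[OF orth] measure_orthogonal_image[OF orth] by auto
    have [measurable]: "?R' ` box l u \<in> sets borel"
      unfolding eq[symmetric] using measurable_sets[OF R, of "box l u"] by simp
    have W: "emeasure lborel W = ennreal (measure lebesgue W)" if "W \<in> sets borel" "W \<in> lmeasurable" for W :: "(real ^ 2) set"
    proof -
      have "W \<in> sets lborel" using that(1) by simp
      then have "emeasure lebesgue W = emeasure lborel W"
        by (subst emeasure_completion) (auto intro: sets_completionI_sets)
      then show ?thesis using emeasure_eq_measure2[OF that(2)] by (rule trans[OF sym])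
    qed
    have "emeasure (distr lborel borel ?R) (box l u) = emeasure lborel (?R' ` box l u)"
      by (subst emeasure_distr) (auto simp: eq)
    also have "\<dots> = ennreal (measure lebesgue (box l u))"
      using W ms by simp
    also have "\<dots> = (\<Prod>b\<in>Basis. (u - l) \<bullet> b)"
      using lu by (simp add: measure_lborel_box)
    finally show "emeasure (distr lborel borel ?R) (box l u) = ennreal (\<Prod>b\<in>Basis. (u - l) \<bullet> b)" .
  qed simp
  have "(lborel :: (real ^ 2) measure) = distr lborel borel ((+) p)"
    by (simp add: lborel_distr_plus)
  also have "\<dots> = distr (distr (distr lborel borel ?J) borel ?R) borel ((+) p)"
    using 1 2 by simp
  also have "\<dots> = distr lborel borel (\<lambda>z. point (fst z) (snd z))"
  proof -
    have "?J \<in> measurable lborel borel" using J by simp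
    then have "distr (distr lborel borel ?J) borel ?R = distr lborel borel (?R \<circ> ?J)"
      "?R \<circ> ?J \<in> measurable lborel borel"
      by (rule distr_distr[OF R] measurable_comp[OF _ R])+
    moreover from this(2) have "distr (distr lborel borel (?R \<circ> ?J)) borel ((+) p) = distr lborel borel ((+) p \<circ> (?R \<circ> ?J))"
      by (intro distr_distr) simp_all
    moreover have "(+) p \<circ> (?R \<circ> ?J) = (\<lambda>z. point (fst z) (snd z))"
      by (auto simp: fun_eq_iff point_def axis_def add.assoc)
    ultimately show ?thesis by simp
  qed
  finally show ?thesis .
qed

section \<open>Strips and the flux through a graph\<close>

lemma norm_le_coords: "dist p x \<le> \<bar>tang x\<bar> + \<bar>normal x\<bar>"
proof -
  have "norm (x - p) = norm (tang x *\<^sub>R v + normal x *\<^sub>R \<nu>)"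
    unfolding tang_def normal_def by (rule arg_cong[OF frame_expand])
  also have "\<dots> \<le> norm (tang x *\<^sub>R v) + norm (normal x *\<^sub>R \<nu>)" by (rule norm_triangle_ineq)
  finally show ?thesis using frame by (simp add: dist_norm norm_minus_commute)
qed

lemma compact_strip: "compact {x. \<bar>tang x\<bar> \<le> a \<and> \<bar>normal x\<bar> \<le> b}" (is "compact ?Q")
proof -
  have "closed ?Q" by (intro closed_Collect_conj closed_Collect_le continuous_intros)
  moreover have "?Q \<subseteq> cball p (a + b)"
  proof
    fix x assume "x \<in> ?Q"
    then show "x \<in> cball p (a + b)" using norm_le_coords[of x] by simp
  qed
  ultimately show ?thesis
    using bounded_cball bounded_subset compact_eq_bounded_closed by blast
qed

lemma emeasure_strip:
  assumes "0 \<le> a" "lo \<le> hi"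
  shows "emeasure lborel {x. \<bar>tang x\<bar> \<le> a \<and> lo \<le> normal x \<and> normal x \<le> hi} = ennreal (2 * a * (hi - lo))"
    (is "emeasure lborel ?A = _")
proof -
  have "emeasure lborel ?A = emeasure lborel ((\<lambda>z. point (fst z) (snd z)) -` ?A)"
    by (subst lborel_eq_distr_point) (simp add: emeasure_distr)
  also have "(\<lambda>z. point (fst z) (snd z)) -` ?A = cbox (- a, lo) (a, hi)"
    by (auto simp: cbox_Pair_eq)
  also have "emeasure lborel \<dots> = ennreal (2 * a * (hi - lo))"
    using assms by (subst emeasure_lborel_cbox)
      (auto simp: Basis_prod_def prod.union_disjoint image_iff ennreal_mult mult.commute)
  finally show ?thesis .
qed

text \<open>
  The tangential coordinate is 1-Lipschitz, so it pushes the Hausdorff measure of the graph forward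
  to a measure above Lebesgue measure; this replaces the area formula.
\<close>

lemma hausdorff_boundary_ge_flux:
  fixes \<psi> G :: "real ^ 2 \<Rightarrow> real"
  assumes "0 \<le> a" "0 \<le> b" "open E"
    and graph: "\<And>s t. \<bar>s\<bar> \<le> a \<Longrightarrow> \<bar>t\<bar> \<le> b \<Longrightarrow> point s t \<in> E \<longleftrightarrow> t < \<gamma> s"
      "\<And>s t. \<bar>s\<bar> \<le> a \<Longrightarrow> \<bar>t\<bar> \<le> b \<Longrightarrow> point s t \<in> frontier E \<longleftrightarrow> t = \<gamma> s"
      "\<And>s. \<bar>s\<bar> \<le> a \<Longrightarrow> \<bar>\<gamma> s\<bar> \<le> b"
    and \<psi>: "continuous_on UNIV \<psi>" "\<And>x. 0 \<le> \<psi> x"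
      "\<And>x. \<psi> x \<noteq> 0 \<Longrightarrow> \<bar>tang x\<bar> \<le> a \<and> \<bar>normal x\<bar> < b"
    and G: "continuous_on UNIV G" "\<And>x. G x \<noteq> 0 \<Longrightarrow> \<bar>tang x\<bar> \<le> a \<and> \<bar>normal x\<bar> \<le> b"
    and deriv: "\<And>s t. ((\<lambda>t. \<psi> (point s t)) has_real_derivative G (point s t)) (at t)"
  shows "ennreal (LINT x:E|lborel. G x) \<le> (\<integral>\<^sup>+x\<in>frontier E. ennreal (\<psi> x) \<partial>hausdorff_measure 1)"
proof -
  define H where "H x = indicator E x * G x" for x
  define F where "F s = (if \<bar>s\<bar> \<le> a then \<psi> (point s (\<gamma> s)) else 0)" for s
  define Q where "Q = {x. \<bar>tang x\<bar> \<le> a \<and> \<bar>normal x\<bar> \<le> b}"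
  have [measurable]: "E \<in> sets borel" using \<open>open E\<close> by simp
  have [measurable]: "G \<in> borel_measurable borel" "\<psi> \<in> borel_measurable borel"
    using G(1) \<psi>(1) by (auto intro: borel_measurable_continuous_onI)
  have [measurable]: "H \<in> borel_measurable borel" unfolding H_def by measurable
  have Q: "Q = {x. \<bar>tang x\<bar> \<le> a \<and> - b \<le> normal x \<and> normal x \<le> b}" by (auto simp: Q_def)
  have "compact Q" unfolding Q_def by (rule compact_strip)
  have closedQ: "closed Q" using \<open>compact Q\<close> by (rule compact_imp_closed)
   have "bounded (G ` Q)"
    using G(1) \<open>compact Q\<close> by (intro compact_imp_bounded compact_continuous_image) (auto intro: continuous_on_subset)
  then obtain C where C: "\<And>x. x \<in> Q \<Longrightarrow> \<bar>G x\<bar> \<le> C" by (auto simp: bounded_iff)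
  have "integrable lborel (\<lambda>x. indicator Q x * C)"
    using emeasure_strip[of a "- b" b] assms(1,2) closedQ
    by (intro integrable_mult_left integrable_real_indicator) (auto simp: Q)
  then have intH: "integrable lborel H"
  proof (rule Bochner_Integration.integrable_bound)
    have "norm (H x) \<le> norm (indicator Q x * C)" for x
      using C[of x] G(2)[of x] by (auto simp: H_def Q_def indicator_def)
    then show "AE x in lborel. norm (H x) \<le> norm (indicator Q x * C)" by simp
  qed simp
  \<comment> \<open>On a normal line \<open>E\<close> is the part below \<open>\<gamma> s\<close>
    within the window, up to one null point. The fundamental theorem then leaves the value of \<psi>
    on the graph; the lower end \<open>t = - b\<close> contributes 0, because \<psi> is supported
    where \<open>\<bar>normal x\<bar> < b\<close>.\<close>
  have inner: "(LINT t|lborel. H (point s t)) = F s" for s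
  proof (cases "\<bar>s\<bar> \<le> a")
    case True
    have \<gamma>: "- b \<le> \<gamma> s" "\<gamma> s \<le> b" using graph(3)[OF True] by auto
    have "AE t in lborel. H (point s t) = indicator {- b .. \<gamma> s} t *\<^sub>R G (point s t)"
      using AE_lborel_singleton[of "\<gamma> s"]
    proof eventually_elim
      case (elim t)
      show ?case
      proof (cases "\<bar>t\<bar> \<le> b")
        case t: True
        then show ?thesis using graph(1)[OF True t] elim by (auto simp: H_def indicator_def)
      next
        case False
        then have "G (point s t) = 0" using G(2)[of "point s t"] by auto
        then show ?thesis by (simp add: H_def)
      qed
    qed
    then have "(LINT t|lborel. H (point s t)) = (LINT t|lborel. indicator {- b .. \<gamma> s} t *\<^sub>R G (point s t))"
    proof (intro integral_cong_AE)
      have [measurable]: "(\<lambda>t. point s t) \<in> borel_measurable borel"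
        unfolding point_def by measurable
      show "(\<lambda>t. H (point s t)) \<in> borel_measurable lborel"
        "(\<lambda>t. indicator {- b .. \<gamma> s} t *\<^sub>R G (point s t)) \<in> borel_measurable lborel" by measurable
    qed
    also have "\<dots> = \<psi> (point s (\<gamma> s)) - \<psi> (point s (- b))"
    proof (rule integral_FTC_Icc)
      show "((\<lambda>t. \<psi> (point s t)) has_vector_derivative G (point s x)) (at x within {- b..\<gamma> s})" for x
        using deriv[of s x] has_field_derivative_at_within has_real_derivative_iff_has_vector_derivative by blast
      have "continuous_on UNIV (\<lambda>t. point s t)" unfolding point_def by (intro continuous_intros)
      then show "continuous_on {- b..\<gamma> s} (\<lambda>t. G (point s t))"
        by (intro continuous_on_compose2[OF G(1)]) (auto intro: continuous_on_subset)
    qed (fact \<gamma>)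
    also have "\<psi> (point s (- b)) = 0" using \<psi>(3)[of "point s (- b)"] assms(2) by auto
    finally show ?thesis using True by (simp add: F_def)
  next
    case False
    then have "H (point s t) = 0" for t using G(2)[of "point s t"] by (auto simp: H_def)
    with False show ?thesis by (simp add: F_def)
  qed
  have intP: "integrable (lborel \<Otimes>\<^sub>M lborel) (\<lambda>z. H (point (fst z) (snd z)))"
    and LP: "(LINT x|lborel. H x) = (LINT z|(lborel \<Otimes>\<^sub>M lborel). H (point (fst z) (snd z)))"
  proof -
    show "(LINT x|lborel. H x) = (LINT z|(lborel \<Otimes>\<^sub>M lborel). H (point (fst z) (snd z)))"
      unfolding lborel_prod by (subst lborel_eq_distr_point) (simp add: integral_distr)
    show "integrable (lborel \<Otimes>\<^sub>M lborel) (\<lambda>z. H (point (fst z) (snd z)))"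
      using intH unfolding lborel_prod
      by (subst (asm) lborel_eq_distr_point) (simp add: integrable_distr_eq)
  qed
  have intF: "integrable lborel F" and LF: "(LINT x|lborel. H x) = (LINT s|lborel. F s)"
    using lborel_pair.integrable_fst'[OF intP] lborel_pair.integral_fst'[OF intP] LP by (simp_all add: inner)
  have F0: "0 \<le> F s" for s using \<psi>(2) by (simp add: F_def)
  have [measurable]: "F \<in> borel_measurable borel" using intF by auto
  define K where "K = frontier E \<inter> Q"
  have K: "K \<in> sets borel" unfolding K_def using closedQ by (intro borel_closed closed_Int) auto
  have [measurable]: "K \<in> sets (hausdorff_measure 1)" "tang \<in> borel_measurable (hausdorff_measure 1)"
    "\<psi> \<in> borel_measurable (hausdorff_measure 1)" "frontier E \<in> sets (hausdorff_measure 1)"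
    by (rule sets_hausdorff_measureI measurable_hausdorff_measureI K measurable_coords
        borel_closed frontier_closed \<open>\<psi> \<in> borel_measurable borel\<close>)+
  have tang_m: "tang \<in> borel_measurable (density (hausdorff_measure 1) (indicator K))"
    unfolding measurable_density_eq1 by (rule measurable_hausdorff_measureI measurable_coords)+
  define \<rho> where "\<rho> = distr (density (hausdorff_measure 1) (indicator K)) borel tang"
  have \<rho>: "emeasure \<rho> B = hausdorff_outer 1 (K \<inter> tang -` B)" if B: "B \<in> sets borel" for B
  proof -
    have "tang -` B \<in> sets borel" using measurable_sets[OF measurable_coords(1) B] by simp
    then have tB: "tang -` B \<in> sets (hausdorff_measure 1)" by (rule sets_hausdorff_measureI)
    then have KB: "K \<inter> tang -` B \<in> sets (hausdorff_measure 1)"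
      by (rule sets.Int[OF sets_hausdorff_measureI[OF K]])
    have "emeasure \<rho> B = emeasure (density (hausdorff_measure 1) (indicator K)) (tang -` B \<inter> UNIV)"
      unfolding \<rho>_def emeasure_distr[OF tang_m B] space_density space_hausdorff_measure ..
    also have "\<dots> = (\<integral>\<^sup>+x. indicator K x * indicator (tang -` B) x \<partial>hausdorff_measure 1)"
      unfolding Int_UNIV_right 
      by (rule emeasure_density[OF borel_measurable_indicator[OF sets_hausdorff_measureI[OF K]] tB])
    also have "\<dots> = (\<integral>\<^sup>+x. indicator (K \<inter> tang -` B) x \<partial>hausdorff_measure 1)"
      unfolding indicator_inter_arith ..
    also have "\<dots> = hausdorff_outer 1 (K \<inter> tang -` B)"
      using KB by (simp only: nn_integral_indicator emeasure_hausdorff_measure)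
    finally show ?thesis .
  qed
  have le: "density lborel (indicator {- a .. a}) \<le> \<rho>"
  proof (subst le_measure, goal_cases)
    case 2
    show ?case
    proof
      fix B assume "B \<in> sets (density lborel (indicator {- a .. a}))"
      then have [measurable]: "B \<in> sets borel" by simp
      have "emeasure (density lborel (indicator {- a .. a})) B = emeasure lborel ({- a .. a} \<inter> B)"
        by (simp add: emeasure_density indicator_inter_arith[symmetric])
      also have "\<dots> \<le> hausdorff_outer 1 (K \<inter> tang -` B)"
      proof (rule lborel_le_hausdorff_outer_1[of tang])
        show "{- a .. a} \<inter> B \<subseteq> tang ` (K \<inter> tang -` B)"
        proof
          fix s assume s: "s \<in> {- a .. a} \<inter> B"
          then have "\<bar>s\<bar> \<le> a" by auto
          then have "point s (\<gamma> s) \<in> K"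
            using graph(2)[of s "\<gamma> s"] graph(3)[of s] by (auto simp: K_def Q_def)
          then show "s \<in> tang ` (K \<inter> tang -` B)"
            using s by (intro image_eqI[of _ _ "point s (\<gamma> s)"]) auto
        qed
        show "{- a .. a} \<inter> B \<in> sets borel" by measurable
      qed (rule abs_tang_diff_le)
      finally show "emeasure (density lborel (indicator {- a .. a})) B \<le> emeasure \<rho> B"
        by (simp only: \<rho>[OF \<open>B \<in> sets borel\<close>])
    qed
  qed (simp only: \<rho>_def sets_distr sets_density sets_lborel)
  have "ennreal (LINT x:E|lborel. G x) = ennreal (LINT s|lborel. F s)"
    using LF by (simp add: set_lebesgue_integral_def H_def)
  also have "\<dots> = (\<integral>\<^sup>+s. ennreal (F s) \<partial>lborel)"
    using intF F0 by (simp add: nn_integral_eq_integral)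
  also have "\<dots> = (\<integral>\<^sup>+s. indicator {- a .. a} s * ennreal (F s) \<partial>lborel)"
    by (intro nn_integral_cong) (auto simp: F_def indicator_def)
  also have "\<dots> = (\<integral>\<^sup>+s. ennreal (F s) \<partial>density lborel (indicator {- a .. a}))"
    by (rule nn_integral_density[symmetric]) simp_all
  also have "\<dots> \<le> (\<integral>\<^sup>+s. ennreal (F s) \<partial>\<rho>)"
    using le by (intro nn_integral_mono_measure) (simp_all only: \<rho>_def sets_distr sets_density sets_lborel)
  also have "\<dots> = (\<integral>\<^sup>+x. indicator K x * ennreal (F (tang x)) \<partial>hausdorff_measure 1)"
  proof -
    have Fm: "(\<lambda>s. ennreal (F s)) \<in> borel_measurable borel" by simp
    have Ft: "(\<lambda>x. ennreal (F (tang x))) \<in> borel_measurable (hausdorff_measure 1)"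
      using measurable_compose[OF measurable_coords(1) Fm] by (rule measurable_hausdorff_measureI)
    have Fm': "(\<lambda>s. ennreal (F s)) \<in> borel_measurable (distr (density (hausdorff_measure 1) (indicator K)) borel tang)"
      unfolding measurable_distr_eq1 by (rule Fm)
    show ?thesis
      unfolding \<rho>_def nn_integral_distr[OF tang_m Fm']
      by (rule nn_integral_density[OF borel_measurable_indicator[OF sets_hausdorff_measureI[OF K]] Ft])
  qed
  also have "\<dots> \<le> (\<integral>\<^sup>+x\<in>frontier E. ennreal (\<psi> x) \<partial>hausdorff_measure 1)"
  proof (rule nn_integral_mono)
    fix x
    show "indicator K x * ennreal (F (tang x)) \<le> ennreal (\<psi> x) * indicator (frontier E) x"
    proof (cases "x \<in> K")
      case True
      then have "normal x = \<gamma> (tang x)" "\<bar>tang x\<bar> \<le> a"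
        using graph(2)[of "tang x" "normal x"] by (auto simp: K_def Q_def)
      then have "F (tang x) = \<psi> x" by (metis F_def point_coords)
      with True show ?thesis by (simp add: K_def)
    qed simp
  qed
  finally show ?thesis .
qed

end


section \<open>Boundaries of \<open>C\<^sup>1\<close> domains in the plane\<close>

lemma C1_level_function_derivative:
  assumes "C1_level_function U \<phi>" "x \<in> U"
  shows "(\<phi> has_derivative (\<lambda>h. inner h (grad \<phi> x))) (at x)"
  using assms GDERIV_grad[of \<phi> x] by (auto simp: C1_level_function_def gderiv_def)

lemma C1_level_function_continuous_grad:
  assumes "C1_level_function U \<phi>" shows "continuous_on U (grad \<phi>)"
proof -
  have "continuous_on U (\<lambda>x. frechet_derivative \<phi> (at x) b)" if "b \<in> Basis" for b
    using assms that by (auto simp: C1_level_function_def)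
  then show ?thesis unfolding grad_def by (intro continuous_intros) auto
qed

lemma derivative_along_line:
  assumes "(f has_derivative (\<lambda>h. inner h g)) (at (x + t *\<^sub>R w))"
  shows "((\<lambda>t. f (x + t *\<^sub>R w)) has_real_derivative inner w g) (at t)"
proof -
  have "((\<lambda>t. x + t *\<^sub>R w) has_derivative (\<lambda>h. h *\<^sub>R w)) (at t)"
    by (auto intro!: derivative_eq_intros)
  from has_derivative_compose[OF this assms]
  show ?thesis by (simp add: has_field_derivative_def mult_commute_abs)
qed

text \<open>Points with positive \<phi> are exterior by continuity. At a zero the gradient does not
  vanish, so a short step along \<open>- grad \<phi> x\<close> enters \<open>E\<close>; the zero
  adheres to the open set \<open>E\<close> without belonging to it.\<close>

lemma C1_level_frontier_iff:
  assumes "C1_level_function U \<phi>" "E \<inter> U = {x\<in>U. \<phi> x < 0}" "open E" "x \<in> U"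
  shows "x \<in> frontier E \<longleftrightarrow> \<phi> x = 0"
proof -
  have "open U" "grad \<phi> x \<noteq> 0" using assms by (auto simp: C1_level_function_def)
  have deriv: "(\<phi> has_derivative (\<lambda>h. inner h (grad \<phi> x))) (at x)"
    using C1_level_function_derivative assms by blast
  have mem: "y \<in> E \<longleftrightarrow> \<phi> y < 0" if "y \<in> U" for y using assms(2) that by blast
  show ?thesis
  proof
    assume "x \<in> frontier E"
    then have x: "x \<notin> E" "x \<in> closure E" using \<open>open E\<close> by (auto simp: frontier_def interior_open)
    then have "\<not> \<phi> x < 0" using assms(2,4) by blast
    moreover have "\<not> 0 < \<phi> x"
    proof
      assume "0 < \<phi> x"
      have "isCont \<phi> x" using deriv by (rule has_derivative_continuous)
      then have "\<forall>\<^sub>F y in at x. 0 < \<phi> y"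
        using \<open>0 < \<phi> x\<close> by (auto simp: isCont_def intro: order_tendstoD)
      then have "\<forall>\<^sub>F y in nhds x. 0 < \<phi> y"
        using \<open>0 < \<phi> x\<close> by (auto simp: eventually_at_filter elim: eventually_mono)
      moreover have "\<forall>\<^sub>F y in nhds x. y \<in> U" using \<open>open U\<close> assms(4) by (rule eventually_nhds_in_open)
      ultimately have "\<forall>\<^sub>F y in nhds x. y \<notin> E"
        by eventually_elim (simp add: mem)
      then obtain S where "open S" "x \<in> S" "\<forall>y\<in>S. y \<notin> E" unfolding eventually_nhds by blast
      then show False using x(2) by (auto simp: closure_iff_nhds_not_empty)
    qed
    ultimately show "\<phi> x = 0" by simp
  next
    assume 0: "\<phi> x = 0"
    then have "x \<notin> E" using mem assms(4) by simp
    obtain e where e: "e > 0" "ball x e \<subseteq> U" using \<open>open U\<close> assms(4) open_contains_ball by blast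
    let ?g = "grad \<phi> x"
    have "((\<lambda>t. \<phi> (x + t *\<^sub>R (- ?g))) has_real_derivative inner (- ?g) ?g) (at 0)"
      using deriv by (intro derivative_along_line) simp
    moreover have "inner (- ?g) ?g < 0" using \<open>?g \<noteq> 0\<close> by simp
    ultimately obtain d where d: "d > 0" "\<And>h. 0 < h \<Longrightarrow> h < d \<Longrightarrow> \<phi> (x + h *\<^sub>R (- ?g)) < 0"
      using 0 by (auto dest!: DERIV_neg_dec_right)
    have "x \<in> closure E"
      unfolding closure_approachable
    proof (intro allI impI)
      fix \<epsilon> :: real assume "\<epsilon> > 0"
      \<comment> \<open>Small enough for the sign of \<phi> along the ray, for staying in
        \<open>U\<close> and for the prescribed \<epsilon>; the divisor 2 makes the last two
        strict.\<close>
      define h where "h = min (d / 2) (min e \<epsilon> / (2 * norm ?g))"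
      have h: "0 < h" "h < d" "h \<le> min e \<epsilon> / (2 * norm ?g)"
        using d(1) e(1) \<open>\<epsilon> > 0\<close> \<open>?g \<noteq> 0\<close> by (auto simp: h_def)
      let ?y = "x + h *\<^sub>R (- ?g)"
      have "dist ?y x = h * norm ?g" using h by (simp add: dist_norm)
      also have "\<dots> \<le> min e \<epsilon> / (2 * norm ?g) * norm ?g" using h by (intro mult_right_mono) auto
      also have "\<dots> = min e \<epsilon> / 2" using \<open>?g \<noteq> 0\<close> by simp
      finally have *: "dist ?y x < e" "dist ?y x < \<epsilon>" using e(1) \<open>\<epsilon> > 0\<close> by linarith+
      then have "?y \<in> U" using e(2) by (auto simp: dist_commute)
      then have "?y \<in> E" using d(2)[OF h(1,2)] assms(2) by blast
      with * show "\<exists>y\<in>E. dist y x < \<epsilon>" by blast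
    qed
    with \<open>x \<notin> E\<close> show "x \<in> frontier E" using \<open>open E\<close> by (simp add: frontier_def interior_open)
  qed
qed

lemma exists_orthogonal_unit:
  fixes \<nu> :: "real ^ 2"
  assumes "norm \<nu> = 1" shows "\<exists>v. norm v = 1 \<and> inner v \<nu> = 0"
proof (intro exI conjI)
  let ?v = "vector [- (\<nu> $ 2), \<nu> $ 1] :: real ^ 2"
  have "inner ?v ?v = inner \<nu> \<nu>" by (simp add: inner_vec_def sum_2)
  then show "norm ?v = 1" using assms by (simp add: norm_eq_sqrt_inner)
  show "inner ?v \<nu> = 0" by (simp add: inner_vec_def sum_2)
qed

context orthonormal_frame
begin

lemma coords_le_dist: "\<bar>tang x\<bar> \<le> dist p x" "\<bar>normal x\<bar> \<le> dist p x"
  using Cauchy_Schwarz_ineq2[of "x - p" v] Cauchy_Schwarz_ineq2[of "x - p" \<nu>] frame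
  by (simp_all add: tang_def normal_def dist_norm norm_minus_commute)

text \<open>Continuity keeps the gradient near \<open>p\<close> in a narrow cone around \<nu>. The
  fraction 1/4 serves two purposes: \<phi> increases along normals, and chords of the boundary are
  nearly tangential.\<close>

lemma C1_level_grad_near:
  assumes "C1_level_function U \<phi>" "p \<in> U" "\<nu> = sgn (grad \<phi> p)"
  obtains m \<rho> where "m > 0" "grad \<phi> p = m *\<^sub>R \<nu>" "\<rho> > 0" "ball p \<rho> \<subseteq> U"
    "\<And>x. x \<in> ball p \<rho> \<Longrightarrow> norm (grad \<phi> x - m *\<^sub>R \<nu>) < m / 4"
proof -
  define m where "m = norm (grad \<phi> p)"
  have m: "m > 0" "grad \<phi> p = m *\<^sub>R \<nu>"
    using assms by (auto simp: m_def C1_level_function_def sgn_div_norm)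
  have "open U" using assms by (simp add: C1_level_function_def)
  then obtain e where e: "e > 0" "ball p e \<subseteq> U" using assms(2) open_contains_ball by blast
  obtain d where d: "d > 0" "\<And>x. x \<in> U \<Longrightarrow> dist x p < d \<Longrightarrow> dist (grad \<phi> x) (grad \<phi> p) < m / 4"
    using C1_level_function_continuous_grad[OF assms(1), unfolded continuous_on_iff, rule_format, OF assms(2), of "m / 4"] m(1)
    by auto
  show thesis
  proof (rule that[of m "min e d"])
    show "norm (grad \<phi> x - m *\<^sub>R \<nu>) < m / 4" if "x \<in> ball p (min e d)" for x
      using that e(2) d(2)[of x] m(2) by (auto simp: dist_norm norm_minus_commute subset_iff)
  qed (use m e d in auto)
qed

text \<open>By the mean value theorem some gradient on the chord between two boundary points is
  orthogonal to the chord. That gradient is nearly parallel to \<nu>, so the normal component of the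
  chord is at most a quarter of its length, and \<open>tang\<close> has a 2-Lipschitz inverse on the
  boundary near \<open>p\<close>.\<close>

lemma C1_boundary_locally_finite:
  assumes "C1_level_function U \<phi>" "p \<in> U" "\<nu> = sgn (grad \<phi> p)" "E \<inter> U = {x\<in>U. \<phi> x < 0}" "open E"
  shows "\<exists>\<rho>>0. hausdorff_outer 1 (frontier E \<inter> ball p \<rho>) < \<infinity>"
proof -
  obtain m \<rho> where m: "m > 0" "grad \<phi> p = m *\<^sub>R \<nu>" and \<rho>: "\<rho> > 0" "ball p \<rho> \<subseteq> U"
    and near: "\<And>x. x \<in> ball p \<rho> \<Longrightarrow> norm (grad \<phi> x - m *\<^sub>R \<nu>) < m / 4"
    using C1_level_grad_near[OF assms(1-3)] by blast
  have "hausdorff_outer 1 (frontier E \<inter> ball p \<rho>) < \<infinity>"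
  proof (rule hausdorff_outer_1_graph_finite[of _ 2 tang \<rho>])
    fix x y assume x: "x \<in> frontier E \<inter> ball p \<rho>" and y: "y \<in> frontier E \<inter> ball p \<rho>"
    let ?w = "x - y"
    have seg: "y + t *\<^sub>R ?w \<in> ball p \<rho>" if "0 \<le> t" "t \<le> 1" for t
    proof -
      have "(1 - t) *\<^sub>R y + t *\<^sub>R x \<in> ball p \<rho>"
        using x y that convex_ball[of p \<rho>] by (intro convexD) auto
      then show ?thesis by (simp add: algebra_simps)
    qed
    have "((\<lambda>t. \<phi> (y + t *\<^sub>R ?w)) has_real_derivative inner ?w (grad \<phi> (y + t *\<^sub>R ?w))) (at t)"
      if "0 \<le> t" "t \<le> 1" for t
      using seg[OF that] \<rho>(2) by (intro derivative_along_line C1_level_function_derivative[OF assms(1)]) auto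
    then obtain t where t: "0 < t" "t < 1"
      "\<phi> (y + 1 *\<^sub>R ?w) - \<phi> (y + 0 *\<^sub>R ?w) = (1 - 0) * inner ?w (grad \<phi> (y + t *\<^sub>R ?w))"
      using MVT2[of 0 1 "\<lambda>t. \<phi> (y + t *\<^sub>R ?w)" "\<lambda>t. inner ?w (grad \<phi> (y + t *\<^sub>R ?w))"] by auto
    let ?g = "grad \<phi> (y + t *\<^sub>R ?w)"
    have "\<phi> x = 0" "\<phi> y = 0"
      using C1_level_frontier_iff[OF assms(1,4,5)] x y \<rho>(2) by auto
    with t have "inner ?w ?g = 0" by simp
    then have "m * inner ?w \<nu> = inner ?w (m *\<^sub>R \<nu> - ?g)" by (simp add: inner_diff_right)
    also have "\<bar>\<dots>\<bar> \<le> norm ?w * norm (m *\<^sub>R \<nu> - ?g)" by (rule Cauchy_Schwarz_ineq2)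
    also have "\<dots> \<le> norm ?w * (m / 4)"
      using near[OF seg[of t]] t by (intro mult_left_mono) (auto simp: norm_minus_commute)
    finally have "m * \<bar>inner ?w \<nu>\<bar> \<le> m * (norm ?w / 4)" using m by (simp add: abs_mult mult.commute)
    then have "\<bar>inner ?w \<nu>\<bar> \<le> norm ?w / 4" using m by simp
    then have "(inner ?w \<nu>)\<^sup>2 \<le> (norm ?w / 4)\<^sup>2" by (simp add: abs_le_square_iff[symmetric])
    then have "(norm ?w)\<^sup>2 \<le> (inner ?w v)\<^sup>2 + (norm ?w)\<^sup>2 / 16"
      using norm_frame[of ?w] by (simp add: power_divide)
    then have "(norm ?w)\<^sup>2 \<le> 4 * (inner ?w v)\<^sup>2"
      using zero_le_power2[of "inner ?w v"] by linarith
    then have "(norm ?w)\<^sup>2 \<le> (2 * inner ?w v)\<^sup>2" by simp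
    then have "norm ?w \<le> \<bar>2 * inner ?w v\<bar>" unfolding abs_le_square_iff[symmetric] abs_norm_cancel .
    also have "\<dots> = 2 * \<bar>tang x - tang y\<bar>" by (simp add: abs_mult tang_def flip: inner_diff_left)
    finally show "dist x y \<le> 2 * \<bar>tang x - tang y\<bar>" by (simp add: dist_norm)
  next
    fix x assume "x \<in> frontier E \<inter> ball p \<rho>"
    then show "\<bar>tang x\<bar> \<le> \<rho>" using coords_le_dist(1)[of x] by simp
  qed (use \<rho> in auto)
  with \<rho>(1) show ?thesis by blast
qed

text \<open>An implicit function theorem at every small scale: \<phi> increases strictly along
  normals, and its linear part at \<open>p\<close> has no tangential term, so the zero on each
  normal line stays close to the tangent. The width \<open>K\<close> and the flatness \<delta> are
  separate parameters, since the flux estimate needs a wide window and the comparison with the half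
  ball a thin graph.\<close>

lemma C1_boundary_graph:
  assumes "C1_level_function U \<phi>" "p \<in> U" "\<nu> = sgn (grad \<phi> p)" "E \<inter> U = {x\<in>U. \<phi> x < 0}" "open E"
    and "p \<in> frontier E" "0 < \<delta>" "\<delta> \<le> K"
  shows "\<exists>r0>0. \<forall>r. 0 < r \<longrightarrow> r < r0 \<longrightarrow>
    (\<exists>\<gamma>. \<forall>s. \<bar>s\<bar> \<le> K * r \<longrightarrow> \<bar>\<gamma> s\<bar> \<le> \<delta> * r \<and>
      (\<forall>t. \<bar>t\<bar> \<le> K * r \<longrightarrow> (point s t \<in> E \<longleftrightarrow> t < \<gamma> s) \<and> (point s t \<in> frontier E \<longleftrightarrow> t = \<gamma> s)))"
proof -
  obtain m \<rho> where m: "m > 0" "grad \<phi> p = m *\<^sub>R \<nu>" and \<rho>: "\<rho> > 0" "ball p \<rho> \<subseteq> U"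
    and near: "\<And>x. x \<in> ball p \<rho> \<Longrightarrow> norm (grad \<phi> x - m *\<^sub>R \<nu>) < m / 4"
    using C1_level_grad_near[OF assms(1-3)] by blast
  have K: "0 < K" using assms by simp
  have \<phi>p: "\<phi> p = 0" using C1_level_frontier_iff[OF assms(1,4,5,2)] assms(6) by simp
  have pos: "0 < inner \<nu> (grad \<phi> x)" if "x \<in> ball p \<rho>" for x
  proof -
    have "\<bar>inner \<nu> (grad \<phi> x - m *\<^sub>R \<nu>)\<bar> \<le> norm \<nu> * norm (grad \<phi> x - m *\<^sub>R \<nu>)" by (rule Cauchy_Schwarz_ineq2)
    then have "\<bar>inner \<nu> (grad \<phi> x) - m\<bar> < m / 4" using near[OF that] frame by (simp add: inner_diff_right)
    then show ?thesis using m(1) by linarith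
  qed
  \<comment> \<open>Points of the window are within \<open>2 * K * r\<close> of \<open>p\<close>, so
    the linear approximation errs by at most \<open>m * \<delta> * r / 2\<close>, half its value at
    height \<open>\<delta> * r\<close>. This yields the sign change between
    \<open>- (\<delta> * r)\<close> and \<open>\<delta> * r\<close>.\<close>
  define e where "e = m * \<delta> / (4 * K)"
  have "e > 0" using m K assms by (simp add: e_def)
  have "(\<phi> has_derivative (\<lambda>h. inner h (grad \<phi> p))) (at p)"
    using C1_level_function_derivative assms(1,2) by blast
  then obtain d where d: "d > 0"
    "\<And>x. norm (x - p) < d \<Longrightarrow> norm (\<phi> x - \<phi> p - inner (x - p) (grad \<phi> p)) \<le> e * norm (x - p)"
    unfolding has_derivative_at_alt using \<open>e > 0\<close> by blast
  define r0 where "r0 = min \<rho> d / (2 * K)"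
  have "r0 > 0" using \<rho> d K by (simp add: r0_def)
  moreover have "\<exists>\<gamma>. \<forall>s. \<bar>s\<bar> \<le> K * r \<longrightarrow> \<bar>\<gamma> s\<bar> \<le> \<delta> * r \<and>
      (\<forall>t. \<bar>t\<bar> \<le> K * r \<longrightarrow> (point s t \<in> E \<longleftrightarrow> t < \<gamma> s) \<and> (point s t \<in> frontier E \<longleftrightarrow> t = \<gamma> s))"
    if r: "0 < r" "r < r0" for r
  proof -
    have "2 * K * r < min \<rho> d" using r K by (simp add: r0_def field_simps)
    then have in_ball: "dist p (point s t) < min \<rho> d" "dist p (point s t) \<le> 2 * K * r"
      if "\<bar>s\<bar> \<le> K * r" "\<bar>t\<bar> \<le> K * r" for s t
      using norm_le_coords[of "point s t"] that by (auto simp: min_def split: if_splits)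
    have ex: "\<exists>c. \<bar>c\<bar> \<le> \<delta> * r \<and>
      (\<forall>t. \<bar>t\<bar> \<le> K * r \<longrightarrow> (point s t \<in> E \<longleftrightarrow> t < c) \<and> (point s t \<in> frontier E \<longleftrightarrow> t = c))"
      if s: "\<bar>s\<bar> \<le> K * r" for s
    proof -
      define g where "g t = \<phi> (point s t)" for t
      have gd: "(g has_real_derivative inner \<nu> (grad \<phi> (point s t))) (at t)" if "\<bar>t\<bar> \<le> K * r" for t
      proof -
        have "point s t \<in> U" using in_ball[OF s that] \<rho>(2) by auto
        then show ?thesis unfolding g_def point_def
          by (intro derivative_along_line C1_level_function_derivative[OF assms(1)]) (simp add: point_def)
      qed
      have incr: "g t < g t'" if "t < t'" "\<bar>t\<bar> \<le> K * r" "\<bar>t'\<bar> \<le> K * r" for t t'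
      proof (rule DERIV_pos_imp_increasing[OF that(1)])
        fix x assume "t \<le> x" "x \<le> t'"
        then have "\<bar>x\<bar> \<le> K * r" using that by linarith
        then show "\<exists>y. (g has_real_derivative y) (at x) \<and> 0 < y"
          using gd[of x] pos[of "point s x"] in_ball[OF s, of x] by auto
      qed
      have \<delta>r: "0 < \<delta> * r" "\<delta> * r \<le> K * r" using r assms(7,8) by auto
      have approx: "\<bar>g t - m * t\<bar> \<le> m * (\<delta> * r) / 2" if "\<bar>t\<bar> \<le> K * r" for t
      proof -
        have "norm (\<phi> (point s t) - \<phi> p - inner (point s t - p) (grad \<phi> p)) \<le> e * norm (point s t - p)"
          using in_ball[OF s that] by (intro d(2)) (simp add: dist_norm norm_minus_commute)
        moreover have "inner (point s t - p) (grad \<phi> p) = m * t"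
          using m(2) by (simp add: point_def inner_add_left)
        ultimately have "\<bar>g t - m * t\<bar> \<le> e * norm (point s t - p)" using \<phi>p by (simp add: g_def)
        also have "\<dots> \<le> e * (2 * K * r)"
          using in_ball[OF s that] \<open>e > 0\<close> by (intro mult_left_mono) (auto simp: dist_norm norm_minus_commute)
        also have "\<dots> = m * (\<delta> * r) / 2" using K by (simp add: e_def)
        finally show ?thesis .
      qed
      have m\<delta>: "0 < m * (\<delta> * r)" using m \<delta>r by simp
      have sgn: "g (- (\<delta> * r)) \<le> 0" "0 \<le> g (\<delta> * r)"
        using approx[of "\<delta> * r"] approx[of "- (\<delta> * r)"] \<delta>r m\<delta>
        unfolding abs_le_iff mult_minus_right by linarith+
      have "continuous_on {- (\<delta> * r) .. \<delta> * r} g"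
      proof (rule continuous_at_imp_continuous_on, rule ballI)
        fix x assume "x \<in> {- (\<delta> * r) .. \<delta> * r}"
        then have "\<bar>x\<bar> \<le> K * r" using \<delta>r by auto
        then show "isCont g x" using gd DERIV_isCont by blast
      qed
      then obtain c where c: "- (\<delta> * r) \<le> c" "c \<le> \<delta> * r" "g c = 0"
        using IVT'[of g "- (\<delta> * r)" 0 "\<delta> * r"] sgn \<delta>r by auto
      then have cK: "\<bar>c\<bar> \<le> K * r" using \<delta>r by auto
      have "(point s t \<in> E \<longleftrightarrow> t < c) \<and> (point s t \<in> frontier E \<longleftrightarrow> t = c)" if t: "\<bar>t\<bar> \<le> K * r" for t
      proof -
        have U: "point s t \<in> U" using in_ball[OF s t] \<rho>(2) by auto
        then have "point s t \<in> E \<longleftrightarrow> g t < 0" using assms(4) by (auto simp: g_def)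
        moreover have "point s t \<in> frontier E \<longleftrightarrow> g t = 0"
          using C1_level_frontier_iff[OF assms(1,4,5) U] by (simp add: g_def)
        moreover have "t < c \<Longrightarrow> g t < 0" "c < t \<Longrightarrow> 0 < g t"
          using incr[of t c] incr[of c t] t cK c(3) by auto
        ultimately show ?thesis using c(3) by (cases t c rule: linorder_cases) auto
      qed
      moreover have "\<bar>c\<bar> \<le> \<delta> * r" using c by auto
      ultimately show ?thesis by blast
    qed
    then show ?thesis by metis
  qed
  ultimately show ?thesis by blast
qed

end

section \<open>Finite length of the whole boundary\<close>

lemma outer_normal_norm:
  assumes "outer_normal E p \<nu>" shows "norm \<nu> = 1"
  using assms by (auto simp: outer_normal_def C1_level_function_def norm_sgn)

text \<open>The boundary is compact, so finitely many of the local bounds add up. Bounded measurable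
  functions on the boundary become integrable through this.\<close>

lemma hausdorff_frontier_finite:
  fixes E :: "(real ^ 2) set"
  assumes "C1_domain E" "bounded E"
  shows "emeasure (hausdorff_measure 1) (frontier E) < \<infinity>"
proof -
  have sets: "frontier E \<inter> ball q e \<in> sets (hausdorff_measure 1)" for q e
    by (intro sets_hausdorff_measureI) simp
  have "\<exists>\<rho>>0. emeasure (hausdorff_measure 1) (frontier E \<inter> ball q \<rho>) < \<infinity>" if "q \<in> frontier E" for q
  proof -
    obtain U \<phi> where U: "q \<in> U" "C1_level_function U \<phi>" "E \<inter> U = {x\<in>U. \<phi> x < 0}"
      using assms(1) \<open>q \<in> frontier E\<close> unfolding C1_domain_def by blast
    then have "norm (sgn (grad \<phi> q)) = 1" by (auto simp: C1_level_function_def norm_sgn)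
    moreover from exists_orthogonal_unit[OF this] obtain w where "norm w = 1" "inner w (sgn (grad \<phi> q)) = 0"
      by blast
    ultimately interpret orthonormal_frame q w "sgn (grad \<phi> q)" by unfold_locales auto
    show ?thesis
      using C1_boundary_locally_finite[OF U(2,1) refl U(3)] assms(1) emeasure_hausdorff_measure[OF sets]
      by (auto simp: C1_domain_def)
  qed
  then obtain \<rho> where \<rho>: "\<And>q. q \<in> frontier E \<Longrightarrow> \<rho> q > 0"
    "\<And>q. q \<in> frontier E \<Longrightarrow> emeasure (hausdorff_measure 1) (frontier E \<inter> ball q (\<rho> q)) < \<infinity>"
    by metis
  have "compact (frontier E)" using assms(2) by (rule compact_frontier_bounded)
  then obtain T where T: "T \<subseteq> frontier E" "finite T" "frontier E \<subseteq> (\<Union>q\<in>T. ball q (\<rho> q))"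
  proof (rule compactE_image[of "frontier E" "frontier E" "\<lambda>q. ball q (\<rho> q)"])
    show "frontier E \<subseteq> (\<Union>q\<in>frontier E. ball q (\<rho> q))" using \<rho>(1) by (meson UN_I centre_in_ball subsetI)
  qed auto
  have "emeasure (hausdorff_measure 1) (frontier E) \<le> emeasure (hausdorff_measure 1) (\<Union>q\<in>T. frontier E \<inter> ball q (\<rho> q))"
    using T sets by (intro emeasure_mono sets.finite_UN) auto
  also have "\<dots> \<le> (\<Sum>q\<in>T. emeasure (hausdorff_measure 1) (frontier E \<inter> ball q (\<rho> q)))"
    using T sets by (intro emeasure_subadditive_finite) auto
  also have "\<dots> < \<infinity>" using T \<rho>(2) by (auto simp: less_top[symmetric])
  finally show ?thesis .
qed


section \<open>The test functions\<close>

lemma grad_eq: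
  assumes "(f has_derivative (\<lambda>h. inner h w)) (at x)" shows "grad f x = w"
proof -
  have "frechet_derivative f (at x) = (\<lambda>h. inner h w)"
    using frechet_derivative_at[OF assms] by simp
  then have "grad f x = (\<Sum>b\<in>Basis. inner w b *\<^sub>R b)" by (simp add: grad_def inner_commute)
  then show ?thesis by (simp add: euclidean_representation)
qed

context orthonormal_frame
begin

text \<open>The prefactor \<open>r\<close> bounds the gradient independently of \<open>r\<close>:
  the main terms are then comparable to the area \<open>r\<^sup>2\<close>, and the sup norm
  \<open>r\<close> turns an error mass of \<open>o(r)\<close> into
  \<open>o(r\<^sup>2)\<close>.\<close>

definition tent :: "real \<Rightarrow> real \<Rightarrow> real ^ 2 \<Rightarrow> real" where
  "tent L r x = r * (bump (tang x / (L * r)) * ramp (normal x / r))"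

definition tent_grad :: "real \<Rightarrow> real \<Rightarrow> real ^ 2 \<Rightarrow> real ^ 2" where
  "tent_grad L r x = (bump' (tang x / (L * r)) * ramp (normal x / r) / L) *\<^sub>R v +
     (bump (tang x / (L * r)) * ramp' (normal x / r)) *\<^sub>R \<nu>"

context
  fixes L r :: real
  assumes L: "L > 0" and r: "r > 0"
begin

lemma tent_has_derivative: "(tent L r has_derivative (\<lambda>h. inner h (tent_grad L r x))) (at x)"
proof -
  have nz: "L \<noteq> 0" "r \<noteq> 0" using L r by auto
  have "((\<lambda>x. tang x / (L * r)) has_derivative (\<lambda>h. inner h v / (L * r))) (at x)"
    "((\<lambda>x. normal x / r) has_derivative (\<lambda>h. inner h \<nu> / r)) (at x)"
    unfolding tang_def normal_def by (auto intro!: derivative_eq_intros simp: inner_diff_left nz)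
  note has_derivative_compose[OF this(1) bump_derivative[unfolded has_field_derivative_def]]
    has_derivative_compose[OF this(2) ramp_derivative[unfolded has_field_derivative_def]]
  from has_derivative_mult_right[OF has_derivative_mult[OF this], of r]
  have "(tent L r has_derivative (\<lambda>h. r * (bump (tang x / (L * r)) * (ramp' (normal x / r) * (inner h \<nu> / r)) +
      bump' (tang x / (L * r)) * (inner h v / (L * r)) * ramp (normal x / r)))) (at x)"
    by (simp only: tent_def[abs_def])
  moreover have "r * (bump (tang x / (L * r)) * (ramp' (normal x / r) * (inner h \<nu> / r)) +
      bump' (tang x / (L * r)) * (inner h v / (L * r)) * ramp (normal x / r)) = inner h (tent_grad L r x)" for h
    using nz by (simp add: tent_grad_def inner_add_right distrib_left)
  ultimately show ?thesis by simp
qed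

lemma grad_tent: "grad (tent L r) x = tent_grad L r x"
  using tent_has_derivative by (rule grad_eq)

lemma tent_bounds: "0 \<le> tent L r x" "tent L r x \<le> r"
proof -
  let ?a = "bump (tang x / (L * r))" and ?b = "ramp (normal x / r)"
  have "0 \<le> ?a * ?b" by (intro mult_nonneg_nonneg bump_bounds ramp_bounds)
  moreover have "?a * ?b \<le> 1 * 1" by (intro mult_mono bump_bounds ramp_bounds) simp
  ultimately show "0 \<le> tent L r x" "tent L r x \<le> r"
    using r mult_left_mono[of "?a * ?b" 1 r] by (auto simp: tent_def)
qed

lemma tent_zero:
  assumes "2 * L * r \<le> \<bar>tang x\<bar> \<or> normal x \<le> - 3 * r \<or> 7 * r \<le> normal x"
  shows "tent L r x = 0" "tent_grad L r x = 0"
proof -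
  from assms have *: "2 \<le> \<bar>tang x / (L * r)\<bar> \<or> (normal x / r \<le> - 3 \<or> 7 \<le> normal x / r)"
    using L r by (auto simp: field_simps abs_mult)
  then show "tent L r x = 0"
    using bump_eq_0(1) ramp_eq_0(1) by (auto simp: tent_def)
  from * have "bump (tang x / (L * r)) = 0 \<and> bump' (tang x / (L * r)) = 0 \<or>
      ramp (normal x / r) = 0 \<and> ramp' (normal x / r) = 0"
    using bump_eq_0 ramp_eq_0 by metis
  then show "tent_grad L r x = 0" by (auto simp: tent_grad_def)
qed

lemma tent_supp:
  assumes "tent L r x \<noteq> 0 \<or> tent_grad L r x \<noteq> 0"
  shows "\<bar>tang x\<bar> < 2 * L * r" "\<bar>normal x\<bar> < 7 * r"
proof -
  have "\<not> (2 * L * r \<le> \<bar>tang x\<bar> \<or> normal x \<le> - 3 * r \<or> 7 * r \<le> normal x)"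
    using tent_zero[of x] assms by blast
  then show "\<bar>tang x\<bar> < 2 * L * r" "\<bar>normal x\<bar> < 7 * r" using r by auto
qed

lemma continuous_tent: "continuous_on UNIV (tent L r)"
  by (intro continuous_at_imp_continuous_on ballI has_derivative_continuous[OF tent_has_derivative])

lemma continuous_tent_grad: "continuous_on UNIV (tent_grad L r)"
proof -
  have f: "continuous_on UNIV (flat_exp n)" for n
    by (intro continuous_at_imp_continuous_on ballI DERIV_isCont[OF flat_exp_has_derivative])
  have 1: "continuous_on UNIV bump"
    by (intro continuous_at_imp_continuous_on ballI DERIV_isCont[OF bump_derivative])
  have 2: "continuous_on UNIV ramp"
    by (intro continuous_at_imp_continuous_on ballI DERIV_isCont[OF ramp_derivative])
  have 3: "continuous_on UNIV bump'" "continuous_on UNIV ramp'"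
    unfolding bump'_def ramp'_def
    by (intro continuous_intros continuous_on_compose2[OF f]; simp)+
  have t: "continuous_on UNIV (\<lambda>x. tang x / (L * r))"
    using L r by (intro continuous_intros) auto
  have n: "continuous_on UNIV (\<lambda>x. normal x / r)"
    using r by (intro continuous_intros) auto
  have comp: "continuous_on UNIV (\<lambda>x. f (g x))"
    if "continuous_on UNIV f" "continuous_on UNIV g" for f :: "real \<Rightarrow> real" and g :: "real ^ 2 \<Rightarrow> real"
    using that by (rule continuous_on_compose2) simp
  show ?thesis
    unfolding tent_grad_def using L
    by (intro continuous_intros comp[OF 1 t] comp[OF 2 n] comp[OF 3(1) t] comp[OF 3(2) n]) auto
qed

lemma test_function_tent: "test_function (tent L r)"
  unfolding test_function_def
proof (intro conjI allI flat_exp_algebra_Ck_on)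
  have t: "flat_exp_algebra (\<lambda>x. flat_exp 0 (c + k * tang x))" for c k
  proof -
    have "c + k * tang x = (c - k * inner p v) + inner x (k *\<^sub>R v)" for x
      by (simp add: tang_def algebra_simps)
    then show ?thesis by (simp only: flat_exp_algebra.flat)
  qed
  have n: "flat_exp_algebra (\<lambda>x. flat_exp 0 (c + k * normal x))" for c k
  proof -
    have "c + k * normal x = (c - k * inner p \<nu>) + inner x (k *\<^sub>R \<nu>)" for x
      by (simp add: normal_def algebra_simps)
    then show ?thesis by (simp only: flat_exp_algebra.flat)
  qed
  \<comment> \<open>Squares are spelled out as products to match the generators of
    \<open>flat_exp_algebra\<close> literally.\<close>
  have "tent L r = (\<lambda>x. r * (((flat_exp 0 (2 + (- (1 / (L * r))) * tang x) * flat_exp 0 (2 + (1 / (L * r)) * tang x)) *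
      (flat_exp 0 (2 + (- (1 / (L * r))) * tang x) * flat_exp 0 (2 + (1 / (L * r)) * tang x))) *
      (flat_exp 0 (3 + (1 / r) * normal x) * flat_exp 0 (7 + (- (1 / r)) * normal x))))"
    by (simp add: fun_eq_iff tent_def bump_def ramp_def power2_eq_square)
  then show "flat_exp_algebra (tent L r)"
    by (simp only:) (intro t n flat_exp_algebra.mult flat_exp_algebra.const)
  have "closure {x. tent L r x \<noteq> 0} \<subseteq> {x. \<bar>tang x\<bar> \<le> 2 * L * r \<and> \<bar>normal x\<bar> \<le> 7 * r}"
    using compact_imp_closed[OF compact_strip] tent_supp by (intro closure_minimal) (auto intro: less_imp_le)
  from bounded_subset[OF compact_imp_bounded[OF compact_strip] this]
  show "compact (closure {x. tent L r x \<noteq> 0})" by (simp add: compact_eq_bounded_closed)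
qed

text \<open>The constant 16 comes from \<open>bump'_sq_le\<close> and 5 / 144 from
  \<open>ramp'_ge\<close>, whose range is the reason for \<open>normal x \<le> r\<close>. The vector
  \<open>w\<close> stands for the value of \<xi> at \<open>x\<close>.\<close>

lemma tent_pointwise:
  assumes "normal x \<le> r" "0 \<le> M" "norm w \<le> M"
  shows "(M - inner w \<nu>) * inner \<nu> (tent_grad L r x) / 2 - 16 * M / (5 / 144 * L\<^sup>2)
     \<le> M * inner \<nu> (tent_grad L r x) - inner w (tent_grad L r x)"
    and "0 \<le> inner \<nu> (tent_grad L r x)"
proof -
  let ?k = "5 / 144 :: real"
  define a where "a = bump (tang x / (L * r))"
  define a' where "a' = bump' (tang x / (L * r))"
  define b where "b = ramp (normal x / r)"
  define b' where "b' = ramp' (normal x / r)"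
  have a: "0 \<le> a" "a'\<^sup>2 \<le> 16 * a" using bump_bounds bump'_sq_le by (auto simp: a_def a'_def)
  have b: "0 \<le> b" "b \<le> 1" "?k * b \<le> b'"
    using ramp_bounds ramp'_ge[of "normal x / r"] assms r by (auto simp: b_def b'_def)
  \<comment> \<open>Since \<open>b \<le> 1\<close>, the linear bound \<open>?k * b \<le> b'\<close>
    implies the quadratic one that \<open>X\<^sup>2\<close> calls for.\<close>
  have b': "0 \<le> b'" "?k * b\<^sup>2 \<le> b'"
    using b mult_left_mono[of b 1 b] by (auto simp: power2_eq_square intro: order_trans)
  have tg: "tent_grad L r x = (a' * b / L) *\<^sub>R v + (a * b') *\<^sub>R \<nu>"
    by (simp add: tent_grad_def a_def a'_def b_def b'_def)
  have G: "inner \<nu> (tent_grad L r x) = a * b'" by (simp add: tg inner_add_right)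
  show "0 \<le> inner \<nu> (tent_grad L r x)" using a b' by (simp add: G)
  define q where "q = M - inner w \<nu>"
  have "inner w \<nu> \<le> norm w * norm \<nu>" by (rule norm_cauchy_schwarz)
  then have q: "0 \<le> q" using assms frame by (simp add: q_def)
  have "(inner w v)\<^sup>2 \<le> 2 * M * q"
  proof -
    have "(inner w v)\<^sup>2 + (inner w \<nu>)\<^sup>2 \<le> M\<^sup>2"
      using norm_frame[of w] assms by (metis norm_ge_zero power_mono)
    moreover have "(inner w \<nu>)\<^sup>2 = M\<^sup>2 - 2 * M * q + q\<^sup>2" by (simp add: q_def power2_eq_square algebra_simps)
    ultimately show ?thesis using zero_le_power2[of q] by linarith
  qed
  define Y where "Y = q * (a * b')"
  define D where "D = 16 * M / (?k * L\<^sup>2)"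
  define X where "X = inner w v * (a' * b / L)"
  have YD: "0 \<le> Y" "0 \<le> D" using q a b' assms L by (auto simp: Y_def D_def)
  have "X\<^sup>2 = (inner w v)\<^sup>2 * (a'\<^sup>2 * b\<^sup>2) / L\<^sup>2" by (simp add: X_def power_mult_distrib power_divide)
  also have "\<dots> \<le> (2 * M * q) * ((16 * a) * (b' / ?k)) / L\<^sup>2"
    using \<open>(inner w v)\<^sup>2 \<le> 2 * M * q\<close> a b b' assms q
    by (intro divide_right_mono mult_mono) auto
  also have "\<dots> = 2 * Y * D" using L by (simp add: Y_def D_def field_simps)
  also have "\<dots> \<le> (Y / 2 + D)\<^sup>2"
  proof -
    \<comment> \<open>\<open>(Y / 2 + D)\<^sup>2\<close> exceeds \<open>(Y / 2 - D)\<^sup>2\<close>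
      by \<open>2 * Y * D\<close>; these weights leave \<open>Y / 2\<close> for the
      conclusion.\<close>
    have "0 \<le> (Y / 2 - D)\<^sup>2" by simp
    then show ?thesis by (simp add: power2_eq_square algebra_simps)
  qed
  finally have "X\<^sup>2 \<le> (Y / 2 + D)\<^sup>2" .
  then have "\<bar>X\<bar> \<le> Y / 2 + D" using YD by (simp add: abs_le_square_iff[symmetric])
  then have "Y / 2 - D \<le> Y - X" by linarith
  moreover have "M * (a * b') - inner w (tent_grad L r x) = Y - X"
    by (simp add: tg inner_add_right X_def Y_def q_def algebra_simps)
  ultimately show "(M - inner w \<nu>) * inner \<nu> (tent_grad L r x) / 2 - 16 * M / (5 / 144 * L\<^sup>2)
     \<le> M * inner \<nu> (tent_grad L r x) - inner w (tent_grad L r x)"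
    by (simp add: G Y_def D_def q_def)
qed

text \<open>Thanks to \<open>1 \<le> L\<close>, both profiles are evaluated in
  \<open>[-1, 1]\<close> on the ball. There \<open>bump_lower\<close> contributes
  \<open>exp (- 4)\<close>, and \<open>ramp_lower\<close> with \<open>ramp'_ge\<close> contributes
  \<open>5 / 144 * exp (- 1)\<close>.\<close>

lemma tent_lower:
  assumes "x \<in> ball p r" "1 \<le> L"
  shows "5 / 144 * exp (- 5) \<le> inner \<nu> (tent_grad L r x)"
proof -
  have "\<bar>tang x\<bar> < r" "\<bar>normal x\<bar> < r" using assms(1) coords_le_dist[of x] by auto
  moreover have "r \<le> L * r" using assms r by simp
  ultimately have "\<bar>tang x\<bar> \<le> L * r" "\<bar>normal x\<bar> \<le> r" by linarith+
  then have *: "\<bar>tang x / (L * r)\<bar> \<le> 1" "\<bar>normal x / r\<bar> \<le> 1"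
    using L r by (auto simp: abs_mult divide_le_eq)
  have "5 / 144 * exp (- 1) \<le> 5 / 144 * ramp (normal x / r)"
    using ramp_lower[OF *(2)] by simp
  also have "\<dots> \<le> ramp' (normal x / r)" using abs_le_D1[OF *(2)] by (rule ramp'_ge)
  finally have "exp (- 4) \<le> bump (tang x / (L * r))" "5 / 144 * exp (- 1) \<le> ramp' (normal x / r)"
    using bump_lower[OF *(1)] by auto
  then have "exp (- 4) * (5 / 144 * exp (- 1)) \<le> bump (tang x / (L * r)) * ramp' (normal x / r)"
    by (intro mult_mono bump_bounds) auto
  also have "\<dots> = inner \<nu> (tent_grad L r x)" by (simp add: tent_grad_def inner_add_right)
  also have "exp (- 4) * (5 / 144 * exp (- 1)) = 5 / 144 * exp (- 5 :: real)"
    using exp_add[of "- 4" "- 1 :: real"] by simp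
  finally show ?thesis .
qed

end

end


section \<open>Points of maximal trace\<close>

text \<open>
  \<open>\<Lambda> R\<close> stands for the mass in \<open>ball p R\<close> of the divergence inside \<open>E\<close> plus that of the trace
  defect on the boundary.
\<close>

locale one_sided_trace = orthonormal_frame p v \<nu>
  for p v \<nu> :: "real ^ 2" +
  fixes E U :: "(real ^ 2) set" and \<phi> :: "real ^ 2 \<Rightarrow> real" and \<xi> :: "real ^ 2 \<Rightarrow> real ^ 2"
    and M :: real and \<Lambda> :: "real \<Rightarrow> real"
  assumes dom: "C1_level_function U \<phi>" "p \<in> U" "\<nu> = sgn (grad \<phi> p)" "E \<inter> U = {x\<in>U. \<phi> x < 0}"
      "open E" "p \<in> frontier E"
    and finite_boundary: "emeasure (hausdorff_measure 1) (frontier E) < \<infinity>"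
    and \<xi>: "\<xi> \<in> borel_measurable lebesgue" "AE x in lebesgue. norm (\<xi> x) \<le> M" "0 \<le> M"
    and flux: "\<And>\<psi> R c. test_function \<psi> \<Longrightarrow> (\<And>x. 0 \<le> \<psi> x \<and> \<psi> x \<le> c) \<Longrightarrow> (\<And>x. \<psi> x \<noteq> 0 \<Longrightarrow> x \<in> ball p R) \<Longrightarrow>
      M * (LINT x:frontier E|hausdorff_measure 1. \<psi> x) \<le>
        (LINT x:E|lebesgue. inner (\<xi> x) (grad \<psi> x)) + c * \<Lambda> R"
    and \<Lambda>: "((\<lambda>r. \<Lambda> r / r) \<longlongrightarrow> 0) (at_right 0)"
begin

lemma defect_nonneg: "AE x in lebesgue. 0 \<le> M - inner (\<xi> x) \<nu> \<and> M - inner (\<xi> x) \<nu> \<le> 2 * M"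
  using \<xi>(2)
proof eventually_elim
  case (elim x)
  have "\<bar>inner (\<xi> x) \<nu>\<bar> \<le> norm (\<xi> x) * norm \<nu>" by (rule Cauchy_Schwarz_ineq2)
  with elim frame show ?case by (auto simp: abs_le_iff)
qed

lemma [measurable]: "\<xi> \<in> borel_measurable lebesgue" "E \<in> sets lebesgue" "ball q r \<in> sets lebesgue"
  using \<xi>(1) dom(5) by (auto intro: sets_completionI_sets)

lemma integrable_defect:
  "integrable lebesgue (\<lambda>x. indicator (E \<inter> ball p r) x * (M - inner (\<xi> x) \<nu>))"
proof (rule Bochner_Integration.integrable_bound)
  have "ball p r \<in> lmeasurable" by simp
  then show "integrable lebesgue (\<lambda>x. indicator (ball p r) x * (2 * M))"
    by (intro integrable_mult_left integrable_real_indicator) (auto simp: fmeasurable_def)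
  show "AE x in lebesgue. norm (indicator (E \<inter> ball p r) x * (M - inner (\<xi> x) \<nu>)) \<le> norm (indicator (ball p r) x * (2 * M))"
    using defect_nonneg by eventually_elim (auto simp: indicator_def)
qed measurable

text \<open>The graph estimate is applied in the window that \<open>tent_supp\<close> dictates.
  Finite boundary length turns its extended-real integral into the Bochner integral that occurs in
  \<open>flux\<close>.\<close>

lemma tent_flux_le:
  assumes "0 < L" "0 < r"
    and graph: "\<And>s t. \<bar>s\<bar> \<le> 2 * L * r \<Longrightarrow> \<bar>t\<bar> \<le> 7 * r \<Longrightarrow> point s t \<in> E \<longleftrightarrow> t < \<gamma> s"
      "\<And>s t. \<bar>s\<bar> \<le> 2 * L * r \<Longrightarrow> \<bar>t\<bar> \<le> 7 * r \<Longrightarrow> point s t \<in> frontier E \<longleftrightarrow> t = \<gamma> s"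
      "\<And>s. \<bar>s\<bar> \<le> 2 * L * r \<Longrightarrow> \<bar>\<gamma> s\<bar> \<le> 7 * r"
  shows "(LINT x:E|lebesgue. inner \<nu> (tent_grad L r x)) \<le> (LINT x:frontier E|hausdorff_measure 1. tent L r x)"
proof -
  have cont: "continuous_on UNIV (\<lambda>x. inner \<nu> (tent_grad L r x))"
    by (intro continuous_intros continuous_tent_grad[OF assms(1,2)])
  have m: "tent L r \<in> borel_measurable (hausdorff_measure 1)"
    by (intro measurable_hausdorff_measureI borel_measurable_continuous_onI continuous_tent assms)
  have fr: "frontier E \<in> sets (hausdorff_measure 1)" by (intro sets_hausdorff_measureI) simp
  have "ennreal (LINT x:E|lborel. inner \<nu> (tent_grad L r x)) \<le>
      (\<integral>\<^sup>+x\<in>frontier E. ennreal (tent L r x) \<partial>hausdorff_measure 1)"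
  proof (rule hausdorff_boundary_ge_flux[where a = "2 * L * r" and b = "7 * r" and \<gamma> = \<gamma>])
    show "((\<lambda>t. tent L r (point s t)) has_real_derivative inner \<nu> (tent_grad L r (point s t))) (at t)" for s t
      unfolding point_def by (intro derivative_along_line tent_has_derivative assms)
  next
    fix x assume "tent L r x \<noteq> 0"
    then show "\<bar>tang x\<bar> \<le> 2 * L * r \<and> \<bar>normal x\<bar> < 7 * r"
      using tent_supp[OF assms(1,2), of x] by simp
  next
    fix x assume "inner \<nu> (tent_grad L r x) \<noteq> 0"
    then have "tent_grad L r x \<noteq> 0" by auto
    then show "\<bar>tang x\<bar> \<le> 2 * L * r \<and> \<bar>normal x\<bar> \<le> 7 * r"
      using tent_supp[OF assms(1,2), of x] by simp
  qed (use assms(1,2) in \<open>simp_all add: graph dom(5) tent_bounds continuous_tent cont\<close>)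
  also have "\<dots> = (\<integral>\<^sup>+x. ennreal (indicator (frontier E) x * tent L r x) \<partial>hausdorff_measure 1)"
    by (intro nn_integral_cong) (auto simp: indicator_def)
  also have "\<dots> = ennreal (LINT x|hausdorff_measure 1. indicator (frontier E) x * tent L r x)"
  proof (rule nn_integral_eq_integral)
    show "integrable (hausdorff_measure 1) (\<lambda>x. indicator (frontier E) x * tent L r x)"
    proof (rule Bochner_Integration.integrable_bound)
      show "integrable (hausdorff_measure 1) (\<lambda>x. indicator (frontier E) x * r)"
        using finite_boundary fr by (intro integrable_mult_left integrable_real_indicator)
      show "(\<lambda>x. indicator (frontier E) x * tent L r x) \<in> borel_measurable (hausdorff_measure 1)"
        by (intro borel_measurable_times borel_measurable_indicator fr m)
      show "AE x in hausdorff_measure 1. norm (indicator (frontier E) x * tent L r x) \<le> norm (indicator (frontier E) x * r)"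
        using tent_bounds[OF assms(1,2)] by (intro AE_I2) (auto simp: indicator_def intro: order_trans[OF _ abs_ge_self])
    qed
    show "AE x in hausdorff_measure 1. 0 \<le> indicator (frontier E) x * tent L r x"
      using tent_bounds[OF assms(1,2)] by (intro AE_I2) auto
  qed
  finally have "(LINT x:E|lborel. inner \<nu> (tent_grad L r x)) \<le> (LINT x|hausdorff_measure 1. indicator (frontier E) x * tent L r x)"
    by (subst (asm) ennreal_le_iff) (auto intro!: integral_nonneg_AE AE_I2 simp: tent_bounds[OF assms(1,2)])
  moreover have "(LINT x:E|lborel. inner \<nu> (tent_grad L r x)) = (LINT x:E|lebesgue. inner \<nu> (tent_grad L r x))"
    unfolding set_lebesgue_integral_def
    using dom(5) borel_measurable_continuous_onI[OF cont] by (intro integral_completion[symmetric]) simp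
  ultimately show ?thesis by (simp add: set_lebesgue_integral_def)
qed

text \<open>The factor 5 / 288 is half the constant of \<open>tent_lower\<close>; the other half is
  spent in \<open>tent_pointwise\<close>. The pointwise loss there is multiplied by
  \<open>56 * L * r\<^sup>2\<close>, the area of a rectangle of sides \<open>4 * L * r\<close> and
  \<open>14 * r\<close> around the support. The radius \<open>10 * L * r\<close> exceeds
  \<open>2 * L * r + 7 * r\<close>.\<close>

lemma defect_integral_le:
  assumes "7 \<le> L"
  shows "\<exists>r0>0. \<forall>r. 0 < r \<longrightarrow> r < r0 \<longrightarrow>
    5 / 288 * exp (- 5) * (LINT x|lebesgue. indicator (E \<inter> ball p r) x * (M - inner (\<xi> x) \<nu>))
      \<le> 16 * M / (5 / 144 * L\<^sup>2) * (56 * L * r\<^sup>2) + r * \<Lambda> (10 * L * r)"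
proof -
  \<comment> \<open>Flatness 1 gives \<open>normal x \<le> r\<close> on \<open>E\<close>, as
    \<open>tent_pointwise\<close> requires; \<open>7 \<le> L\<close> makes the square window of
    half-width \<open>2 * L * r\<close> contain the normal range \<open>7 * r\<close>.\<close>
  obtain r0 where r0: "r0 > 0" "\<And>r. 0 < r \<Longrightarrow> r < r0 \<Longrightarrow> \<exists>\<gamma>. \<forall>s. \<bar>s\<bar> \<le> 2 * L * r \<longrightarrow> \<bar>\<gamma> s\<bar> \<le> 1 * r \<and>
      (\<forall>t. \<bar>t\<bar> \<le> 2 * L * r \<longrightarrow> (point s t \<in> E \<longleftrightarrow> t < \<gamma> s) \<and> (point s t \<in> frontier E \<longleftrightarrow> t = \<gamma> s))"
    using C1_boundary_graph[OF dom, of 1 "2 * L"] assms by auto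
  have "5 / 288 * exp (- 5) * (LINT x|lebesgue. indicator (E \<inter> ball p r) x * (M - inner (\<xi> x) \<nu>))
      \<le> 16 * M / (5 / 144 * L\<^sup>2) * (56 * L * r\<^sup>2) + r * \<Lambda> (10 * L * r)" if r: "0 < r" "r < r0" for r
  proof -
    have L: "0 < L" "1 \<le> L" using assms by auto
    have Lr: "7 * r \<le> L * r" "r \<le> L * r" using assms r by auto
    obtain \<gamma> where \<gamma>: "\<And>s. \<bar>s\<bar> \<le> 2 * L * r \<Longrightarrow> \<bar>\<gamma> s\<bar> \<le> r"
      "\<And>s t. \<bar>s\<bar> \<le> 2 * L * r \<Longrightarrow> \<bar>t\<bar> \<le> 2 * L * r \<Longrightarrow> point s t \<in> E \<longleftrightarrow> t < \<gamma> s"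
      "\<And>s t. \<bar>s\<bar> \<le> 2 * L * r \<Longrightarrow> \<bar>t\<bar> \<le> 2 * L * r \<Longrightarrow> point s t \<in> frontier E \<longleftrightarrow> t = \<gamma> s"
      using r0(2)[OF r] by auto
    define Q where "Q = {x. \<bar>tang x\<bar> \<le> 2 * L * r \<and> - (7 * r) \<le> normal x \<and> normal x \<le> 7 * r}"
    define G where "G x = inner \<nu> (tent_grad L r x)" for x
    define f where "f x = indicator E x * (M * G x - inner (\<xi> x) (tent_grad L r x))" for x
    define D where "D = 16 * M / (5 / 144 * L\<^sup>2)"
    have D0: "0 \<le> D" using \<xi>(3) by (simp add: D_def)
    note ct = continuous_tent_grad[OF L(1) r(1)] and supp = tent_supp[OF L(1) r(1)]
    have Q_eq: "Q = {x. \<bar>tang x\<bar> \<le> 2 * L * r \<and> \<bar>normal x\<bar> \<le> 7 * r}" by (auto simp: Q_def)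
    have cQ: "compact Q" unfolding Q_eq by (rule compact_strip)
    have Qb: "Q \<in> sets lborel" using borel_compact[OF cQ] by simp
    then have [measurable]: "Q \<in> sets lebesgue" by (rule sets_completionI_sets)
    have [measurable]: "tent_grad L r \<in> borel_measurable lebesgue"
      using borel_measurable_continuous_onI[OF ct] by (intro measurable_completion) simp
    have measQ: "emeasure lebesgue Q = ennreal (56 * L * r\<^sup>2)"
    proof -
      have "emeasure lebesgue Q = emeasure lborel Q"
        unfolding emeasure_completion[OF sets_completionI_sets[OF Qb]] main_part[OF Qb] ..
      also have "\<dots> = ennreal (2 * (2 * L * r) * (7 * r - - (7 * r)))"
        unfolding Q_def using L r by (intro emeasure_strip) auto
      finally show ?thesis by (simp add: power2_eq_square mult.assoc)
    qed
    have intQ: "integrable lebesgue (\<lambda>x. D * indicator Q x)"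
      using measQ by (intro integrable_mult_right integrable_real_indicator) auto
    obtain C where C: "\<And>x. x \<in> Q \<Longrightarrow> norm (tent_grad L r x) \<le> C"
    proof -
      have "bounded (tent_grad L r ` Q)"
        using ct cQ by (intro compact_imp_bounded compact_continuous_image) (auto intro: continuous_on_subset)
      then show thesis using that by (auto simp: bounded_iff)
    qed
    have bd: "norm (tent_grad L r x) \<le> C * indicator Q x" for x
      using C[of x] supp[of x] by (cases "tent_grad L r x = 0") (auto simp: indicator_def Q_eq)
    have int1: "integrable lebesgue (\<lambda>x. indicator E x * G x)"
    proof (rule Bochner_Integration.integrable_bound)
      show "integrable lebesgue (\<lambda>x. C * indicator Q x)"
        using measQ by (intro integrable_mult_right integrable_real_indicator) auto
      show "AE x in lebesgue. norm (indicator E x * G x) \<le> norm (C * indicator Q x)"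
      proof (rule AE_I2)
        fix x
        have "norm (indicator E x * G x) \<le> \<bar>G x\<bar>" by (simp add: indicator_def)
        also have "\<dots> \<le> C * indicator Q x"
          using Cauchy_Schwarz_ineq2[of \<nu> "tent_grad L r x"] bd[of x] frame by (simp add: G_def)
        also have "\<dots> \<le> norm (C * indicator Q x)" unfolding real_norm_def by (rule abs_ge_self)
        finally show "norm (indicator E x * G x) \<le> norm (C * indicator Q x)" .
      qed
    qed (simp add: G_def)
    have int2: "integrable lebesgue (\<lambda>x. indicator E x * inner (\<xi> x) (tent_grad L r x))"
    proof (rule Bochner_Integration.integrable_bound)
      show "integrable lebesgue (\<lambda>x. M * C * indicator Q x)"
        using measQ by (intro integrable_mult_right integrable_real_indicator) auto
      show "AE x in lebesgue. norm (indicator E x * inner (\<xi> x) (tent_grad L r x)) \<le> norm (M * C * indicator Q x)"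
        using \<xi>(2)
      proof eventually_elim
        case (elim x)
        have "\<bar>inner (\<xi> x) (tent_grad L r x)\<bar> \<le> norm (\<xi> x) * norm (tent_grad L r x)" by (rule Cauchy_Schwarz_ineq2)
        also have "\<dots> \<le> M * (C * indicator Q x)" using elim bd[of x] \<xi>(3) by (intro mult_mono) auto
        also have "\<dots> \<le> norm (M * C * indicator Q x)" unfolding real_norm_def mult.assoc by (rule abs_ge_self)
        finally have *: "\<bar>inner (\<xi> x) (tent_grad L r x)\<bar> \<le> norm (M * C * indicator Q x)" .
        show ?case
        proof (cases "x \<in> E")
          case True with * show ?thesis by simp
        next
          case False then show ?thesis by simp
        qed
      qed
    qed simp
    have f_eq: "f = (\<lambda>x. M * (indicator E x * G x) - indicator E x * inner (\<xi> x) (tent_grad L r x))"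
      by (simp add: f_def fun_eq_iff algebra_simps)
    have intf: "integrable lebesgue f"
      unfolding f_eq by (intro Bochner_Integration.integrable_diff integrable_mult_right int1 int2)
    have "(LINT x|lebesgue. f x) = M * (LINT x:E|lebesgue. G x) - (LINT x:E|lebesgue. inner (\<xi> x) (grad (tent L r) x))"
      unfolding f_eq set_lebesgue_integral_def grad_tent[OF L(1) r(1)]
      using int1 int2 by simp
    also have "\<dots> \<le> M * (LINT x:frontier E|hausdorff_measure 1. tent L r x) -
        (LINT x:E|lebesgue. inner (\<xi> x) (grad (tent L r) x))"
    proof -
      have "(LINT x:E|lebesgue. G x) \<le> (LINT x:frontier E|hausdorff_measure 1. tent L r x)"
        unfolding G_def
      proof (rule tent_flux_le[OF L(1) r(1), where \<gamma> = \<gamma>])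
        fix s t assume s: "\<bar>s\<bar> \<le> 2 * L * r" and t: "\<bar>t\<bar> \<le> 7 * r"
        then have t': "\<bar>t\<bar> \<le> 2 * L * r" using Lr by linarith
        show "point s t \<in> E \<longleftrightarrow> t < \<gamma> s" by (rule \<gamma>(2)[OF s t'])
        show "point s t \<in> frontier E \<longleftrightarrow> t = \<gamma> s" by (rule \<gamma>(3)[OF s t'])
      next
        fix s assume "\<bar>s\<bar> \<le> 2 * L * r"
        from \<gamma>(1)[OF this] show "\<bar>\<gamma> s\<bar> \<le> 7 * r" using r by linarith
      qed
      then show ?thesis using \<xi>(3) by (simp add: mult_left_mono)
    qed
    also have "\<dots> \<le> r * \<Lambda> (10 * L * r)"
    proof -
      have "x \<in> ball p (10 * L * r)" if "tent L r x \<noteq> 0" for x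
        using norm_le_coords[of x] supp[of x] that Lr by auto
      from flux[OF test_function_tent[OF L(1) r(1)] _ this, of r] show ?thesis
        using tent_bounds[OF L(1) r(1)] by simp
    qed
    finally have up: "(LINT x|lebesgue. f x) \<le> r * \<Lambda> (10 * L * r)" .
    \<comment> \<open>\<open>?d\<close> bounds \<open>f\<close> from below pointwise: on the ball it
      keeps the gain of \<open>tent_lower\<close>, elsewhere only the sign of the defect is used,
      and the loss \<open>D\<close> is charged on all of \<open>Q\<close>.\<close>
    let ?d = "\<lambda>x. 5 / 288 * exp (- 5) * (indicator (E \<inter> ball p r) x * (M - inner (\<xi> x) \<nu>)) - D * indicator Q x"
    have "(LINT x|lebesgue. ?d x) \<le> (LINT x|lebesgue. f x)"
    proof (rule integral_mono_AE)
      show "integrable lebesgue ?d"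
        by (intro Bochner_Integration.integrable_diff integrable_mult_right[OF integrable_defect] intQ)
      show "AE x in lebesgue. ?d x \<le> f x"
        using defect_nonneg \<xi>(2)
      proof eventually_elim
        case (elim x)
        have ballQ: "x \<in> Q" if "x \<in> ball p r"
        proof -
          have "\<bar>tang x\<bar> < r" "\<bar>normal x\<bar> < r" using that coords_le_dist[of x] by auto
          then have "\<bar>tang x\<bar> \<le> 2 * L * r" "\<bar>normal x\<bar> \<le> 7 * r" using Lr r by linarith+
          then show ?thesis by (simp add: Q_eq)
        qed
        show ?case
        proof (cases "x \<in> E \<inter> Q")
          case False
          have "f x = 0"
          proof (cases "x \<in> E")
            case True
            then have "tent_grad L r x = 0" using False supp[of x] by (force simp: Q_eq)
            then show ?thesis by (simp add: f_def G_def)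
          qed (simp add: f_def)
          moreover have "x \<notin> E \<inter> ball p r" using False ballQ by auto
          ultimately show ?thesis using D0 by simp
        next
          case True
          then have "\<bar>tang x\<bar> \<le> 2 * L * r" "\<bar>normal x\<bar> \<le> 7 * r" by (auto simp: Q_eq)
          then have tn: "\<bar>tang x\<bar> \<le> 2 * L * r" "\<bar>normal x\<bar> \<le> 2 * L * r" using Lr by linarith+
          then have "normal x < \<gamma> (tang x)" using \<gamma>(2)[OF tn] True by simp
          then have nr: "normal x \<le> r" using \<gamma>(1)[OF tn(1)] by linarith
          note tp = tent_pointwise[OF L(1) r(1) nr \<xi>(3) elim(2)]
          have "5 / 288 * exp (- 5) * (indicator (E \<inter> ball p r) x * (M - inner (\<xi> x) \<nu>))
            \<le> (M - inner (\<xi> x) \<nu>) * G x / 2"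
          proof (cases "x \<in> ball p r")
            case b: True
            have "5 / 144 * exp (- 5) * (M - inner (\<xi> x) \<nu>) \<le> G x * (M - inner (\<xi> x) \<nu>)"
              using tent_lower[OF L(1) r(1) b L(2)] elim(1) by (intro mult_right_mono) (auto simp: G_def)
            with True b show ?thesis by (simp add: mult.commute)
          next
            case False
            have "0 \<le> (M - inner (\<xi> x) \<nu>) * G x" using elim(1) tp(2) by (simp add: G_def)
            with False show ?thesis by simp
          qed
          moreover have "(M - inner (\<xi> x) \<nu>) * G x / 2 - D \<le> f x"
            using tp(1) True by (simp add: f_def G_def D_def)
          moreover have "D * indicator Q x = D" using True by simp
          ultimately show ?thesis by linarith
        qed
      qed
    qed (fact intf)
    also have "(LINT x|lebesgue. ?d x) = 5 / 288 * exp (- 5) * (LINT x|lebesgue. indicator (E \<inter> ball p r) x * (M - inner (\<xi> x) \<nu>)) - D * measure lebesgue Q"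
      using integrable_defect[of r] intQ by (subst Bochner_Integration.integral_diff) auto
    also have "measure lebesgue Q = 56 * L * r\<^sup>2"
      using measQ L r by (simp add: measure_def)
    finally show ?thesis using up by (simp add: D_def)
  qed
  with r0(1) show ?thesis by blast
qed

section \<open>From the integrated defect to the approximate limit\<close>

lemma measure_ball_2: "0 \<le> r \<Longrightarrow> measure lebesgue (ball q r) = pi * r\<^sup>2" for q :: "real ^ 2"
  using content_ball[of r q] by (simp add: unit_ball_vol_2)

text \<open>Chebyshev's inequality, with the squared deviation from \<open>M *\<^sub>R \<nu>\<close>
  at most \<open>2 * M\<close> times the defect. The half ball is not contained in \<open>E\<close>;
  its part outside \<open>E\<close> lies in the strip \<open>Z\<close> between the tangent line and
  depth \<open>\<delta> * r\<close>.\<close>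

lemma deviation_set_le:
  assumes "0 < r" "0 < \<alpha>"
    and \<gamma>: "\<And>s. \<bar>s\<bar> \<le> r \<Longrightarrow> \<bar>\<gamma> s\<bar> \<le> \<delta> * r"
      "\<And>s t. \<bar>s\<bar> \<le> r \<Longrightarrow> \<bar>t\<bar> \<le> r \<Longrightarrow> point s t \<in> E \<longleftrightarrow> t < \<gamma> s"
  shows "measure lebesgue ({x \<in> half_ball (- \<nu>) 1 p. norm (\<xi> x - M *\<^sub>R \<nu>) \<ge> \<alpha>} \<inter> ball p r) \<le>
     2 * \<delta> * r\<^sup>2 + 2 * M / \<alpha>\<^sup>2 * (LINT x|lebesgue. indicator (E \<inter> ball p r) x * (M - inner (\<xi> x) \<nu>))"
proof -
  define N where "N = {x \<in> half_ball (- \<nu>) 1 p. norm (\<xi> x - M *\<^sub>R \<nu>) \<ge> \<alpha>} \<inter> ball p r"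
  define Z where "Z = {x. \<bar>tang x\<bar> \<le> r \<and> - (\<delta> * r) \<le> normal x \<and> normal x \<le> 0}"
  define W where "W = {x \<in> E \<inter> ball p r. norm (\<xi> x - M *\<^sub>R \<nu>) \<ge> \<alpha>}"
  have \<delta>: "0 \<le> \<delta> * r" using \<gamma>(1)[of 0] assms by linarith
  then have \<delta>0: "0 \<le> \<delta>" using assms(1) by (simp add: zero_le_mult_iff)
  have [measurable]: "{x. norm (\<xi> x - M *\<^sub>R \<nu>) \<ge> \<alpha>} \<in> sets lebesgue"
  proof -
    have "{x \<in> space lebesgue. \<alpha> \<le> norm (\<xi> x - M *\<^sub>R \<nu>)} \<in> sets lebesgue" by measurable
    then show ?thesis by simp
  qed
  have "W = (E \<inter> ball p r) \<inter> {x. norm (\<xi> x - M *\<^sub>R \<nu>) \<ge> \<alpha>}" by (auto simp: W_def)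
  then have W: "W \<in> sets lebesgue" by simp
  have Wf: "W \<in> lmeasurable"
    using W by (rule fmeasurableI2[OF lmeasurable_ball, rotated]) (auto simp: W_def)
  have "open {x. 0 < inner (x - p) (- \<nu>)}" by (intro open_Collect_less continuous_intros)
  then have hb: "half_ball (- \<nu>) 1 p \<in> sets lebesgue"
    unfolding half_ball_def by (auto intro!: sets_completionI_sets simp: Collect_conj_eq)
  have "N = (half_ball (- \<nu>) 1 p \<inter> ball p r) \<inter> {x. norm (\<xi> x - M *\<^sub>R \<nu>) \<ge> \<alpha>}" by (auto simp: N_def)
  then have N: "N \<in> sets lebesgue" using hb by simp
  have "closed Z" unfolding Z_def by (intro closed_Collect_conj closed_Collect_le continuous_intros)
  then have Zb: "Z \<in> sets lborel" by simp
  have eZ: "emeasure lebesgue Z = ennreal (2 * \<delta> * r\<^sup>2)"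
    unfolding emeasure_completion[OF sets_completionI_sets[OF Zb]] main_part[OF Zb] unfolding Z_def
    using assms \<delta> by (subst emeasure_strip) (auto simp: power2_eq_square algebra_simps)
  have Zf: "Z \<in> lmeasurable"
    using sets_completionI_sets[OF Zb] eZ by (simp add: fmeasurable_def)
  have mZ: "measure lebesgue Z = 2 * \<delta> * r\<^sup>2"
    using eZ \<delta>0 by (simp add: measure_def)
  have "N \<subseteq> W \<union> Z"
  proof
    fix x assume x: "x \<in> N"
    then have "\<bar>tang x\<bar> \<le> r" "\<bar>normal x\<bar> \<le> r" "normal x < 0"
      using coords_le_dist[of x] by (auto simp: N_def half_ball_def normal_def)
    then show "x \<in> W \<union> Z"
      using \<gamma>(2)[of "tang x" "normal x"] \<gamma>(1)[of "tang x"] x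
      by (cases "x \<in> E") (auto simp: N_def W_def Z_def)
  qed
  then have "measure lebesgue N \<le> measure lebesgue (W \<union> Z)"
    using N Wf Zf by (intro measure_mono_fmeasurable) auto
  also have "\<dots> \<le> measure lebesgue W + measure lebesgue Z"
    using Wf Zf by (intro measure_Un_le) (auto dest: fmeasurableD)
  finally have 1: "measure lebesgue N \<le> measure lebesgue W + 2 * \<delta> * r\<^sup>2" by (simp add: mZ)
  let ?I = "LINT x|lebesgue. indicator (E \<inter> ball p r) x * (M - inner (\<xi> x) \<nu>)"
  have "\<alpha>\<^sup>2 * measure lebesgue W = (LINT x|lebesgue. \<alpha>\<^sup>2 * indicator W x)"
    using W by simp
  also have "\<dots> \<le> (LINT x|lebesgue. 2 * M * (indicator (E \<inter> ball p r) x * (M - inner (\<xi> x) \<nu>)))"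
  proof (rule integral_mono_AE)
    show "integrable lebesgue (\<lambda>x. \<alpha>\<^sup>2 * indicator W x)"
      using Wf by (intro integrable_mult_right integrable_real_indicator) (auto simp: fmeasurable_def)
    show "integrable lebesgue (\<lambda>x. 2 * M * (indicator (E \<inter> ball p r) x * (M - inner (\<xi> x) \<nu>)))"
      by (intro integrable_mult_right integrable_defect)
    show "AE x in lebesgue. \<alpha>\<^sup>2 * indicator W x \<le> 2 * M * (indicator (E \<inter> ball p r) x * (M - inner (\<xi> x) \<nu>))"
      using \<xi>(2) defect_nonneg
    proof eventually_elim
      case (elim x)
      have "(norm (\<xi> x - M *\<^sub>R \<nu>))\<^sup>2 = (norm (\<xi> x))\<^sup>2 + M\<^sup>2 - 2 * M * inner (\<xi> x) \<nu>"
        by (simp add: power2_norm_eq_inner inner_diff_left inner_diff_right inner_commute power2_eq_square[of M])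
      also have "\<dots> \<le> M\<^sup>2 + M\<^sup>2 - 2 * M * inner (\<xi> x) \<nu>"
        using elim(1) by (simp add: power_mono)
      also have "\<dots> = 2 * M * (M - inner (\<xi> x) \<nu>)" by (simp add: power2_eq_square algebra_simps)
      finally have *: "(norm (\<xi> x - M *\<^sub>R \<nu>))\<^sup>2 \<le> 2 * M * (M - inner (\<xi> x) \<nu>)" .
      show ?case
      proof (cases "x \<in> W")
        case True
        then have "\<alpha>\<^sup>2 \<le> (norm (\<xi> x - M *\<^sub>R \<nu>))\<^sup>2" using assms(2) by (intro power_mono) (auto simp: W_def)
        with * True show ?thesis by (simp add: W_def)
      next
        case False
        then show ?thesis using elim(2) \<xi>(3) by simp
      qed
    qed
  qed
  also have "\<dots> = 2 * M * ?I" by simp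
  finally have "measure lebesgue W \<le> 2 * M / \<alpha>\<^sup>2 * ?I"
    using assms(2) by (simp add: field_simps)
  with 1 show ?thesis by (simp add: N_def)
qed

text \<open>Three errors get \<open>\<epsilon> / 4 * r\<^sup>2\<close> each: \<open>L\<close>
  handles the tangential loss, \<delta> the strip, and afterwards a small \<open>r\<close> handles
  \<Lambda>. Their sum is below \<epsilon> times the area of the ball because
  \<open>3 / 4 < pi\<close>.\<close>

lemma ap_lim: "has_ap_lim_minus \<xi> \<nu> p (M *\<^sub>R \<nu>)"
  unfolding has_ap_lim_minus_def density_zero_def
proof (intro allI impI)
  fix \<alpha> :: real assume \<alpha>: "0 < \<alpha>"
  let ?N = "{x \<in> half_ball (- \<nu>) 1 p. norm (\<xi> x - M *\<^sub>R \<nu>) \<ge> \<alpha>}"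
  let ?I = "\<lambda>r. LINT x|lebesgue. indicator (E \<inter> ball p r) x * (M - inner (\<xi> x) \<nu>)"
  show "((\<lambda>r. measure lebesgue (?N \<inter> ball p r) / measure lebesgue (ball p r)) \<longlongrightarrow> 0) (at_right 0)"
  proof (rule tendstoI)
    fix \<epsilon> :: real assume \<epsilon>: "0 < \<epsilon>"
    define k where "k = 5 / 288 * exp (- 5 :: real)"
    \<comment> \<open>\<open>A\<close> passes from the estimate of \<open>defect_integral_le\<close>
      to the Chebyshev bound, and \<open>B / L\<close> is the coefficient of
      \<open>r\<^sup>2\<close> that results.\<close>
    define A where "A = 2 * M / \<alpha>\<^sup>2 / k"
    define B where "B = A * (16 * M / (5 / 144) * 56)"
    have k: "0 < k" and A: "0 \<le> A" and B: "0 \<le> B" using \<xi>(3) \<alpha> by (auto simp: k_def A_def B_def)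
    define L where "L = max 7 (4 * B / \<epsilon>)"
    have L: "7 \<le> L" "B / L \<le> \<epsilon> / 4"
      using \<epsilon> by (auto simp: L_def field_simps max_def)
    define \<delta> where "\<delta> = min 1 (\<epsilon> / 8)"
    have \<delta>: "0 < \<delta>" "\<delta> \<le> 1" "\<delta> \<le> \<epsilon> / 8" using \<epsilon> by (auto simp: \<delta>_def)
    obtain r1 where r1: "r1 > 0" "\<And>r. 0 < r \<Longrightarrow> r < r1 \<Longrightarrow>
        k * ?I r \<le> 16 * M / (5 / 144 * L\<^sup>2) * (56 * L * r\<^sup>2) + r * \<Lambda> (10 * L * r)"
      using defect_integral_le[OF L(1)] unfolding k_def by blast
    obtain r2 where r2: "r2 > 0" "\<And>r. 0 < r \<Longrightarrow> r < r2 \<Longrightarrow> \<exists>\<gamma>. \<forall>s. \<bar>s\<bar> \<le> 1 * r \<longrightarrow> \<bar>\<gamma> s\<bar> \<le> \<delta> * r \<and>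
      (\<forall>t. \<bar>t\<bar> \<le> 1 * r \<longrightarrow> (point s t \<in> E \<longleftrightarrow> t < \<gamma> s) \<and> (point s t \<in> frontier E \<longleftrightarrow> t = \<gamma> s))"
      using C1_boundary_graph[OF dom \<delta>(1,2)] by blast
    \<comment> \<open>The factor \<open>10 * L\<close> undoes the enlarged radius at which \<Lambda>
      is evaluated; \<open>A + 1\<close> avoids a division by zero when
      \<open>M = 0\<close>.\<close>
    define \<epsilon>' where "\<epsilon>' = \<epsilon> / (4 * (A + 1) * (10 * L))"
    have "0 < \<epsilon>'" using \<epsilon> A L by (simp add: \<epsilon>'_def)
    then have "\<forall>\<^sub>F r in at_right 0. dist (\<Lambda> r / r) 0 < \<epsilon>'" using \<Lambda> by (rule tendstoD[rotated])
    then obtain r3 where r3: "r3 > 0" "\<And>r. 0 < r \<Longrightarrow> r < r3 \<Longrightarrow> dist (\<Lambda> r / r) 0 < \<epsilon>'"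
      unfolding eventually_at_right_field by blast
    have r3': "\<Lambda> r / r < \<epsilon>'" if "0 < r" "r < r3" for r
      using abs_ge_self r3(2)[OF that] unfolding dist_real_def diff_0_right by (rule order.strict_trans1)
    have "dist (measure lebesgue (?N \<inter> ball p r) / measure lebesgue (ball p r)) 0 < \<epsilon>"
      if r: "0 < r" "r < r1" "r < r2" "r < r3 / (10 * L)" for r
    proof -
      obtain \<gamma> where "\<forall>s. \<bar>s\<bar> \<le> 1 * r \<longrightarrow> \<bar>\<gamma> s\<bar> \<le> \<delta> * r \<and>
        (\<forall>t. \<bar>t\<bar> \<le> 1 * r \<longrightarrow> (point s t \<in> E \<longleftrightarrow> t < \<gamma> s) \<and> (point s t \<in> frontier E \<longleftrightarrow> t = \<gamma> s))"
        using r2(2)[OF r(1,3)] by blast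
      then have "measure lebesgue (?N \<inter> ball p r) \<le> 2 * \<delta> * r\<^sup>2 + 2 * M / \<alpha>\<^sup>2 * ?I r"
        by (intro deviation_set_le[where \<gamma> = \<gamma>] r \<alpha>) auto
      also have "2 * M / \<alpha>\<^sup>2 * ?I r = A * (k * ?I r)" using k by (simp add: A_def)
      also have "\<dots> \<le> A * (16 * M / (5 / 144 * L\<^sup>2) * (56 * L * r\<^sup>2) + r * \<Lambda> (10 * L * r))"
        using r1(2)[OF r(1,2)] A by (rule mult_left_mono)
      also have "\<dots> = B / L * r\<^sup>2 + A * r * \<Lambda> (10 * L * r)"
        using L by (simp add: B_def power2_eq_square field_simps)
      also have "\<dots> \<le> \<epsilon> / 4 * r\<^sup>2 + \<epsilon> / 4 * r\<^sup>2"
      proof (rule add_mono)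
        show "B / L * r\<^sup>2 \<le> \<epsilon> / 4 * r\<^sup>2" using L by (intro mult_right_mono) auto
        have "10 * L * r < r3" "0 < 10 * L * r" using r L by (auto simp: field_simps)
        then have "\<Lambda> (10 * L * r) / (10 * L * r) < \<epsilon>'" using r3' by blast
        then have "\<Lambda> (10 * L * r) \<le> \<epsilon>' * (10 * L * r)"
          using \<open>0 < 10 * L * r\<close> by (simp add: pos_divide_less_eq)
        also have "\<dots> = \<epsilon> / (4 * (A + 1)) * r" using L by (simp add: \<epsilon>'_def)
        finally have "A * r * \<Lambda> (10 * L * r) \<le> A * r * (\<epsilon> / (4 * (A + 1)) * r)"
          using A r by (intro mult_left_mono) auto
        also have "\<dots> = (A / (A + 1)) * (\<epsilon> / 4 * r\<^sup>2)" by (simp add: power2_eq_square algebra_simps)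
        also have "\<dots> \<le> 1 * (\<epsilon> / 4 * r\<^sup>2)" using A \<epsilon> by (intro mult_right_mono) auto
        finally show "A * r * \<Lambda> (10 * L * r) \<le> \<epsilon> / 4 * r\<^sup>2" by simp
      qed
      also have "2 * \<delta> * r\<^sup>2 \<le> \<epsilon> / 4 * r\<^sup>2" using \<delta> by (intro mult_right_mono) auto
      finally have "measure lebesgue (?N \<inter> ball p r) \<le> 3 / 4 * \<epsilon> * r\<^sup>2" by simp
      also have "\<dots> < \<epsilon> * (pi * r\<^sup>2)"
      proof -
        have "3 / 4 < pi" using pi_gt3 by simp
        then have "(3 / 4) * (\<epsilon> * r\<^sup>2) < pi * (\<epsilon> * r\<^sup>2)" using \<epsilon> r by (intro mult_strict_right_mono) auto
        then show ?thesis by (simp add: mult_ac)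
      qed
      finally have "measure lebesgue (?N \<inter> ball p r) < \<epsilon> * measure lebesgue (ball p r)"
        unfolding measure_ball_2[OF less_imp_le[OF r(1)]] .
      moreover have "0 < measure lebesgue (ball p r)"
        using r unfolding measure_ball_2[OF less_imp_le[OF r(1)]] by simp
      ultimately show ?thesis by (simp add: dist_real_def pos_divide_less_eq)
    qed
    then show "\<forall>\<^sub>F r in at_right 0. dist (measure lebesgue (?N \<inter> ball p r) / measure lebesgue (ball p r)) 0 < \<epsilon>"
      unfolding eventually_at_right_field
      using r1(1) r2(1) r3(1) L(1) by (intro exI[of _ "min (min r1 r2) (r3 / (10 * L))"]) auto
  qed
qed

end

section \<open>The flux inequality at almost every point of maximal trace\<close>

lemma set_integral_bound:
  fixes \<psi> :: "'a \<Rightarrow> real"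
  assumes "B \<in> sets M" "C \<in> sets M" "emeasure M (B \<inter> C) < \<infinity>"
    "\<And>x. 0 \<le> \<psi> x \<and> \<psi> x \<le> c" "\<And>x. \<psi> x \<noteq> 0 \<Longrightarrow> x \<in> C"
  shows "\<bar>LINT x:B|M. \<psi> x\<bar> \<le> c * measure M (B \<inter> C)"
proof -
  have c: "0 \<le> c" using assms(4) by (meson order_trans)
  have "\<bar>LINT x:B|M. \<psi> x\<bar> \<le> (LINT x|M. c * indicator (B \<inter> C) x)"
  proof (cases "integrable M (\<lambda>x. indicator B x *\<^sub>R \<psi> x)")
    case True
    have "0 \<le> (LINT x:B|M. \<psi> x)"
      unfolding set_lebesgue_integral_def using assms(4) by (intro integral_nonneg_AE AE_I2) simp
    then have "\<bar>LINT x:B|M. \<psi> x\<bar> = (LINT x|M. indicator B x *\<^sub>R \<psi> x)" by (simp add: set_lebesgue_integral_def)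
    also have "\<dots> \<le> (LINT x|M. c * indicator (B \<inter> C) x)"
    proof (rule integral_mono[OF True])
      show "integrable M (\<lambda>x. c * indicator (B \<inter> C) x)"
        using assms by (intro integrable_mult_right integrable_real_indicator) auto
      show "indicator B x *\<^sub>R \<psi> x \<le> c * indicator (B \<inter> C) x" for x
        using assms(4)[of x] assms(5)[of x] c by (cases "\<psi> x = 0") (auto simp: indicator_def)
    qed
    finally show ?thesis .
  next
    \<comment> \<open>A function that is not integrable has integral 0 by convention, so the bound
      is trivial here.\<close>
    case False
    then have "(LINT x:B|M. \<psi> x) = 0"
      unfolding set_lebesgue_integral_def by (rule not_integrable_integral_eq)
    moreover have "0 \<le> (LINT x|M. c * indicator (B \<inter> C) x)"
      using c by (intro integral_nonneg_AE AE_I2) simp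
    ultimately show ?thesis by simp
  qed
  also have "\<dots> = c * measure M (B \<inter> C)" using assms by simp
  finally show ?thesis .
qed

text \<open>The open set \<open>E\<close> is disjoint from its frontier, so the restriction of \<mu>
  to \<open>E\<close> gives the frontier no mass and the covering lemma applies. It is a finite
  measure because the closure of \<open>E\<close> is compact.\<close>

lemma AE_density_zero_on_frontier:
  fixes \<mu> :: "(real ^ 2) measure"
  assumes \<mu>: "radon_measure \<mu>" and E: "open E" "bounded E"
  shows "AE x in hausdorff_measure 1. x \<in> frontier E \<longrightarrow>
    ((\<lambda>r. measure \<mu> (E \<inter> ball x r) / r) \<longlongrightarrow> 0) (at_right 0)"
proof -
  have sets: "sets \<mu> = sets borel" using \<mu> by (simp add: radon_measure_def)
  have fin: "emeasure \<mu> E < \<infinity>"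
  proof -
    have "emeasure \<mu> E \<le> emeasure \<mu> (closure E)"
      by (intro emeasure_mono closure_subset) (simp add: sets)
    also have "\<dots> < \<infinity>" using \<mu> E by (simp add: radon_measure_def compact_closure)
    finally show ?thesis .
  qed
  define \<theta> where "\<theta> = density \<mu> (indicator E)"
  have \<theta>: "emeasure \<theta> B = emeasure \<mu> (E \<inter> B)" if "B \<in> sets borel" for B
  proof -
    have "emeasure \<theta> B = (\<integral>\<^sup>+x. indicator E x * indicator B x \<partial>\<mu>)"
      unfolding \<theta>_def by (intro emeasure_density borel_measurable_indicator) (use that E sets in auto)
    then show ?thesis using that E by (simp add: indicator_inter_arith[symmetric] sets)
  qed
  have s\<theta>: "sets \<theta> = sets borel" by (simp add: \<theta>_def sets)
  have "emeasure \<theta> (frontier E) = 0"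
    using E by (subst \<theta>) (auto simp: frontier_def interior_open)
  then have "AE x in hausdorff_measure 1. x \<in> frontier E \<longrightarrow> ((\<lambda>r. measure \<theta> (ball x r) / r) \<longlongrightarrow> 0) (at_right 0)"
    using fin by (intro AE_hausdorff_1_density_zero s\<theta> outer_regular_null_set) (simp_all add: \<theta>)
  moreover have "measure \<theta> (ball x r) = measure \<mu> (E \<inter> ball x r)" for x r
    by (simp add: measure_def \<theta>)
  ultimately show ?thesis by simp
qed

text \<open>
  The density lemma needs open neighbourhoods of \<open>{x\<in>F. h x = M}\<close> of small \<open>\<bar>h - M\<bar>\<close>-mass. As \<open>h\<close> is
  only measurable for the complete Hausdorff measure, this set need not be Borel, so it is first
  replaced by a Borel hull of the same measure.
\<close>

lemma AE_Lebesgue_point_on_boundary: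
  fixes F :: "(real ^ 2) set" and h :: "real ^ 2 \<Rightarrow> real"
  assumes F: "F \<in> sets borel" and fin: "emeasure (hausdorff_measure 1) F < \<infinity>"
    and h: "set_borel_measurable (hausdorff_measure 1) F h"
    and bd: "AE x in hausdorff_measure 1. x \<in> F \<longrightarrow> \<bar>h x\<bar> \<le> C"
  shows "AE x in hausdorff_measure 1. x \<in> F \<and> h x = M \<longrightarrow>
    ((\<lambda>r. (LINT y|hausdorff_measure 1. indicator (F \<inter> ball x r) y * \<bar>h y - M\<bar>) / r) \<longlongrightarrow> 0) (at_right 0)"
proof -
  let ?H = "hausdorff_measure 1 :: (real ^ 2) measure"
  have FH: "F \<in> sets ?H" by (rule sets_hausdorff_measureI[OF F])
  define w where "w y = indicator F y * \<bar>h y - M\<bar>" for y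
  have hF: "(\<lambda>y. indicator F y * h y) \<in> borel_measurable ?H"
    using h by (simp add: set_borel_measurable_def)
  have iF: "(indicator F :: _ \<Rightarrow> real) \<in> borel_measurable ?H" by (rule borel_measurable_indicator[OF FH])
  \<comment> \<open>Measurability is given only for the product of \<open>h\<close> with the
    indicator of \<open>F\<close>, so \<open>w\<close> is rewritten in terms of it.\<close>
  have w_eq: "w = (\<lambda>y. \<bar>indicator F y * h y - indicator F y * M\<bar>)"
    by (auto simp: w_def fun_eq_iff indicator_def)
  have wm: "w \<in> borel_measurable ?H"
    unfolding w_eq by (intro borel_measurable_abs borel_measurable_diff borel_measurable_times hF iF borel_measurable_const)
  have w0: "0 \<le> w y" for y by (simp add: w_def)
  have intw: "integrable ?H w"
  proof (rule Bochner_Integration.integrable_bound)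
    show "integrable ?H (\<lambda>y. (\<bar>C\<bar> + \<bar>M\<bar>) * indicator F y)"
      using FH fin by (intro integrable_mult_right integrable_real_indicator)
    show "AE y in ?H. norm (w y) \<le> norm ((\<bar>C\<bar> + \<bar>M\<bar>) * indicator F y)"
      using bd by eventually_elim (auto simp: w_def indicator_def)
  qed (fact wm)
  \<comment> \<open>Pushing forward by the identity restricts the measure from the Caratheodory sets
    to the Borel sets, where outer regularity and the covering lemma operate.\<close>
  define \<theta> where "\<theta> = distr (density ?H (\<lambda>y. ennreal (w y))) borel (\<lambda>y. y)"
  have idm: "(\<lambda>y. y) \<in> borel_measurable (density ?H (\<lambda>y. ennreal (w y)))"
    unfolding measurable_density_eq1 by (rule measurable_hausdorff_measureI) simp
  have \<theta>: "emeasure \<theta> B = (\<integral>\<^sup>+y. ennreal (w y) * indicator B y \<partial>?H)" if B: "B \<in> sets borel" for B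
  proof -
    have "emeasure \<theta> B = emeasure (density ?H (\<lambda>y. ennreal (w y))) ((\<lambda>y. y) -` B \<inter> UNIV)"
      unfolding \<theta>_def emeasure_distr[OF idm B] space_density space_hausdorff_measure ..
    also have "\<dots> = emeasure (density ?H (\<lambda>y. ennreal (w y))) B" by simp
    also have "\<dots> = (\<integral>\<^sup>+y. ennreal (w y) * indicator B y \<partial>?H)"
      by (intro emeasure_density measurable_compose[OF wm measurable_ennreal] sets_hausdorff_measureI B)
    finally show ?thesis .
  qed
  have \<theta>m: "measure \<theta> B = (LINT y|?H. indicator B y * w y)" if B: "B \<in> sets borel" for B
  proof -
    have "emeasure \<theta> B = (\<integral>\<^sup>+y. ennreal (indicator B y * w y) \<partial>?H)"
      unfolding \<theta>[OF B] by (intro nn_integral_cong) (auto simp: indicator_def)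
    also have "\<dots> = ennreal (LINT y|?H. indicator B y * w y)"
    proof (rule nn_integral_eq_integral)
      show "integrable ?H (\<lambda>y. indicator B y * w y)"
        using integrable_mult_indicator[OF sets_hausdorff_measureI[OF B] intw] by simp
    qed (simp add: w0)
    finally show ?thesis
      by (simp add: measure_def w0 integral_nonneg_AE)
  qed
  have s\<theta>: "sets \<theta> = sets borel" by (simp add: \<theta>_def)
  have f\<theta>: "emeasure \<theta> UNIV < \<infinity>"
  proof -
    have "emeasure \<theta> UNIV = (\<integral>\<^sup>+y. ennreal (w y) \<partial>?H)" by (subst \<theta>) auto
    also have "\<dots> = ennreal (LINT y|?H. w y)" using intw w0 by (simp add: nn_integral_eq_integral)
    finally show ?thesis by simp
  qed
  define A where "A = {x\<in>F. h x = M}"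
  have AH: "A \<in> sets ?H"
  proof -
    have "w -` {0} \<inter> space ?H \<in> sets ?H" using wm by (rule measurable_sets) simp
    then have "F \<inter> (w -` {0} \<inter> space ?H) \<in> sets ?H" using FH by (rule sets.Int[rotated])
    moreover have "F \<inter> (w -` {0} \<inter> space ?H) = A" by (auto simp: A_def w_def)
    ultimately show ?thesis by simp
  qed
  have finA: "emeasure ?H A < \<infinity>"
    using emeasure_mono[of A F ?H] FH fin by (auto simp: A_def)
  then obtain B where B: "B \<in> sets borel" "A \<subseteq> B" "hausdorff_outer 1 B = hausdorff_outer 1 A"
    using hausdorff_borel_hull[of 1 A] emeasure_hausdorff_measure[OF AH] by auto
  have BH: "B \<in> sets ?H" by (rule sets_hausdorff_measureI[OF B(1)])
  have "emeasure ?H (B - A) = emeasure ?H B - emeasure ?H A"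
    using finA B(2) AH BH by (intro emeasure_Diff) auto
  also have "\<dots> = 0"
    unfolding emeasure_hausdorff_measure[OF AH] emeasure_hausdorff_measure[OF BH] B(3)
    using finA[unfolded emeasure_hausdorff_measure[OF AH]] by (simp add: diff_eq_0_iff_ennreal)
  finally have nB: "B - A \<in> null_sets ?H" using AH BH by (intro null_setsI) auto
  \<comment> \<open>The difference \<open>B - A\<close> is null because \<open>A\<close> has finite
    measure, and \<open>w\<close> vanishes on \<open>A\<close>.\<close>
  have "emeasure \<theta> B = (\<integral>\<^sup>+y. 0 \<partial>?H)"
    unfolding \<theta>[OF B(1)]
  proof (rule nn_integral_cong_AE)
    show "AE y in ?H. ennreal (w y) * indicator B y = 0"
      using AE_not_in[OF nB] by eventually_elim (auto simp: A_def w_def indicator_def)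
  qed
  then have "emeasure \<theta> B = 0" by simp
  then have "\<exists>U. open U \<and> A \<subseteq> U \<and> emeasure \<theta> U < ennreal \<epsilon>" if "\<epsilon> > 0" for \<epsilon>
    using outer_regular_null_set[OF s\<theta> f\<theta> B(1) _ that] B(2) by blast
  from AE_hausdorff_1_density_zero[OF s\<theta> f\<theta> this]
  have "AE x in ?H. x \<in> A \<longrightarrow> ((\<lambda>r. measure \<theta> (ball x r) / r) \<longlongrightarrow> 0) (at_right 0)" .
  moreover have "measure \<theta> (ball x r) = (LINT y|?H. indicator (F \<inter> ball x r) y * \<bar>h y - M\<bar>)" for x r
    by (subst \<theta>m) (auto simp: w_def indicator_inter_arith ac_simps intro!: Bochner_Integration.integral_cong)
  ultimately show ?thesis by (simp add: A_def)
qed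

text \<open>\<open>real_of_ereal\<close> is faithful only for a finite essential supremum. The
  essential bound on \<xi> excludes \<infinity>, and negative values are excluded since the whole
  space is not a null set.\<close>

lemma bounded_field_Linf_norm:
  fixes \<xi> :: "'a::euclidean_space \<Rightarrow> 'a"
  assumes "bounded_field \<xi>"
  shows "AE x in lebesgue. norm (\<xi> x) \<le> Linf_norm \<xi>" "0 \<le> Linf_norm \<xi>"
proof -
  let ?f = "\<lambda>x. ereal (norm (\<xi> x))"
  obtain C where C: "\<xi> \<in> borel_measurable lebesgue" "AE x in lebesgue. norm (\<xi> x) \<le> C"
    using assms by (auto simp: bounded_field_def)
  have m: "?f \<in> borel_measurable lebesgue" using C(1) by measurable
  have "esssup lebesgue ?f \<le> ereal C" using C(2) by (intro esssup_I m) auto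
  moreover have "ereal 0 \<le> esssup lebesgue ?f"
  proof (rule ccontr)
    assume n: "\<not> ereal 0 \<le> esssup lebesgue ?f"
    have "AE x in (lebesgue :: 'a measure). False"
      using esssup_AE[of ?f lebesgue]
    proof eventually_elim
      case (elim x)
      have "ereal 0 \<le> ereal (norm (\<xi> x))" by simp
      then show ?case using elim n by (meson order_trans)
    qed
    then show False using AE_iff_measurable[of UNIV "lebesgue :: 'a measure" "\<lambda>x. False"] by simp
  qed
  ultimately have e: "esssup lebesgue ?f = ereal (Linf_norm \<xi>)"
    unfolding Linf_norm_def by (cases "esssup lebesgue ?f") auto
  show "0 \<le> Linf_norm \<xi>" using \<open>ereal 0 \<le> esssup lebesgue ?f\<close> unfolding e by simp
  show "AE x in lebesgue. norm (\<xi> x) \<le> Linf_norm \<xi>"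
    using esssup_AE[of ?f lebesgue] unfolding e by simp
qed

lemma surface_dim: "DIM(real ^ 2) - 1 = 1"
  by simp

text \<open>The exceptional set comes from the densities alone. The frame and the level function are
  chosen afterwards, point by point, so \<nu> can be quantified inside and later be taken from
  \<open>S\<close>.\<close>

lemma AE_maximal_trace_ap_lim:
  fixes \<xi> :: "real ^ 2 \<Rightarrow> real ^ 2" and E :: "(real ^ 2) set"
  assumes \<xi>: "\<xi> \<in> borel_measurable lebesgue" "AE x in lebesgue. norm (\<xi> x) \<le> M" "0 \<le> M"
    and E: "C1_domain E" "bounded E" and tr: "weak_normal_trace \<xi> E h"
  shows "AE x in hausdorff_measure 1. \<forall>\<nu>. outer_normal E x \<nu> \<and> h x = M \<longrightarrow> has_ap_lim_minus \<xi> \<nu> x (M *\<^sub>R \<nu>)"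
proof -
  let ?H = "hausdorff_measure 1 :: (real ^ 2) measure" and ?F = "frontier E"
  have "open E" using E by (simp add: C1_domain_def)
  obtain C m where hm: "set_borel_measurable ?H ?F h"
    and hC: "AE x in ?H. x \<in> ?F \<longrightarrow> \<bar>h x\<bar> \<le> C"
    and m: "has_divergence \<xi> m"
    and trace: "\<And>\<psi>. test_function \<psi> \<Longrightarrow> signed_integral m E \<psi> + (LINT x:E|lebesgue. inner (\<xi> x) (grad \<psi> x)) =
           (LINT x:?F|?H. \<psi> x * h x)"
    using tr unfolding weak_normal_trace_def surface_dim by blast
  have radon: "radon_measure (fst m)" "radon_measure (snd m)" using m by (auto simp: has_divergence_def)
  have finF: "emeasure ?H ?F < \<infinity>" using E by (rule hausdorff_frontier_finite)
  have FH: "?F \<in> sets ?H" by (intro sets_hausdorff_measureI) simp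
  \<comment> \<open>The three summands vanish relative to \<open>r\<close> at almost every point in
    question, each by its own density statement.\<close>
  define \<Lambda> where "\<Lambda> x r = measure (fst m) (E \<inter> ball x r) + measure (snd m) (E \<inter> ball x r) +
    (LINT y|?H. indicator (?F \<inter> ball x r) y * \<bar>h y - M\<bar>)" for x r
  have "AE x in ?H. x \<in> ?F \<and> h x = M \<longrightarrow> ((\<lambda>r. \<Lambda> x r / r) \<longlongrightarrow> 0) (at_right 0)"
    using AE_density_zero_on_frontier[OF radon(1) \<open>open E\<close> E(2)]
      AE_density_zero_on_frontier[OF radon(2) \<open>open E\<close> E(2)]
      AE_Lebesgue_point_on_boundary[OF borel_closed[OF frontier_closed] finF hm hC, of M]
  proof eventually_elim
    case (elim x)
    show ?case
    proof
      assume x: "x \<in> ?F \<and> h x = M"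
      then have "((\<lambda>r. measure (fst m) (E \<inter> ball x r) / r + measure (snd m) (E \<inter> ball x r) / r +
        (LINT y|?H. indicator (?F \<inter> ball x r) y * \<bar>h y - M\<bar>) / r) \<longlongrightarrow> 0 + 0 + 0) (at_right 0)"
        using elim by (intro tendsto_add) auto
      then show "((\<lambda>r. \<Lambda> x r / r) \<longlongrightarrow> 0) (at_right 0)"
        by (simp add: \<Lambda>_def add_divide_distrib)
    qed
  qed
  then show ?thesis
  proof eventually_elim
    case (elim x)
    show ?case
    proof (intro allI impI)
      fix \<nu> assume \<nu>: "outer_normal E x \<nu> \<and> h x = M"
      then obtain U \<phi> where U: "x \<in> ?F" "x \<in> U" "C1_level_function U \<phi>" "E \<inter> U = {x\<in>U. \<phi> x < 0}"
        "\<nu> = sgn (grad \<phi> x)" by (auto simp: outer_normal_def)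
      have n\<nu>: "norm \<nu> = 1" using \<nu> outer_normal_norm by blast
      from exists_orthogonal_unit[OF this] obtain v where v: "norm v = 1" "inner v \<nu> = 0" by blast
      interpret one_sided_trace x v \<nu> E U \<phi> \<xi> M "\<Lambda> x"
      proof
        fix \<psi> :: "real ^ 2 \<Rightarrow> real" and R c :: real
        assume \<psi>: "test_function \<psi>" "\<And>y. 0 \<le> \<psi> y \<and> \<psi> y \<le> c" "\<And>y. \<psi> y \<noteq> 0 \<Longrightarrow> y \<in> ball x R"
        have c: "0 \<le> c" using \<psi>(2) by (meson order_trans)
        \<comment> \<open>The two measures representing the divergence are estimated one at a time,
          so any representing pair will do.\<close>
        have si: "\<bar>LINT y:E|\<mu>. \<psi> y\<bar> \<le> c * measure \<mu> (E \<inter> ball x R)" if "radon_measure \<mu>" for \<mu>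
        proof (rule set_integral_bound)
          have s: "sets \<mu> = sets borel" using that by (simp add: radon_measure_def)
          show "E \<in> sets \<mu>" "ball x R \<in> sets \<mu>" using \<open>open E\<close> by (simp_all add: s)
          have "emeasure \<mu> (E \<inter> ball x R) \<le> emeasure \<mu> (cball x R)"
            by (intro emeasure_mono) (auto simp: s)
          also have "\<dots> < \<infinity>" using that by (simp add: radon_measure_def)
          finally show "emeasure \<mu> (E \<inter> ball x R) < \<infinity>" .
        qed (use \<psi> in auto)
        have \<psi>m: "\<psi> \<in> borel_measurable ?H"
        proof -
          have "Ck_on 0 UNIV \<psi>" using \<psi>(1) unfolding test_function_def by blast
          then show ?thesis by (intro measurable_hausdorff_measureI borel_measurable_continuous_onI) simp
        qed
        have hF: "(\<lambda>y. indicator ?F y * h y) \<in> borel_measurable ?H"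
          using hm by (simp add: set_borel_measurable_def)
        have i1: "integrable ?H (\<lambda>y. indicator ?F y * \<psi> y)"
        proof (rule Bochner_Integration.integrable_bound)
          show "integrable ?H (\<lambda>y. c * indicator ?F y)"
            using FH finF by (intro integrable_mult_right integrable_real_indicator)
          show "AE y in ?H. norm (indicator ?F y * \<psi> y) \<le> norm (c * indicator ?F y)"
            using \<psi>(2) c by (intro AE_I2) (auto simp: indicator_def)
        qed (intro borel_measurable_times borel_measurable_indicator FH \<psi>m)
        have i2: "integrable ?H (\<lambda>y. indicator ?F y * (\<psi> y * h y))"
        proof (rule Bochner_Integration.integrable_bound)
          show "integrable ?H (\<lambda>y. c * \<bar>C\<bar> * indicator ?F y)"
            using FH finF by (intro integrable_mult_right integrable_real_indicator)
          show "AE y in ?H. norm (indicator ?F y * (\<psi> y * h y)) \<le> norm (c * \<bar>C\<bar> * indicator ?F y)"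
            using hC
          proof eventually_elim
            case (elim y)
            have "\<bar>\<psi> y\<bar> * \<bar>h y\<bar> \<le> c * \<bar>C\<bar>" if "y \<in> ?F"
              using elim that \<psi>(2)[of y] c by (intro mult_mono) auto
            then show ?case using c by (auto simp: indicator_def abs_mult)
          qed
          have "(\<lambda>y. indicator ?F y * (\<psi> y * h y)) = (\<lambda>y. \<psi> y * (indicator ?F y * h y))" by (simp add: ac_simps)
          then show "(\<lambda>y. indicator ?F y * (\<psi> y * h y)) \<in> borel_measurable ?H"
            by (simp only:) (intro borel_measurable_times \<psi>m hF)
        qed
        have i3: "integrable ?H (\<lambda>y. indicator (?F \<inter> ball x R) y * \<bar>h y - M\<bar>)"
        proof (rule Bochner_Integration.integrable_bound)
          show "integrable ?H (\<lambda>y. (\<bar>C\<bar> + \<bar>M\<bar>) * indicator ?F y)"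
            using FH finF by (intro integrable_mult_right integrable_real_indicator)
          show "AE y in ?H. norm (indicator (?F \<inter> ball x R) y * \<bar>h y - M\<bar>) \<le> norm ((\<bar>C\<bar> + \<bar>M\<bar>) * indicator ?F y)"
            using hC by eventually_elim (auto simp: indicator_def)
          have "(\<lambda>y. indicator (?F \<inter> ball x R) y * \<bar>h y - M\<bar>) =
            (\<lambda>y. indicator (ball x R) y * \<bar>indicator ?F y * h y - indicator ?F y * M\<bar>)"
            by (auto simp: fun_eq_iff indicator_def)
          moreover have "ball x R \<in> sets ?H" by (intro sets_hausdorff_measureI) simp
          ultimately show "(\<lambda>y. indicator (?F \<inter> ball x R) y * \<bar>h y - M\<bar>) \<in> borel_measurable ?H"
            by (simp only:) (intro borel_measurable_abs borel_measurable_diff borel_measurable_times hF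
                borel_measurable_indicator FH borel_measurable_const)
        qed
        \<comment> \<open>Replacing the trace by \<open>M\<close> costs at most \<open>c\<close>
          times the local mass of \<open>\<bar>h - M\<bar>\<close>, since \<psi> lies between 0 and
          \<open>c\<close> and is supported in the ball.\<close>
        have "M * (LINT y:?F|?H. \<psi> y) - (LINT y:?F|?H. \<psi> y * h y) =
            (LINT y|?H. M * (indicator ?F y * \<psi> y) - indicator ?F y * (\<psi> y * h y))"
          using i1 i2 by (simp add: set_lebesgue_integral_def)
        also have "\<dots> \<le> (LINT y|?H. c * (indicator (?F \<inter> ball x R) y * \<bar>h y - M\<bar>))"
        proof (rule integral_mono)
          show "integrable ?H (\<lambda>y. M * (indicator ?F y * \<psi> y) - indicator ?F y * (\<psi> y * h y))"
            using i1 i2 by simp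
          show "integrable ?H (\<lambda>y. c * (indicator (?F \<inter> ball x R) y * \<bar>h y - M\<bar>))" using i3 by simp
          fix y
          show "M * (indicator ?F y * \<psi> y) - indicator ?F y * (\<psi> y * h y) \<le> c * (indicator (?F \<inter> ball x R) y * \<bar>h y - M\<bar>)"
          proof (cases "y \<in> ?F \<and> \<psi> y \<noteq> 0")
            case True
            have "\<psi> y * (M - h y) \<le> c * \<bar>h y - M\<bar>"
            proof -
              have "\<psi> y * (M - h y) \<le> \<psi> y * \<bar>h y - M\<bar>" using \<psi>(2)[of y] by (intro mult_left_mono) auto
              also have "\<dots> \<le> c * \<bar>h y - M\<bar>" using \<psi>(2)[of y] by (intro mult_right_mono) auto
              finally show ?thesis .
            qed
            with True \<psi>(3)[of y] show ?thesis by (simp add: algebra_simps)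
          next
            case False
            then show ?thesis using c by auto
          qed
        qed
        finally have "M * (LINT y:?F|?H. \<psi> y) \<le> (LINT y:?F|?H. \<psi> y * h y) +
            c * (LINT y|?H. indicator (?F \<inter> ball x R) y * \<bar>h y - M\<bar>)"
          by simp
        also have "(LINT y:?F|?H. \<psi> y * h y) = (LINT y:E|fst m. \<psi> y) - (LINT y:E|snd m. \<psi> y) +
            (LINT x:E|lebesgue. inner (\<xi> x) (grad \<psi> x))"
          using trace[OF \<psi>(1)] by (simp add: signed_integral_def)
        finally show "M * (LINT y:?F|?H. \<psi> y) \<le> (LINT x:E|lebesgue. inner (\<xi> x) (grad \<psi> x)) + c * \<Lambda> x R"
          using si[OF radon(1)] si[OF radon(2)] unfolding \<Lambda>_def distrib_left abs_le_iff by linarith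
      qed (use v n\<nu> U \<nu> elim \<xi> \<open>open E\<close> finF in auto)
      show "has_ap_lim_minus \<xi> \<nu> x (M *\<^sub>R \<nu>)" by (rule ap_lim)
    qed
  qed
qed

theorem theorem1p4:
  fixes \<xi> \<nu> :: "real ^ 2 \<Rightarrow> real ^ 2" and S :: "(real ^ 2) set" and g :: "real ^ 2 \<Rightarrow> real"
  assumes "\<xi> \<in> DM_inf"
    and "oriented_rectifiable S \<nu>"
    and "locally_finite_measure 1 S"
    and "weak_normal_trace_on \<xi> S \<nu> g"
  shows "AE x in hausdorff_measure 1. x \<in> S \<and> g x = Linf_norm \<xi> \<longrightarrow>
           has_ap_lim_minus \<xi> (\<nu> x) x (Linf_norm \<xi> *\<^sub>R \<nu> x)"
proof -
  have bf: "bounded_field \<xi>" using assms(1) by (simp add: DM_inf_def)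
  then have \<xi>: "\<xi> \<in> borel_measurable lebesgue" by (simp add: bounded_field_def)
  obtain A E h where A: "\<And>i::nat. bounded (E i)" "\<And>i. C1_domain (E i)"
      "\<And>i x. x \<in> A i \<Longrightarrow> outer_normal (E i) x (\<nu> x)" "\<And>i. weak_normal_trace \<xi> (E i) (h i)"
      "\<And>i. AE x in hausdorff_measure 1. x \<in> A i \<longrightarrow> g x = h i x"
    and cover: "AE x in hausdorff_measure 1. x \<in> S \<longrightarrow> x \<in> (\<Union>i. A i)"
    using assms(4) unfolding weak_normal_trace_on_def surface_dim by blast
  \<comment> \<open>The pieces are countably many, so one exceptional set serves all of them; on
    \<open>A i\<close> the trace \<open>g\<close> is that of \<open>E i\<close>, and \<nu> is the
    outer normal of \<open>E i\<close>.\<close>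
  have "AE x in hausdorff_measure 1. \<forall>i. x \<in> A i \<and> g x = Linf_norm \<xi> \<longrightarrow>
      has_ap_lim_minus \<xi> (\<nu> x) x (Linf_norm \<xi> *\<^sub>R \<nu> x)"
    unfolding AE_all_countable
  proof
    fix i
    show "AE x in hausdorff_measure 1. x \<in> A i \<and> g x = Linf_norm \<xi> \<longrightarrow>
        has_ap_lim_minus \<xi> (\<nu> x) x (Linf_norm \<xi> *\<^sub>R \<nu> x)"
      using AE_maximal_trace_ap_lim[OF \<xi> bounded_field_Linf_norm[OF bf] A(2)[of i] A(1)[of i] A(4)[of i]] A(5)[of i]
    proof eventually_elim
      case (elim x)
      then show ?case using A(3)[of x i] by metis
    qed
  qed
  with cover show ?thesis by eventually_elim blast
qed

end
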